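(* Let $E\in\mathcal G$ be a Banach space with $\sigma_{E'}=-1$ such that the bilinear estimate $$\sup_{0<t<T}\|\mathcal B(u,v)(t)\|_{E'}\le K\sup_{0<t<T}\|u(t)\|_{E'}\sup_{0<t<T}\|v(t)\|_{E'}$$ holds for all $u,v\in L^\infty((0,T);E')$ and $T\in(0,\infty]$, with $K>0$ a universal constant. Assume that there exist Banach spaces $E_3,E_4\in\mathcal G$ such that (for all $s>0$ and all $f,g$ in the relevant spaces): (U1) $-1<\sigma_{E_3'}<1$; (U2) $\|U(s)f\|_{E_3'}\le C\|f\|_{E_3'}$; (U3) $\|U(s)f\|_{E_3'}\le Cs^{\frac12(\sigma_{E'}-\sigma_{E_3'})}\|f\|_{E'}$; (U4) $\|f\cdot g\|_{E_4'}\le C\|f\|_{E'}\|g\|_{E_3'}$; (U5) $\|\nabla U(s)\mathbb Pf\|_{E'}\le Cs^{\frac12(\sigma_{E_4'}-\sigma_{E'})-\frac12}\|f\|_{E_4'}$. Then, if $u$ and $v$ are two mild solutions of the Navier–Stokes equations in $C([0,T);E')$ with the same initial data $u_0\in\tilde{E'}$, it follows that $u(\cdot,t)=v(\cdot,t)$ in $E'$ for all $t\in[0,T)$. Here $\tilde{E'}$ is the maximal closed subspace of $E'$ in which the heat semigroup $\{U(t)\}_{t\ge0}$ is strongly continuous.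
   Context: All spaces are over $\mathbb R^n$, $n\ge3$; $E'$ is the dual of $E$. $\mathcal G$ is the class of Banach spaces $F\subset\mathcal S'$ for which there exist $\sigma_F\in\mathbb R$ and $C>0$ with $f(\lambda\cdot)\in F$ and $\|f(\lambda\cdot)\|_F\le C\lambda^{\sigma_F}\|f\|_F$ for all $\lambda>0$, $f\in F$; $\sigma_F$ is the scaling exponent of $F$, and $\sigma_{E'},\sigma_{E_3'},\sigma_{E_4'}$ are the scaling exponents of the dual spaces. $U(t)f=\Phi(t,\cdot)*f$, $\Phi(t,x)=(4\pi t)^{-n/2}e^{-|x|^2/(4t)}$; $\mathbb P=(\delta_{kj}+\mathcal R_k\mathcal R_j)_{k,j}$ is the Leray projector, $\mathcal R_j$ the Riesz transforms; for vector fields $u,v$ (norms componentwise) $$\mathcal B(u,v)(t)=-\int_0^t\nabla U(t-s)\cdot\mathbb P(u\otimes v)(s)\,ds,$$ the integral being understood weakly by duality with $E$. The Navier–Stokes equations are $\partial_tu-\Delta u+\mathbb P(u\cdot\nabla)u=0$, $\nabla\cdot u=0$, $u(\cdot,0)=u_0$ in $\mathbb R^n$; a mild solution is a $u$ with $u(t)=U(t)u_0+\mathcal B(u,u)(t)$. *)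

theory Defs
  imports "HOL-Analysis.Analysis"
begin

section \<open>Schwartz functions and tempered distributions\<close>

definition partial_deriv :: "'n::finite \<Rightarrow> (real^'n \<Rightarrow> complex) \<Rightarrow> real^'n \<Rightarrow> complex" where
  "partial_deriv i f x = vector_derivative (\<lambda>h. f (x + h *\<^sub>R axis i 1)) (at 0)"

primrec partial_derivs :: "'n::finite list \<Rightarrow> (real^'n \<Rightarrow> complex) \<Rightarrow> real^'n \<Rightarrow> complex" where
  "partial_derivs [] f = f"
| "partial_derivs (i # is) f = partial_deriv i (partial_derivs is f)"

definition schwartz :: "(real^'n::finite \<Rightarrow> complex) \<Rightarrow> bool" where
  "schwartz \<phi> \<longleftrightarrow>
     (\<forall>is. partial_derivs is \<phi> differentiable_on UNIV) \<and>
     (\<forall>is N. \<exists>C. \<forall>x. (1 + norm x) ^ N * cmod (partial_derivs is \<phi> x) \<le> C)"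

definition test_function :: "(real^'n::finite \<Rightarrow> complex) \<Rightarrow> bool" where
  "test_function \<phi> \<longleftrightarrow> schwartz \<phi> \<and> bounded {x. \<phi> x \<noteq> 0}"

definition schwartz_seminorm :: "nat \<Rightarrow> (real^'n::finite \<Rightarrow> complex) \<Rightarrow> real" where
  "schwartz_seminorm N \<phi> =
     (SUP (is, x) \<in> {is. length is \<le> N} \<times> UNIV. (1 + norm x) ^ N * cmod (partial_derivs is \<phi> x))"

text \<open>A distribution is a functional on all functions, normalised to vanish off the Schwartz
  space, so that two tempered distributions are equal as soon as they agree on Schwartz functions
  and the vector space operations are the pointwise ones.\<close>

type_synonym 'n dist = "(real^'n \<Rightarrow> complex) \<Rightarrow> complex"

definition tempered :: "'n::finite dist \<Rightarrow> bool" where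
  "tempered f \<longleftrightarrow>
     (\<forall>\<phi>. \<not> schwartz \<phi> \<longrightarrow> f \<phi> = 0) \<and>
     (\<forall>\<phi> \<psi>. schwartz \<phi> \<longrightarrow> schwartz \<psi> \<longrightarrow> f (\<lambda>x. \<phi> x + \<psi> x) = f \<phi> + f \<psi>) \<and>
     (\<forall>c \<phi>. schwartz \<phi> \<longrightarrow> f (\<lambda>x. c * \<phi> x) = c * f \<phi>) \<and>
     (\<exists>C N. \<forall>\<phi>. schwartz \<phi> \<longrightarrow> cmod (f \<phi>) \<le> C * schwartz_seminorm N \<phi>)"

definition dist_add :: "'n::finite dist \<Rightarrow> 'n dist \<Rightarrow> 'n dist" where
  "dist_add f g = (\<lambda>\<phi>. f \<phi> + g \<phi>)"

definition dist_diff :: "'n::finite dist \<Rightarrow> 'n dist \<Rightarrow> 'n dist" where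
  "dist_diff f g = (\<lambda>\<phi>. f \<phi> - g \<phi>)"

definition dist_scale :: "complex \<Rightarrow> 'n::finite dist \<Rightarrow> 'n dist" where
  "dist_scale c f = (\<lambda>\<phi>. c * f \<phi>)"

definition dist_zero :: "'n::finite dist" where
  "dist_zero = (\<lambda>\<phi>. 0)"

definition dist_of_schwartz :: "(real^'n::finite \<Rightarrow> complex) \<Rightarrow> 'n dist" where
  "dist_of_schwartz \<psi> = (\<lambda>\<phi>. if schwartz \<phi> then LINT x|lebesgue. \<psi> x * \<phi> x else 0)"

text \<open>The distribution \<open>f(\<lambda>\<cdot>)\<close>.\<close>

definition dilate :: "real \<Rightarrow> 'n::finite dist \<Rightarrow> 'n dist" where
  "dilate l f =
     (\<lambda>\<phi>. if schwartz \<phi> then f (\<lambda>x. \<phi> (x /\<^sub>R l)) / of_real (l ^ CARD('n)) else 0)"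

text \<open>\<open>f = F\<close> as distributions, for a locally integrable function \<open>F\<close>. Testing is against
  compactly supported functions only, because \<open>F * \<phi>\<close> need not be integrable for
  all Schwartz \<open>\<phi>\<close> even when \<open>f\<close> is tempered.\<close>

definition represents :: "(real^'n::finite \<Rightarrow> complex) \<Rightarrow> 'n dist \<Rightarrow> bool" where
  "represents F f \<longleftrightarrow> tempered f \<and>
     (\<forall>S. compact S \<longrightarrow> F absolutely_integrable_on S) \<and>
     (\<forall>\<phi>. test_function \<phi> \<longrightarrow> f \<phi> = (LINT x|lebesgue. F x * \<phi> x))"

text \<open>\<open>h = f \<cdot> g\<close>, the pointwise product of locally integrable functions.\<close>

definition is_product :: "'n::finite dist \<Rightarrow> 'n dist \<Rightarrow> 'n dist \<Rightarrow> bool" where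
  "is_product f g h \<longleftrightarrow>
     (\<exists>F G. represents F f \<and> represents G g \<and> represents (\<lambda>x. F x * G x) h)"


section \<open>Banach spaces of distributions and their duals\<close>

record 'n dist_space =
  points :: "'n dist set"
  nrm :: "'n dist \<Rightarrow> real"

text \<open>A complex Banach space contained in the tempered distributions, with continuous inclusion.\<close>

definition banach_dist_space :: "('n::finite) dist_space \<Rightarrow> bool" where
  "banach_dist_space F \<longleftrightarrow>
     (\<forall>f\<in>points F. tempered f) \<and>
     dist_zero \<in> points F \<and>
     (\<forall>f\<in>points F. \<forall>g\<in>points F. dist_add f g \<in> points F \<and>
        nrm F (dist_add f g) \<le> nrm F f + nrm F g) \<and>
     (\<forall>c. \<forall>f\<in>points F. dist_scale c f \<in> points F \<and> nrm F (dist_scale c f) = cmod c * nrm F f) \<and>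
     (\<forall>f\<in>points F. 0 \<le> nrm F f \<and> (nrm F f = 0 \<longrightarrow> f = dist_zero)) \<and>
     (\<forall>X::nat \<Rightarrow> 'n dist. (\<forall>k. X k \<in> points F) \<longrightarrow>
        (\<forall>e>0. \<exists>M. \<forall>i\<ge>M. \<forall>k\<ge>M. nrm F (dist_diff (X i) (X k)) < e) \<longrightarrow>
        (\<exists>f\<in>points F. (\<lambda>k. nrm F (dist_diff (X k) f)) \<longlonglongrightarrow> 0)) \<and>
     (\<forall>\<phi>. schwartz \<phi> \<longrightarrow> (\<exists>C. \<forall>f\<in>points F. cmod (f \<phi>) \<le> C * nrm F f))"

definition scaling_exponent :: "('n::finite) dist_space \<Rightarrow> real \<Rightarrow> bool" where
  "scaling_exponent F \<sigma> \<longleftrightarrow>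
     (\<exists>C>0. \<forall>l>0. \<forall>f\<in>points F.
        dilate l f \<in> points F \<and> nrm F (dilate l f) \<le> C * l powr \<sigma> * nrm F f)"

definition class_G :: "('n::finite) dist_space \<Rightarrow> bool" where
  "class_G F \<longleftrightarrow> banach_dist_space F \<and> (\<exists>\<sigma>. scaling_exponent F \<sigma>)"

text \<open>The Schwartz functions form a dense subspace of \<open>F\<close>. This is what makes the dual of \<open>F\<close> a
  space of tempered distributions: a bounded functional is determined by its restriction to
  Schwartz functions.\<close>

definition schwartz_dense :: "('n::finite) dist_space \<Rightarrow> bool" where
  "schwartz_dense F \<longleftrightarrow>
     (\<forall>\<phi>. schwartz \<phi> \<longrightarrow> dist_of_schwartz \<phi> \<in> points F) \<and>
     (\<forall>f\<in>points F. \<forall>e>0. \<exists>\<phi>. schwartz \<phi> \<and> nrm F (dist_diff f (dist_of_schwartz \<phi>)) < e)"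

definition bounded_functional :: "('n::finite) dist_space \<Rightarrow> ('n dist \<Rightarrow> complex) \<Rightarrow> bool" where
  "bounded_functional F L \<longleftrightarrow>
     (\<forall>f\<in>points F. \<forall>g\<in>points F. L (dist_add f g) = L f + L g) \<and>
     (\<forall>c. \<forall>f\<in>points F. L (dist_scale c f) = c * L f) \<and>
     (\<exists>C. \<forall>f\<in>points F. cmod (L f) \<le> C * nrm F f)"

text \<open>The functional \<open>L\<close> on \<open>F\<close> is identified with the distribution \<open>f\<close>.\<close>

definition induces :: "('n::finite) dist_space \<Rightarrow> ('n dist \<Rightarrow> complex) \<Rightarrow> 'n dist \<Rightarrow> bool" where
  "induces F L f \<longleftrightarrow> bounded_functional F L \<and>
     (\<forall>\<phi>. schwartz \<phi> \<longrightarrow> f \<phi> = L (dist_of_schwartz \<phi>))"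

text \<open>The value at \<open>e \<in> F\<close> of the functional identified with \<open>f\<close>. If \<open>schwartz_dense F\<close>,
  all possible choices agree on \<open>F\<close>.\<close>

definition pairing :: "('n::finite) dist_space \<Rightarrow> 'n dist \<Rightarrow> 'n dist \<Rightarrow> complex" where
  "pairing F f e = (SOME L. induces F L f) e"

definition dual :: "('n::finite) dist_space \<Rightarrow> 'n dist_space" where
  "dual F = \<lparr> points = {f. tempered f \<and> (\<exists>L. induces F L f)},
              nrm = (\<lambda>f. SUP e \<in> {e \<in> points F. nrm F e \<le> 1}. cmod (pairing F f e)) \<rparr>"


section \<open>Heat semigroup and Leray projector\<close>

definition heat_kernel :: "real \<Rightarrow> real^'n::finite \<Rightarrow> real" where
  "heat_kernel t x = (4 * pi * t) powr (- real CARD('n) / 2) * exp (- (norm x)\<^sup>2 / (4 * t))"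

text \<open>\<open>\<Phi>(t,\<cdot>) * f\<close>, by transposition (\<open>\<Phi>(t,\<cdot>)\<close> is even); \<open>U(0)\<close> is the identity.\<close>

definition heat :: "real \<Rightarrow> 'n::finite dist \<Rightarrow> 'n dist" where
  "heat t f = (if t = 0 then f else
     (\<lambda>\<phi>. if schwartz \<phi>
           then f (\<lambda>x. LINT y|lebesgue. of_real (heat_kernel t (x - y)) * \<phi> y) else 0))"

definition fourier :: "(real^'n::finite \<Rightarrow> complex) \<Rightarrow> real^'n \<Rightarrow> complex" where
  "fourier \<phi> \<xi> = (LINT x|lebesgue. exp (- (\<i> * of_real (\<xi> \<bullet> x))) * \<phi> x)"

definition inv_fourier :: "(real^'n::finite \<Rightarrow> complex) \<Rightarrow> real^'n \<Rightarrow> complex" where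
  "inv_fourier \<psi> x =
     (LINT \<xi>|lebesgue. exp (\<i> * of_real (\<xi> \<bullet> x)) * \<psi> \<xi>) / of_real ((2 * pi) ^ CARD('n))"

definition cutoff :: "(real^'n::finite \<Rightarrow> complex) \<Rightarrow> bool" where
  "cutoff \<eta> \<longleftrightarrow> test_function \<eta> \<and> (\<exists>r>0. \<forall>\<xi>. norm \<xi> < r \<longrightarrow> \<eta> \<xi> = 1)"

text \<open>\<open>g = m(D) f\<close> for a symbol \<open>m\<close> that is smooth only away from the origin. Such an \<open>m\<close> does not
  act on all tempered distributions; \<open>m(D) f\<close> is the limit of \<open>((1 - \<eta>(\<cdot>/\<epsilon>)) m)(D) f\<close> as
  \<open>\<epsilon> \<rightarrow> 0\<close>, required to exist in the sense of distributions and not to depend on the cutoff \<open>\<eta>\<close>.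
  The regularised symbol acts on \<open>f\<close> by transposition, which reflects \<open>\<xi>\<close>. For kernels
  of size \<open>O((1 + |x|)^(-n-1))\<close>, like that of \<open>\<nabla>U(s)P\<close>, and for functions \<open>f\<close> such that
  \<open>(1 + |x|)^(-n-1) f\<close> is integrable, the limit is the convolution integral.\<close>

definition is_multiplier ::
  "(real^'n::finite \<Rightarrow> complex) \<Rightarrow> 'n dist \<Rightarrow> 'n dist \<Rightarrow> bool" where
  "is_multiplier m f g \<longleftrightarrow> tempered f \<and> tempered g \<and>
     (\<forall>\<eta> \<phi>. cutoff \<eta> \<longrightarrow> schwartz \<phi> \<longrightarrow>
        ((\<lambda>\<epsilon>. f (inv_fourier (\<lambda>\<xi>. (1 - \<eta> (- \<xi> /\<^sub>R \<epsilon>)) * m (- \<xi>) * fourier \<phi> \<xi>)))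
          \<longlongrightarrow> g \<phi>) (at_right 0))"

definition riesz_symbol :: "'n::finite \<Rightarrow> real^'n \<Rightarrow> complex" where
  "riesz_symbol j \<xi> = - \<i> * of_real (\<xi> $ j / norm \<xi>)"

definition leray_symbol :: "'n::finite \<Rightarrow> 'n \<Rightarrow> real^'n \<Rightarrow> complex" where
  "leray_symbol j k \<xi> = (if j = k then 1 else 0) + riesz_symbol j \<xi> * riesz_symbol k \<xi>"

definition grad_heat_leray_symbol :: "real \<Rightarrow> 'n::finite \<Rightarrow> 'n \<Rightarrow> 'n \<Rightarrow> real^'n \<Rightarrow> complex" where
  "grad_heat_leray_symbol s l j k \<xi> =
     (\<i> * of_real (\<xi> $ l)) * of_real (exp (- s * (norm \<xi>)\<^sup>2)) * leray_symbol j k \<xi>"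

text \<open>\<open>g\<close> is the derivative in direction \<open>l\<close> of component \<open>j\<close> of \<open>U(s)P f\<close>, for a vector field \<open>f\<close>.
  The composition is a single multiplier, since \<open>P f\<close> alone may fail to exist.\<close>

definition grad_heat_leray ::
  "real \<Rightarrow> ('n::finite \<Rightarrow> 'n dist) \<Rightarrow> 'n \<Rightarrow> 'n \<Rightarrow> 'n dist \<Rightarrow> bool" where
  "grad_heat_leray s f l j g \<longleftrightarrow>
     (\<exists>h. (\<forall>k. is_multiplier (grad_heat_leray_symbol s l j k) (f k) (h k)) \<and>
          g = (\<lambda>\<phi>. \<Sum>k\<in>UNIV. h k \<phi>))"

text \<open>\<open>g = \<nabla>U(s) \<cdot> P(u \<otimes> v)\<close>, that is,
  \<open>g\<^sub>j = \<Sum>\<^sub>l \<partial>\<^sub>l (U(s)P (u\<^sub>l v))\<^sub>j\<close>.\<close>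

definition div_heat_leray_tensor ::
  "real \<Rightarrow> ('n::finite \<Rightarrow> 'n dist) \<Rightarrow> ('n \<Rightarrow> 'n dist) \<Rightarrow> ('n \<Rightarrow> 'n dist) \<Rightarrow> bool" where
  "div_heat_leray_tensor s u v g \<longleftrightarrow>
     (\<exists>W D. (\<forall>l k. is_product (u l) (v k) (W l k)) \<and>
            (\<forall>l j. grad_heat_leray s (W l) l j (D l j)) \<and>
            (\<forall>j. g j = (\<lambda>\<phi>. \<Sum>l\<in>UNIV. D l j \<phi>)))"


section \<open>Vector fields depending on time\<close>

definition vfield_in :: "('n::finite) dist_space \<Rightarrow> ('n \<Rightarrow> 'n dist) \<Rightarrow> bool" where
  "vfield_in F u \<longleftrightarrow> (\<forall>j. u j \<in> points F)"

definition vnorm :: "('n::finite) dist_space \<Rightarrow> ('n \<Rightarrow> 'n dist) \<Rightarrow> real" where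
  "vnorm F u = (\<Sum>j\<in>UNIV. nrm F (u j))"

definition strongly_measurable_on ::
  "real set \<Rightarrow> ('n::finite) dist_space \<Rightarrow> (real \<Rightarrow> 'n dist) \<Rightarrow> bool" where
  "strongly_measurable_on I F f \<longleftrightarrow>
     (\<exists>s::nat \<Rightarrow> real \<Rightarrow> 'n dist.
        (\<forall>k. simple_function (lebesgue_on I) (s k) \<and> s k ` I \<subseteq> points F) \<and>
        (AE t in lebesgue_on I. (\<lambda>k. nrm F (dist_diff (s k t) (f t))) \<longlonglongrightarrow> 0))"

text \<open>\<open>L\<^sup>\<infinity>(I; F)\<close>. Elements are given by everywhere bounded representatives, so that the suprema
  over \<open>I\<close> below can be taken literally.\<close>

definition Linfty :: "real set \<Rightarrow> ('n::finite) dist_space \<Rightarrow> (real \<Rightarrow> 'n \<Rightarrow> 'n dist) \<Rightarrow> bool" where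
  "Linfty I F u \<longleftrightarrow>
     (\<forall>t\<in>I. vfield_in F (u t)) \<and>
     (\<forall>j. strongly_measurable_on I F (\<lambda>t. u t j)) \<and>
     bdd_above ((\<lambda>t. vnorm F (u t)) ` I)"

definition continuous_into :: "real set \<Rightarrow> ('n::finite) dist_space \<Rightarrow> (real \<Rightarrow> 'n dist) \<Rightarrow> bool" where
  "continuous_into I F f \<longleftrightarrow>
     (\<forall>t\<in>I. f t \<in> points F \<and>
        ((\<lambda>s. nrm F (dist_diff (f s) (f t))) \<longlongrightarrow> 0) (at t within I))"

definition open_time_interval :: "ereal \<Rightarrow> real set" where
  "open_time_interval T = {t. 0 < t \<and> ereal t < T}"

definition time_interval :: "ereal \<Rightarrow> real set" where
  "time_interval T = {t. 0 \<le> t \<and> ereal t < T}"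

text \<open>\<open>w = \<B>(u,v)(t)\<close> as an element of the dual of \<open>E\<close>, with the time integral taken weakly by
  duality with \<open>E\<close>.\<close>

definition is_bilinear ::
  "('n::finite) dist_space \<Rightarrow> (real \<Rightarrow> 'n \<Rightarrow> 'n dist) \<Rightarrow> (real \<Rightarrow> 'n \<Rightarrow> 'n dist) \<Rightarrow>
     real \<Rightarrow> ('n \<Rightarrow> 'n dist) \<Rightarrow> bool" where
  "is_bilinear E u v t w \<longleftrightarrow> vfield_in (dual E) w \<and>
     (\<exists>G. (AE s in lebesgue_on {0<..<t}.
             div_heat_leray_tensor (t - s) (u s) (v s) (G s) \<and> vfield_in (dual E) (G s)) \<and>
          (\<forall>j. \<forall>e\<in>points E.
             set_integrable lebesgue {0<..<t} (\<lambda>s. pairing E (G s j) e) \<and>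
             pairing E (w j) e = - (LINT s:{0<..<t}|lebesgue. pairing E (G s j) e)))"

definition bilinear_estimate :: "('n::finite) dist_space \<Rightarrow> bool" where
  "bilinear_estimate E \<longleftrightarrow>
     (\<exists>K>0. \<forall>T>0. \<forall>u v.
        Linfty (open_time_interval T) (dual E) u \<longrightarrow>
        Linfty (open_time_interval T) (dual E) v \<longrightarrow>
        (\<forall>t\<in>open_time_interval T. \<exists>w. is_bilinear E u v t w \<and>
           vnorm (dual E) w \<le> K * (SUP s\<in>open_time_interval T. vnorm (dual E) (u s))
                                * (SUP s\<in>open_time_interval T. vnorm (dual E) (v s))))"

definition mild_solution ::
  "('n::finite) dist_space \<Rightarrow> ereal \<Rightarrow> ('n \<Rightarrow> 'n dist) \<Rightarrow> (real \<Rightarrow> 'n \<Rightarrow> 'n dist) \<Rightarrow> bool" where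
  "mild_solution E T u0 u \<longleftrightarrow>
     (\<forall>t\<in>time_interval T. \<exists>w. is_bilinear E u u t w \<and>
        (\<forall>j. u t j = dist_add (heat t (u0 j)) (w j)))"

text \<open>A closed subspace of \<open>F\<close> on which the heat semigroup acts and is strongly continuous.\<close>

definition heat_C0_subspace :: "('n::finite) dist_space \<Rightarrow> 'n dist set \<Rightarrow> bool" where
  "heat_C0_subspace F Y \<longleftrightarrow> Y \<subseteq> points F \<and>
     dist_zero \<in> Y \<and>
     (\<forall>f\<in>Y. \<forall>g\<in>Y. dist_add f g \<in> Y) \<and>
     (\<forall>c. \<forall>f\<in>Y. dist_scale c f \<in> Y) \<and>
     (\<forall>X::nat \<Rightarrow> 'n dist. \<forall>f\<in>points F. (\<forall>k. X k \<in> Y) \<longrightarrow>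
        (\<lambda>k. nrm F (dist_diff (X k) f)) \<longlonglongrightarrow> 0 \<longrightarrow> f \<in> Y) \<and>
     (\<forall>f\<in>Y. (\<forall>t\<ge>0. heat t f \<in> Y) \<and> continuous_into {0..} F (\<lambda>t. heat t f))"

text \<open>The largest such subspace. It is written as the union of all of them, which equals the
  largest one whenever that exists, and is meaningful without presupposing existence.\<close>

definition heat_continuity_space :: "('n::finite) dist_space \<Rightarrow> 'n dist set" where
  "heat_continuity_space F = \<Union> {Y. heat_C0_subspace F Y}"

end

theory Submission
  imports Defs "HOL-Probability.Characteristic_Functions" "HOL-Probability.Sinc_Integral"
begin

text \<open>Let \<open>Y\<close> be the set of vector fields with components in \<open>E' \<inter> E\<^sub>3'\<close>. By (U4), (U5) and scaling,
  \<open>\<nabla>U(s) \<cdot> P(f \<otimes> g)\<close> and \<open>\<nabla>U(s) \<cdot> P(g \<otimes> f)\<close> are bounded in \<open>E'\<close> by \<open>C s\<^sup>\<beta>\<close> times the norms of \<open>f\<close> in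
  \<open>E'\<close> and of \<open>g\<close> in \<open>E\<^sub>3'\<close>, with \<open>\<beta> > -1\<close>. Hence \<open>\<B>(f,g)\<close> is small over short times when \<open>g\<close> is bounded
  in \<open>E\<^sub>3'\<close>, while the bilinear estimate makes it small when \<open>g\<close> is small in \<open>E'\<close>. If \<open>u\<close> and \<open>v\<close> take
  values in the closure of \<open>Y\<close>, both are sums of a step function with values in \<open>Y\<close> and a small
  remainder, so \<open>w = u - v = \<B>(w,u) + \<B>(v,w)\<close> gives \<open>w = 0\<close> by steps of a fixed length.

  To see that \<open>u\<close> takes values in the closure of \<open>Y\<close>, let \<open>d(t)\<close> be the distance from \<open>u(t)\<close> to \<open>Y\<close>,
  let \<open>d \<le> m\<close> on \<open>[0,t]\<close>, and let \<open>f\<close> be a step function with values in \<open>Y\<close> and \<open>r = u - f\<close> of size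
  at most \<open>m + \<epsilon>\<close>. In \<open>\<B>(u,u) = \<B>(f,u) + \<B>(r,f) + \<B>(r,r)\<close> the first two terms lie in the closure of
  \<open>Y\<close>: cut off the times close to \<open>t\<close> and use \<open>\<nabla>U(2\<tau>)P = U(\<tau>)\<nabla>U(\<tau>)P\<close> with (U3). So
  \<open>d(t) \<le> K m\<^sup>2\<close>. Since \<open>d\<close> is continuous and \<open>d(0) = 0\<close>, it cannot leave \<open>0\<close>.\<close>


section \<open>Smooth functions\<close>

text \<open>The set \<open>Y\<close> is not assumed dense in \<open>E'\<close>, so approximability
  has to be propagated from the data. For t > 0 the caloric part U(t)u0 lies in \<open>Y\<close> by
  (U3), and it tends to u0 in \<open>E'\<close> as t tends to 0 because u0 lies in the heat
  continuity space; this gives d(0) = 0 and removes the linear term from the estimate of d(t). The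
  exponent comes from scaling: dilating (U4) gives \<sigma>4 \<ge> \<sigma>E + \<sigma>3 unless all
  products have norm zero, so (\<sigma>4 - \<sigma>E)/2 - 1/2 \<ge> (\<sigma>3 - 1)/2 > -1, and the
  singularity of the kernel in time is integrable. Products, multipliers and time integrals are
  relations between distributions. Expanding B(u,u) and comparing two expansions is legitimate only
  once each relation is known to be single-valued and additive. This is the purpose of the real
  analysis that comes before the duals: products are fixed by representatives that are unique almost
  everywhere, agreement on test functions has to force equality of tempered distributions, and
  splitting off U(\<tau>) requires the Fourier transform of a heat convolution.\<close>

definition smooth :: "(real^'n::finite \<Rightarrow> complex) \<Rightarrow> bool" where
  "smooth f \<longleftrightarrow> (\<forall>is x. partial_derivs is f differentiable (at x))"

lemma partial_deriv_has_derivative: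
  fixes f :: "real^'n::finite \<Rightarrow> complex"
  assumes "(f has_derivative f') (at x)"
  shows "partial_deriv i f x = f' (axis i 1)"
proof -
  have lin: "linear f'" using assms has_derivative_linear by blast
  have f: "(f has_derivative f') (at (x + 0 *\<^sub>R axis i 1))" using assms by simp
  have "((\<lambda>h. x + h *\<^sub>R axis i (1::real)) has_derivative (\<lambda>h. h *\<^sub>R axis i 1)) (at 0)"
    by (auto intro!: derivative_eq_intros)
  from has_derivative_compose[OF this f]
  have "((\<lambda>h. f (x + h *\<^sub>R axis i 1)) has_derivative (\<lambda>h. f' (h *\<^sub>R axis i 1))) (at 0)" by simp
  then have "((\<lambda>h. f (x + h *\<^sub>R axis i 1)) has_vector_derivative f' (axis i 1)) (at 0)"
    unfolding has_vector_derivative_def using linear_cmul[OF lin] by simp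
  then show ?thesis unfolding partial_deriv_def by (rule vector_derivative_at)
qed

text \<open>Linearity and the standard basis. It turns bounds on the finitely many partial
  derivatives into operator norm bounds, as the mean value theorem needs.\<close>

lemma frechet_derivative_partial:
  fixes f :: "real^'n::finite \<Rightarrow> complex"
  assumes "(f has_derivative f') (at x)"
  shows "f' h = (\<Sum>i\<in>UNIV. (h $ i) *\<^sub>R partial_deriv i f x)"
proof -
  have lin: "linear f'" using assms has_derivative_linear by blast
  have "f' h = f' (\<Sum>i\<in>UNIV. (h $ i) *\<^sub>R axis i 1)"
    by (simp add: basis_expansion[symmetric] scalar_mult_eq_scaleR[symmetric] basis_expansion)
  also have "\<dots> = (\<Sum>i\<in>UNIV. (h $ i) *\<^sub>R f' (axis i 1))"
    by (simp add: linear_sum[OF lin] linear_cmul[OF lin])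
  finally show ?thesis using partial_deriv_has_derivative[OF assms] by simp
qed

lemma partial_derivs_append: "partial_derivs (is @ js) f = partial_derivs is (partial_derivs js f)"
  by (induction "is") auto

lemma partial_derivs_snoc: "partial_derivs (is @ [i]) f = partial_derivs is (partial_deriv i f)"
  by (simp add: partial_derivs_append)

lemma smooth_partial_derivs: "smooth f \<Longrightarrow> smooth (partial_derivs js f)"
  unfolding smooth_def by (metis partial_derivs_append)

lemma smooth_partial_deriv: "smooth f \<Longrightarrow> smooth (partial_deriv i f)"
  using smooth_partial_derivs[of f "[i]"] by simp

lemma smooth_differentiable: "smooth f \<Longrightarrow> f differentiable (at x)"
  unfolding smooth_def by (metis partial_derivs.simps(1))

lemma smooth_continuous: "smooth f \<Longrightarrow> continuous_on UNIV f"
  by (simp add: smooth_differentiable continuous_at_imp_continuous_on differentiable_imp_continuous_within)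

lemma smooth_borel: "smooth f \<Longrightarrow> f \<in> borel_measurable borel"
  using smooth_continuous borel_measurable_continuous_onI by blast

lemma partial_deriv_add:
  assumes "f differentiable (at x)" "g differentiable (at x)"
  shows "partial_deriv i (\<lambda>x. f x + g x) x = partial_deriv i f x + partial_deriv i g x"
proof -
  from assms obtain f' g' where d: "(f has_derivative f') (at x)" "(g has_derivative g') (at x)"
    unfolding differentiable_def by blast
  show ?thesis using partial_deriv_has_derivative[OF has_derivative_add[OF d]]
      partial_deriv_has_derivative[OF d(1)] partial_deriv_has_derivative[OF d(2)] by simp
qed

lemma partial_deriv_mult:
  assumes "f differentiable (at x)" "g differentiable (at x)"
  shows "partial_deriv i (\<lambda>x. f x * g x) x = partial_deriv i f x * g x + f x * partial_deriv i g x"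
proof -
  from assms obtain f' g' where d: "(f has_derivative f') (at x)" "(g has_derivative g') (at x)"
    unfolding differentiable_def by blast
  show ?thesis using partial_deriv_has_derivative[OF has_derivative_mult[OF d]]
      partial_deriv_has_derivative[OF d(1)] partial_deriv_has_derivative[OF d(2)] by simp
qed

lemma partial_deriv_const: "partial_deriv i (\<lambda>x. c) = (\<lambda>x. 0)"
  using partial_deriv_has_derivative[OF has_derivative_const] by fastforce

section \<open>Smoothness by closure under differentiation\<close>

inductive_set algebra_hull :: "(real^'n::finite \<Rightarrow> complex) set \<Rightarrow> (real^'n \<Rightarrow> complex) set" for A where
  gen: "f \<in> A \<Longrightarrow> f \<in> algebra_hull A"
| add: "f \<in> algebra_hull A \<Longrightarrow> g \<in> algebra_hull A \<Longrightarrow> (\<lambda>x. f x + g x) \<in> algebra_hull A"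
| mult: "f \<in> algebra_hull A \<Longrightarrow> g \<in> algebra_hull A \<Longrightarrow> (\<lambda>x. f x * g x) \<in> algebra_hull A"

text \<open>Sum and product rule keep the first derivatives of hull elements in the hull once this
  holds for the generators. Every iterated derivative is then a differentiable hull element, so
  checking first derivatives of a well-chosen \<open>A\<close> replaces an induction over all
  orders.\<close>

lemma algebra_hull_smooth:
  assumes A: "\<And>f x. f \<in> A \<Longrightarrow> f differentiable (at x)"
    and A': "\<And>f i. f \<in> A \<Longrightarrow> partial_deriv i f \<in> algebra_hull A"
    and f: "f \<in> algebra_hull A"
  shows "smooth f"
proof -
  have step: "(\<forall>x. g differentiable (at x)) \<and> (\<forall>i. partial_deriv i g \<in> algebra_hull A)"
    if "g \<in> algebra_hull A" for g
    using that
  proof induction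
    case (add f g)
    then have "partial_deriv i (\<lambda>x. f x + g x) = (\<lambda>x. partial_deriv i f x + partial_deriv i g x)" for i
      by (auto simp: partial_deriv_add)
    with add show ?case by (auto intro: algebra_hull.add)
  next
    case (mult f g)
    then have "partial_deriv i (\<lambda>x. f x * g x) =
        (\<lambda>x. partial_deriv i f x * g x + f x * partial_deriv i g x)" for i
      by (auto simp: partial_deriv_mult)
    with mult show ?case by (auto intro!: algebra_hull.intros(2,3) derivative_intros)
  qed (use A A' in auto)
  have "partial_derivs is f \<in> algebra_hull A" for "is"
    by (induction "is") (use step f in auto)
  then show ?thesis unfolding smooth_def using step by blast
qed

lemma smooth_algebra: "f \<in> algebra_hull {f. smooth f} \<Longrightarrow> smooth f"
  by (rule algebra_hull_smooth)
     (auto intro: smooth_differentiable smooth_partial_deriv algebra_hull.gen)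

lemma smooth_add: "smooth f \<Longrightarrow> smooth g \<Longrightarrow> smooth (\<lambda>x. f x + g x)"
  by (rule smooth_algebra) (auto intro: algebra_hull.intros)

lemma smooth_mult: "smooth f \<Longrightarrow> smooth g \<Longrightarrow> smooth (\<lambda>x. f x * g x)"
  by (rule smooth_algebra) (auto intro: algebra_hull.intros)

lemma smooth_const: "smooth (\<lambda>x. c)"
proof (rule algebra_hull_smooth[where A = "range (\<lambda>c x. c)"])
  show "partial_deriv i f \<in> algebra_hull (range (\<lambda>c x. c))" if "f \<in> range (\<lambda>c x. c)"
    for f :: "real^'n \<Rightarrow> complex" and i
    using that by (auto simp: partial_deriv_const intro: algebra_hull.gen)
qed (auto intro: algebra_hull.gen)

lemma smooth_diff: "smooth f \<Longrightarrow> smooth g \<Longrightarrow> smooth (\<lambda>x. f x - g x)"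
  using smooth_add[OF _ smooth_mult[OF smooth_const[of "-1"]], of f g] by simp

lemma smooth_prod:
  "finite I \<Longrightarrow> (\<And>i. i \<in> I \<Longrightarrow> smooth (f i)) \<Longrightarrow> smooth (\<lambda>x. \<Prod>i\<in>I. f i x)"
  by (induction I rule: finite_induct) (auto intro: smooth_const smooth_mult)

text \<open>Adjoining 1/f to the smooth functions gives a suitable generating set, since its
  derivative -f' (1/f)(1/f) is a product of generators.\<close>

lemma smooth_inverse:
  assumes f: "smooth f" and nz: "\<And>x. f x \<noteq> 0"
  shows "smooth (\<lambda>x. inverse (f x))"
proof (rule algebra_hull_smooth[where A = "insert (\<lambda>x. inverse (f x)) {f. smooth f}"])
  let ?A = "insert (\<lambda>x. inverse (f x)) {f. smooth f}"
  have df: "f differentiable (at x)" for x using f by (rule smooth_differentiable)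
  show "g differentiable (at x)" if "g \<in> ?A" for g x
    using that df nz by (auto intro: smooth_differentiable differentiable_inverse)
  have "partial_deriv i (\<lambda>x. inverse (f x)) =
      (\<lambda>x. ((-1) * partial_deriv i f x) * (inverse (f x) * inverse (f x)))" for i
  proof
    fix x
    obtain f' where d: "(f has_derivative f') (at x)" using df unfolding differentiable_def by blast
    from Deriv.has_derivative_inverse[OF nz d] partial_deriv_has_derivative[OF d]
    show "partial_deriv i (\<lambda>x. inverse (f x)) x =
        ((-1) * partial_deriv i f x) * (inverse (f x) * inverse (f x))"
      by (subst partial_deriv_has_derivative) (auto simp: mult_ac)
  qed
  moreover have "(\<lambda>x. ((-1) * partial_deriv i f x) * (inverse (f x) * inverse (f x))) \<in> algebra_hull ?A" for i
    by (intro algebra_hull.mult algebra_hull.gen) (auto intro: smooth_mult smooth_const smooth_partial_deriv f)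
  ultimately show "partial_deriv i g \<in> algebra_hull ?A" if "g \<in> ?A" for g i
    using that by (auto intro: algebra_hull.gen smooth_partial_deriv)
qed (auto intro: algebra_hull.gen)

lemma partial_deriv_cmult:
  assumes "f differentiable (at x)"
  shows "partial_deriv i (\<lambda>x. c * f x) x = c * partial_deriv i f x"
  using partial_deriv_mult[of "\<lambda>x. c" x f i] assms by (simp add: partial_deriv_const)

lemma partial_derivs_add:
  assumes "smooth f" "smooth g"
  shows "partial_derivs is (\<lambda>x. f x + g x) = (\<lambda>x. partial_derivs is f x + partial_derivs is g x)"
  by (induction "is")
     (auto simp: fun_eq_iff[symmetric] intro!: ext partial_deriv_add smooth_differentiable smooth_partial_derivs assms)

lemma partial_derivs_cmult:
  assumes "smooth f"
  shows "partial_derivs is (\<lambda>x. c * f x) = (\<lambda>x. c * partial_derivs is f x)"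
  by (induction "is")
     (auto simp: fun_eq_iff[symmetric] intro!: ext partial_deriv_cmult smooth_differentiable smooth_partial_derivs assms)

lemma partial_deriv_scale:
  fixes f :: "real^'n::finite \<Rightarrow> complex"
  assumes "\<And>x. f differentiable (at x)"
  shows "partial_deriv i (\<lambda>x. f (c *\<^sub>R x)) = (\<lambda>x. of_real c * partial_deriv i f (c *\<^sub>R x))"
proof
  fix x :: "real^'n"
  obtain f' where d: "(f has_derivative f') (at (c *\<^sub>R x))" using assms unfolding differentiable_def by blast
  have "((\<lambda>x. c *\<^sub>R x) has_derivative (\<lambda>h. c *\<^sub>R h)) (at x)" by (auto intro!: derivative_eq_intros)
  from has_derivative_compose[OF this d] have "partial_deriv i (\<lambda>x. f (c *\<^sub>R x)) x = f' (c *\<^sub>R axis i 1)"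
    by (rule partial_deriv_has_derivative)
  also have "\<dots> = of_real c * f' (axis i 1)"
    by (simp only: linear_cmul[OF has_derivative_linear[OF d]] scaleR_conv_of_real[where 'a = complex])
  finally show "partial_deriv i (\<lambda>x. f (c *\<^sub>R x)) x = of_real c * partial_deriv i f (c *\<^sub>R x)"
    by (simp add: partial_deriv_has_derivative[OF d])
qed

lemma differentiable_scale:
  fixes f :: "real^'n::finite \<Rightarrow> complex"
  assumes "f differentiable (at (c *\<^sub>R x))"
  shows "(\<lambda>x. f (c *\<^sub>R x)) differentiable (at x)"
  using differentiable_chain_at[of "\<lambda>x. c *\<^sub>R x" x f] assms by (simp add: o_def)

lemma smooth_scale:
  assumes "smooth f"
  shows "smooth (\<lambda>x. f (c *\<^sub>R x))"
proof (rule algebra_hull_smooth)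
  let ?A = "{g. smooth g} \<union> {(\<lambda>x. g (c *\<^sub>R x)) |g. smooth g}"
  show "g differentiable (at x)" if "g \<in> ?A" for g x
    using that by (auto intro: smooth_differentiable differentiable_scale)
  show "partial_deriv i g \<in> algebra_hull ?A" if "g \<in> ?A" for g i
    using that
  proof
    assume "g \<in> {(\<lambda>x. g (c *\<^sub>R x)) |g. smooth g}"
    then obtain h where h: "g = (\<lambda>x. h (c *\<^sub>R x))" "smooth h" by blast
    have "(\<lambda>x. of_real c * partial_deriv i h (c *\<^sub>R x)) \<in> algebra_hull ?A"
      using smooth_partial_deriv[OF h(2)]
      by (intro algebra_hull.mult algebra_hull.gen) (auto intro: smooth_const)
    with h show ?thesis by (simp add: partial_deriv_scale smooth_differentiable)
  qed (auto intro: algebra_hull.gen smooth_partial_deriv)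
  show "(\<lambda>x. f (c *\<^sub>R x)) \<in> algebra_hull ?A"
    using assms by (auto intro: algebra_hull.gen)
qed

lemma partial_derivs_scale:
  assumes "smooth f"
  shows "partial_derivs is (\<lambda>x. f (c *\<^sub>R x)) = (\<lambda>x. of_real (c ^ length is) * partial_derivs is f (c *\<^sub>R x))"
proof (induction "is")
  case (Cons i "is")
  have s: "smooth (partial_derivs is f)" by (rule smooth_partial_derivs[OF assms])
  show ?case
    by (simp add: Cons fun_eq_iff partial_deriv_cmult
        differentiable_scale[OF smooth_differentiable[OF s]] partial_deriv_scale[OF smooth_differentiable[OF s]])
qed simp

lemma partial_derivs_zero_on_open:
  assumes "open V" "\<And>x. x \<in> V \<Longrightarrow> f x = 0" "x \<in> V"
  shows "partial_derivs is f x = 0"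
  using assms(3)
proof (induction "is" arbitrary: x)
  case (Cons i "is")
  have "((\<lambda>x. 0) has_derivative (\<lambda>x. 0)) (at x)" by simp
  then have "(partial_derivs is f has_derivative (\<lambda>x. 0)) (at x)"
    by (rule has_derivative_transform_within_open[OF _ assms(1) Cons.prems]) (use Cons.IH in auto)
  from partial_deriv_has_derivative[OF this] show ?case by simp
qed (use assms in auto)

section \<open>Bump functions\<close>

text \<open>The polynomial \<open>p\<close> makes the family of these functions closed under differentiation.\<close>

definition flat :: "real poly \<Rightarrow> real \<Rightarrow> real" where
  "flat p x = (if x > 0 then poly p (1 / x) * exp (- (1 / x)) else 0)"

text \<open>The free power \<open>y ^ k\<close> is what makes the induction on \<open>p\<close> go
  through: passing from p to a + y p raises it by one.\<close>

lemma tendsto_power_poly_exp_0: "((\<lambda>y. y ^ k * poly p y * exp (- y)) \<longlongrightarrow> (0::real)) at_top"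
proof (induction p arbitrary: k)
  case (pCons a p)
  have "((\<lambda>y. a * (y ^ k / exp y) + y ^ Suc k * poly p y * exp (- y)) \<longlongrightarrow> a * 0 + 0) at_top"
    by (intro tendsto_intros tendsto_power_div_exp_0 pCons.IH)
  then show ?case by (simp add: algebra_simps exp_minus divide_inverse)
qed simp

lemma flat_tendsto_0: "(flat p \<longlongrightarrow> 0) (at_right 0)"
proof -
  have "((\<lambda>y. poly p y * exp (- y)) \<longlongrightarrow> 0) at_top"
    using tendsto_power_poly_exp_0[of 0 p] by simp
  from filterlim_compose[OF this filterlim_inverse_at_top_right]
  have "((\<lambda>x. poly p (inverse x) * exp (- inverse x)) \<longlongrightarrow> 0) (at_right 0)" .
  then show ?thesis
    by (rule Lim_transform_eventually)
       (auto simp: flat_def eventually_at_right_less inverse_eq_divide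
         intro: eventually_mono[OF eventually_at_right_less[of 0]])
qed

text \<open>With y = 1/x, the derivative of p(y) exp(-y) in x is y^2 (p(y) - p'(y)) exp(-y);
  \<open>[:0, 0, 1:]\<close> is the polynomial y^2. Only the origin needs an argument of its
  own.\<close>

lemma flat_has_derivative:
  "(flat p has_real_derivative flat ([:0, 0, 1:] * (p - pderiv p)) x) (at x)"
proof -
  consider "x > 0" | "x < 0" | "x = 0" by linarith
  then show ?thesis
  proof cases
    case 1
    have "((\<lambda>x. poly p (1 / x) * exp (- (1 / x))) has_real_derivative
        flat ([:0, 0, 1:] * (p - pderiv p)) x) (at x)"
      using 1 by (auto intro!: derivative_eq_intros DERIV_chain2[OF poly_DERIV] simp: flat_def field_simps power2_eq_square)
    then show ?thesis
      by (rule has_field_derivative_transform_within_open[of _ _ _ "{0<..}"]) (use 1 in \<open>auto simp: flat_def\<close>)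
  next
    case 2
    have "((\<lambda>x. 0) has_real_derivative 0) (at x)" by simp
    then have "(flat p has_real_derivative 0) (at x)"
      by (rule has_field_derivative_transform_within_open[of _ _ _ "{..<0}"]) (use 2 in \<open>auto simp: flat_def\<close>)
    then show ?thesis using 2 by (simp add: flat_def)
  next
    case 3
    \<comment> \<open>Dividing by h multiplies by y = 1/h, so the difference quotient is again flat,
      with polynomial \<open>pCons 0 p\<close> = y p, and tends to 0.\<close>
    have "((\<lambda>h. flat p h / h) \<longlongrightarrow> 0) (at_right 0)"
      by (rule Lim_transform_eventually[OF flat_tendsto_0[of "pCons 0 p"]])
         (auto simp: flat_def intro!: eventually_mono[OF eventually_at_right_less[of 0]])
    moreover have "((\<lambda>h. flat p h / h) \<longlongrightarrow> 0) (at_left 0)"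
      by (rule Lim_transform_eventually[OF tendsto_const])
         (auto simp: flat_def eventually_at_left_field intro!: exI[of _ "-1"])
    ultimately have "((\<lambda>h. flat p h / h) \<longlongrightarrow> 0) (at 0)"
      by (simp add: filterlim_split_at)
    then show ?thesis using 3 by (simp add: DERIV_def flat_def)
  qed
qed

lemma smooth_flat: "smooth (\<lambda>x::real^'n::finite. of_real (flat p (a * x $ i + b)))"
proof (rule algebra_hull_smooth)
  let ?A = "(\<lambda>p (x::real^'n). complex_of_real (flat p (a * x $ i + b))) ` UNIV \<union> {f. smooth f}"
  have d: "((\<lambda>x::real^'n. complex_of_real (flat p (a * x $ i + b))) has_derivative
      (\<lambda>h. of_real (flat ([:0, 0, 1:] * (p - pderiv p)) (a * x $ i + b) * (a * h $ i)))) (at x)" for p x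
  proof -
    have "((\<lambda>x::real^'n. a * x $ i + b) has_derivative (\<lambda>h. a * h $ i)) (at x)"
      by (auto intro!: derivative_eq_intros bounded_linear_imp_has_derivative)
    from has_derivative_compose[OF this has_field_derivative_imp_has_derivative[OF flat_has_derivative]]
    show ?thesis by (auto intro!: derivative_eq_intros)
  qed
  show "f differentiable (at x)" if "f \<in> ?A" for f x
    using that d by (auto simp: differentiable_def intro: smooth_differentiable[unfolded differentiable_def])
  show "partial_deriv j f \<in> algebra_hull ?A" if "f \<in> ?A" for f j
    using that
  proof
    assume "f \<in> (\<lambda>p x. complex_of_real (flat p (a * x $ i + b))) ` UNIV"
    then obtain p where p: "f = (\<lambda>x. complex_of_real (flat p (a * x $ i + b)))" by blast
    have "partial_deriv j f = (\<lambda>x. of_real (flat ([:0, 0, 1:] * (p - pderiv p)) (a * x $ i + b)) *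
        of_real (a * axis j 1 $ i))"
      unfolding p using partial_deriv_has_derivative[OF d] by (simp add: fun_eq_iff)
    also have "\<dots> \<in> algebra_hull ?A"
      by (intro algebra_hull.mult algebra_hull.gen) (auto intro: smooth_const)
    finally show ?thesis .
  qed (auto intro: algebra_hull.gen smooth_partial_deriv)
qed (auto intro: algebra_hull.gen)

definition smooth_step :: "real \<Rightarrow> real" where
  "smooth_step x = flat 1 x / (flat 1 x + flat 1 (1 - x))"

lemma flat_1_pos: "flat 1 x > 0 \<longleftrightarrow> x > 0" "flat 1 x \<ge> 0" by (auto simp: flat_def)

lemma smooth_step_denominator: "flat 1 x + flat 1 (1 - x) > 0"
proof (cases "x > 0")
  case True
  then show ?thesis using flat_1_pos(1)[of x] flat_1_pos(2)[of "1 - x"] by linarith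
next
  case False
  then show ?thesis using flat_1_pos(1)[of "1 - x"] flat_1_pos(2)[of "x"] by linarith
qed

lemma smooth_step_simps:
  "x \<le> 0 \<Longrightarrow> smooth_step x = 0" "x \<ge> 1 \<Longrightarrow> smooth_step x = 1"
  "0 \<le> smooth_step x" "smooth_step x \<le> 1"
proof -
  show "x \<le> 0 \<Longrightarrow> smooth_step x = 0" by (simp add: smooth_step_def flat_def)
  show "x \<ge> 1 \<Longrightarrow> smooth_step x = 1" by (simp add: smooth_step_def flat_def)
  show "0 \<le> smooth_step x" "smooth_step x \<le> 1"
    using flat_1_pos(2)[of x] flat_1_pos(2)[of "1 - x"] smooth_step_denominator[of x]
    by (auto simp: smooth_step_def)
qed

lemma smooth_smooth_step: "smooth (\<lambda>x::real^'n::finite. of_real (smooth_step (a * x $ i + b)))"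
proof -
  have "smooth (\<lambda>x::real^'n. of_real (flat 1 (a * x $ i + b)) *
      inverse (of_real (flat 1 (a * x $ i + b)) + of_real (flat 1 ((-a) * x $ i + (1 - b)))))"
  proof (intro smooth_mult smooth_inverse smooth_add smooth_flat)
    show "complex_of_real (flat 1 (a * x $ i + b)) + of_real (flat 1 ((-a) * x $ i + (1 - b))) \<noteq> 0"
      for x :: "real^'n"
      using smooth_step_denominator[of "a * x $ i + b"]
      unfolding of_real_add[symmetric] of_real_eq_0_iff by (simp add: algebra_simps)
  qed
  moreover have "1 - (a * y + b) = (-a) * y + (1 - b)" for y by simp
  ultimately show ?thesis
    by (simp only: smooth_step_def of_real_mult of_real_inverse of_real_add divide_inverse)
qed

text \<open>The parameter \<open>k\<close> is the steepness: the function vanishes off the open box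
  and equals 1 at depth 1/k inside it, so it increases to sharpness as \<open>k\<close>
  grows.\<close>

definition bump :: "real \<Rightarrow> real^'n \<Rightarrow> real^'n \<Rightarrow> real^'n::finite \<Rightarrow> real" where
  "bump k a b x = (\<Prod>i\<in>UNIV. smooth_step (k * (x $ i - a $ i)) * smooth_step (k * (b $ i - x $ i)))"

lemma smooth_bump: "smooth (\<lambda>x. of_real (bump k a b x))"
proof -
  have *: "k * (x - c) = k * x + (- k * c)" "k * (c - x) = (-k) * x + k * c" for x c :: real
    by (simp_all add: algebra_simps)
  have "smooth (\<lambda>x::real^'n. of_real (smooth_step (k * (x $ i - c))))"
    "smooth (\<lambda>x::real^'n. of_real (smooth_step (k * (c - x $ i))))" for c i
    unfolding *(1)[of _ c] *(2)[of c] by (rule smooth_smooth_step)+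
  then show ?thesis unfolding bump_def of_real_prod of_real_mult
    by (intro smooth_prod smooth_mult) auto
qed

lemma bump_bounds: "0 \<le> bump k a b x" "bump k a b x \<le> 1"
  by (auto simp: bump_def smooth_step_simps mult_le_one intro!: prod_nonneg prod_le_1)

lemma bump_eq_0:
  assumes "k > 0" "x \<notin> box a b"
  shows "bump k a b x = 0"
proof -
  from assms obtain i where "\<not> (a $ i < x $ i \<and> x $ i < b $ i)" by (auto simp: mem_box_cart)
  then have "k * (x $ i - a $ i) \<le> 0 \<or> k * (b $ i - x $ i) \<le> 0"
    using assms(1) by (auto simp: mult_le_0_iff not_less)
  then have "smooth_step (k * (x $ i - a $ i)) * smooth_step (k * (b $ i - x $ i)) = 0"
    by (auto simp: smooth_step_simps)
  then show ?thesis unfolding bump_def by (simp add: prod_zero_iff) blast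
qed

lemma bump_eq_1:
  assumes "\<And>i. k * (x $ i - a $ i) \<ge> 1" "\<And>i. k * (b $ i - x $ i) \<ge> 1"
  shows "bump k a b x = 1"
  using assms by (simp add: bump_def smooth_step_simps)

text \<open>At a point of the open box all finitely many coordinate gaps are positive, so the bump
  is eventually equal to 1 there; off the box it is always 0.\<close>

lemma bump_tendsto_indicator:
  fixes x :: "real^'n::finite"
  shows "(\<lambda>m. bump (real (Suc m)) a b x) \<longlonglongrightarrow> indicator (box a b) x"
proof (cases "x \<in> box a b")
  case False
  then show ?thesis by (simp add: bump_eq_0)
next
  case True
  have "eventually (\<lambda>m. \<forall>i\<in>UNIV. real (Suc m) * c i \<ge> 1) sequentially" if pos: "\<And>i. c i > 0" for c :: "'n \<Rightarrow> real"
  proof (rule eventually_ball_finite)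
    show "\<forall>i\<in>UNIV. eventually (\<lambda>m. real (Suc m) * c i \<ge> 1) sequentially"
    proof
      fix i
      obtain N where N: "1 < real N * c i" using reals_Archimedean3[OF pos[of i]] by blast
      show "eventually (\<lambda>m. real (Suc m) * c i \<ge> 1) sequentially"
      proof (rule eventually_sequentiallyI[of N])
        fix m assume "m \<ge> N"
        then have "real N * c i \<le> real (Suc m) * c i" using pos[of i] by (intro mult_right_mono) auto
        with N show "1 \<le> real (Suc m) * c i" by linarith
      qed
    qed
  qed simp
  from this[of "\<lambda>i. x $ i - a $ i"] this[of "\<lambda>i. b $ i - x $ i"] True
  have "eventually (\<lambda>m. (\<forall>i\<in>UNIV. real (Suc m) * (x $ i - a $ i) \<ge> 1) \<and> (\<forall>i\<in>UNIV. real (Suc m) * (b $ i - x $ i) \<ge> 1)) sequentially"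
    by (simp add: mem_box_cart eventually_conj)
  then have "eventually (\<lambda>m. indicator (box a b) x = bump (real (Suc m)) a b x) sequentially"
    by eventually_elim (use True in \<open>simp add: bump_eq_1\<close>)
  then show ?thesis by (rule Lim_transform_eventually[OF tendsto_const])
qed

section \<open>Schwartz functions\<close>

lemma schwartz_smooth: "schwartz \<phi> \<Longrightarrow> smooth \<phi>"
  by (auto simp: schwartz_def smooth_def differentiable_on_def)

lemma schwartz_iff: "schwartz \<phi> \<longleftrightarrow> smooth \<phi> \<and>
   (\<forall>is N. \<exists>C. \<forall>x. (1 + norm x) ^ N * cmod (partial_derivs is \<phi> x) \<le> C)"
  by (auto simp: schwartz_def smooth_def differentiable_on_def)

lemma schwartz_decay:
  assumes "schwartz \<phi>"
  obtains C where "C > 0" "\<And>x. (1 + norm x) ^ N * cmod (partial_derivs is \<phi> x) \<le> C"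
proof -
  from assms obtain C where C: "\<And>x. (1 + norm x) ^ N * cmod (partial_derivs is \<phi> x) \<le> C"
    unfolding schwartz_def by blast
  show ?thesis by (rule that[of "max C 1"]) (auto simp: C le_max_iff_disj)
qed

lemma schwartz_partial_derivs: "schwartz \<phi> \<Longrightarrow> schwartz (partial_derivs js \<phi>)"
  unfolding schwartz_def by (metis partial_derivs_append)

lemma schwartz_partial_deriv: "schwartz \<phi> \<Longrightarrow> schwartz (partial_deriv i \<phi>)"
  using schwartz_partial_derivs[of \<phi> "[i]"] by simp

lemma schwartz_add:
  assumes "schwartz \<phi>" "schwartz \<psi>"
  shows "schwartz (\<lambda>x. \<phi> x + \<psi> x)"
proof -
  have "\<exists>C. \<forall>x. (1 + norm x) ^ N * cmod (partial_derivs is \<phi> x + partial_derivs is \<psi> x) \<le> C" for "is" N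
  proof -
    obtain C D where C: "\<And>x. (1 + norm x) ^ N * cmod (partial_derivs is \<phi> x) \<le> C"
        "\<And>x. (1 + norm x) ^ N * cmod (partial_derivs is \<psi> x) \<le> D"
      by (metis assms schwartz_decay)
    have "(1 + norm x) ^ N * cmod (partial_derivs is \<phi> x + partial_derivs is \<psi> x) \<le> C + D" for x
    proof -
      have "(1 + norm x) ^ N * cmod (partial_derivs is \<phi> x + partial_derivs is \<psi> x) \<le>
          (1 + norm x) ^ N * (cmod (partial_derivs is \<phi> x) + cmod (partial_derivs is \<psi> x))"
        by (intro mult_left_mono norm_triangle_ineq) auto
      with C[of x] show ?thesis by (simp add: distrib_left)
    qed
    then show ?thesis by blast
  qed
  then show ?thesis
    using assms by (simp add: schwartz_iff partial_derivs_add smooth_add)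
qed

lemma schwartz_cmult:
  assumes "schwartz \<phi>"
  shows "schwartz (\<lambda>x. c * \<phi> x)"
proof -
  have "\<exists>C. \<forall>x. (1 + norm x) ^ N * cmod (c * partial_derivs is \<phi> x) \<le> C" for "is" N
  proof -
    obtain C where C: "\<And>x. (1 + norm x) ^ N * cmod (partial_derivs is \<phi> x) \<le> C"
      by (metis assms schwartz_decay)
    have "(1 + norm x) ^ N * cmod (c * partial_derivs is \<phi> x) \<le> cmod c * C" for x
      using mult_left_mono[OF C[of x], of "cmod c"] by (simp add: norm_mult mult_ac)
    then show ?thesis by blast
  qed
  then show ?thesis
    using assms by (simp add: schwartz_iff partial_derivs_cmult smooth_mult smooth_const)
qed

lemma schwartz_diff: "schwartz \<phi> \<Longrightarrow> schwartz \<psi> \<Longrightarrow> schwartz (\<lambda>x. \<phi> x - \<psi> x)"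
  using schwartz_add[OF _ schwartz_cmult[of \<psi> "-1"], of \<phi>] by simp

lemma schwartz_scale:
  assumes "schwartz \<phi>" "c \<noteq> 0"
  shows "schwartz (\<lambda>x. \<phi> (c *\<^sub>R x))"
proof -
  have "\<exists>C. \<forall>x. (1 + norm x) ^ N * cmod (of_real (c ^ length is) * partial_derivs is \<phi> (c *\<^sub>R x)) \<le> C" for "is" N
  proof -
    obtain C where C: "\<And>x. (1 + norm x) ^ N * cmod (partial_derivs is \<phi> x) \<le> C"
      by (metis assms(1) schwartz_decay)
    define M where "M = max 1 (1 / \<bar>c\<bar>)"
    have "(1 + norm x) ^ N * cmod (of_real (c ^ length is) * partial_derivs is \<phi> (c *\<^sub>R x)) \<le>
      M ^ N * \<bar>c\<bar> ^ length is * C" for x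
    proof -
      have "1 + norm x \<le> M * (1 + norm (c *\<^sub>R x))"
      proof -
        have "norm x = (1 / \<bar>c\<bar>) * norm (c *\<^sub>R x)" using assms by simp
        also have "\<dots> \<le> M * norm (c *\<^sub>R x)" by (intro mult_right_mono) (auto simp: M_def)
        finally show ?thesis by (simp add: distrib_left M_def)
      qed
      then have "(1 + norm x) ^ N \<le> M ^ N * (1 + norm (c *\<^sub>R x)) ^ N"
        unfolding power_mult_distrib[symmetric] by (intro power_mono) auto
      then have "(1 + norm x) ^ N * (\<bar>c\<bar> ^ length is * cmod (partial_derivs is \<phi> (c *\<^sub>R x))) \<le>
          (M ^ N * (1 + norm (c *\<^sub>R x)) ^ N) * (\<bar>c\<bar> ^ length is * cmod (partial_derivs is \<phi> (c *\<^sub>R x)))"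
        by (intro mult_right_mono) auto
      also have "\<dots> = (M ^ N * \<bar>c\<bar> ^ length is) * ((1 + norm (c *\<^sub>R x)) ^ N * cmod (partial_derivs is \<phi> (c *\<^sub>R x)))"
        by simp
      also have "\<dots> \<le> (M ^ N * \<bar>c\<bar> ^ length is) * C"
        by (intro mult_left_mono C) (auto simp: M_def)
      finally show ?thesis by (simp add: norm_mult norm_power)
    qed
    then show ?thesis by blast
  qed
  then show ?thesis
    using assms by (simp add: schwartz_iff partial_derivs_scale smooth_scale)
qed

lemma schwartz_zero: "schwartz (\<lambda>x. 0)"
  by (auto simp: schwartz_iff smooth_const partial_derivs_zero_on_open[of UNIV] intro: exI[of _ 0])

text \<open>Derivatives vanish outside a ball and are continuous on it, so compactness supplies all
  the Schwartz bounds.\<close>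

lemma test_function_intro:
  assumes sm: "smooth \<phi>" and b: "bounded {x. \<phi> x \<noteq> 0}"
  shows "test_function \<phi>"
proof -
  obtain R where R: "\<And>x. norm x > R \<Longrightarrow> \<phi> x = 0"
    using b unfolding bounded_iff by (metis linorder_not_less mem_Collect_eq)
  have "\<exists>C. \<forall>x. (1 + norm x) ^ N * cmod (partial_derivs is \<phi> x) \<le> C" for "is" N
  proof -
    have zero: "partial_derivs is \<phi> x = 0" if "norm x > R" for x
      by (rule partial_derivs_zero_on_open[of "- cball 0 R"]) (use that R in \<open>auto simp: open_Compl\<close>)
    have "continuous_on (cball 0 R) (\<lambda>x. (1 + norm x) ^ N * cmod (partial_derivs is \<phi> x))"
      by (intro continuous_intros continuous_on_subset[OF smooth_continuous[OF smooth_partial_derivs[OF sm]]]) auto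
    from compact_imp_bounded[OF compact_continuous_image[OF this compact_cball]]
    obtain C where "\<forall>y\<in>(\<lambda>x. (1 + norm x) ^ N * cmod (partial_derivs is \<phi> x)) ` cball 0 R. norm y \<le> C"
      unfolding bounded_iff by blast
    then have C: "\<And>x. x \<in> cball 0 R \<Longrightarrow> \<bar>(1 + norm x) ^ N * cmod (partial_derivs is \<phi> x)\<bar> \<le> C"
      by simp
    have "(1 + norm x) ^ N * cmod (partial_derivs is \<phi> x) \<le> max C 0" for x
      using C[of x] zero[of x] by (cases "norm x > R") auto
    then show ?thesis by blast
  qed
  with sm b show ?thesis by (simp add: test_function_def schwartz_iff)
qed

lemma test_function_bump:
  assumes "k > 0"
  shows "test_function (\<lambda>x. of_real (bump k a b x))"
proof (rule test_function_intro[OF smooth_bump])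
  have "{x. complex_of_real (bump k a b x) \<noteq> 0} \<subseteq> box a b"
    using bump_eq_0[OF assms] by fastforce
  then show "bounded {x. complex_of_real (bump k a b x) \<noteq> 0}"
    using bounded_box bounded_subset by blast
qed

text \<open>On the unit ball every coordinate keeps distance at least 1 from -2 and 2, where the
  steps of slope 1 have reached their plateau. A definition quantifying over all cutoffs would be
  vacuous if there were none.\<close>

lemma cutoff_bump: "cutoff (\<lambda>x::real^'n::finite. of_real (bump 1 (\<chi> i. -2) (\<chi> i. 2) x))"
proof -
  have "bump 1 (\<chi> i. -2) (\<chi> i. 2) \<xi> = 1" if "norm \<xi> < 1" for \<xi> :: "real^'n"
  proof (rule bump_eq_1)
    fix i
    have "\<bar>\<xi> $ i\<bar> < 1" using component_le_norm_cart[of \<xi> i] that by linarith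
    then show "1 \<le> 1 * (\<xi> $ i - (\<chi> i. - 2) $ i)" "1 \<le> 1 * ((\<chi> i. 2) $ i - \<xi> $ i)" by auto
  qed
  then show ?thesis unfolding cutoff_def
    by (auto intro: test_function_bump intro!: exI[of _ "1::real"])
qed

text \<open>The seminorm is a supremum over real numbers and meaningful only for a bounded set.
  Finitely many multi-indices occur, so the sum of their individual bounds serves.\<close>

lemma schwartz_seminorm_bdd:
  fixes \<phi> :: "real^'n::finite \<Rightarrow> complex"
  assumes "schwartz \<phi>"
  shows "bdd_above ((\<lambda>(is, x). (1 + norm x) ^ N * cmod (partial_derivs is \<phi> x)) `
           ({is. length is \<le> N} \<times> UNIV))"
proof -
  have "\<forall>is. \<exists>C. \<forall>x. (1 + norm x) ^ N * cmod (partial_derivs is \<phi> x) \<le> C"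
    using assms by (simp add: schwartz_def)
  then obtain C where C: "\<And>is x. (1 + norm x) ^ N * cmod (partial_derivs is \<phi> x) \<le> C is" by metis
  let ?L = "{is :: 'n list. length is \<le> N}"
  have fin: "finite ?L" using finite_lists_length_le[of "UNIV :: 'n set" N] by simp
  show ?thesis
  proof (rule bdd_aboveI2)
    fix p assume p: "p \<in> ?L \<times> (UNIV :: (real^'n) set)"
    obtain "is" x where ix: "p = (is, x)" by (cases p)
    have "(1 + norm x) ^ N * cmod (partial_derivs is \<phi> x) \<le> \<bar>C is\<bar>" using C[of x "is"] by linarith
    also have "\<dots> \<le> (\<Sum>is\<in>?L. \<bar>C is\<bar>)" using p ix fin by (intro member_le_sum) auto
    finally show "(case p of (is, x) \<Rightarrow> (1 + norm x) ^ N * cmod (partial_derivs is \<phi> x)) \<le> (\<Sum>is\<in>?L. \<bar>C is\<bar>)"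
      by (simp add: ix)
  qed
qed

lemma schwartz_seminorm_ge:
  assumes "schwartz \<phi>" "length is \<le> N"
  shows "(1 + norm x) ^ N * cmod (partial_derivs is \<phi> x) \<le> schwartz_seminorm N \<phi>"
  unfolding schwartz_seminorm_def
  using cSUP_upper[OF _ schwartz_seminorm_bdd[OF assms(1), of N], of "(is, x)"] assms(2) by simp

lemma schwartz_seminorm_le:
  assumes "\<And>is x. length is \<le> N \<Longrightarrow> (1 + norm x) ^ N * cmod (partial_derivs is \<phi> x) \<le> C"
  shows "schwartz_seminorm N \<phi> \<le> C"
  unfolding schwartz_seminorm_def
proof (rule cSUP_least)
  have "([], 0) \<in> {is. length is \<le> N} \<times> UNIV" by simp
  then show "{is. length is \<le> N} \<times> UNIV \<noteq> {}" by blast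
qed (use assms in auto)

lemma schwartz_seminorm_nonneg: "schwartz \<phi> \<Longrightarrow> 0 \<le> schwartz_seminorm N \<phi>"
  by (rule order_trans[OF _ schwartz_seminorm_ge[of \<phi> "[]" N 0]]) auto

lemma schwartz_seminorm_mono:
  fixes \<phi> :: "real^'n::finite \<Rightarrow> complex"
  assumes "schwartz \<phi>" "N \<le> M"
  shows "schwartz_seminorm N \<phi> \<le> schwartz_seminorm M \<phi>"
proof (rule schwartz_seminorm_le)
  fix "is" :: "'n list" and x :: "real^'n" assume l: "length is \<le> N"
  have "(1 + norm x) ^ N * cmod (partial_derivs is \<phi> x) \<le> (1 + norm x) ^ M * cmod (partial_derivs is \<phi> x)"
    using assms by (intro mult_right_mono power_increasing) auto
  also have "\<dots> \<le> schwartz_seminorm M \<phi>" using assms l by (intro schwartz_seminorm_ge) auto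
  finally show "(1 + norm x) ^ N * cmod (partial_derivs is \<phi> x) \<le> schwartz_seminorm M \<phi>" .
qed

section \<open>Tempered distributions\<close>

lemma tempered_not_schwartz: "tempered f \<Longrightarrow> \<not> schwartz \<phi> \<Longrightarrow> f \<phi> = 0"
  and tempered_add_arg: "tempered f \<Longrightarrow> schwartz \<phi> \<Longrightarrow> schwartz \<psi> \<Longrightarrow> f (\<lambda>x. \<phi> x + \<psi> x) = f \<phi> + f \<psi>"
  and tempered_cmult_arg: "tempered f \<Longrightarrow> schwartz \<phi> \<Longrightarrow> f (\<lambda>x. c * \<phi> x) = c * f \<phi>"
  unfolding tempered_def by blast+

lemma tempered_diff_arg:
  "tempered f \<Longrightarrow> schwartz \<phi> \<Longrightarrow> schwartz \<psi> \<Longrightarrow> f (\<lambda>x. \<phi> x - \<psi> x) = f \<phi> - f \<psi>"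
  using tempered_add_arg[of f \<phi> "\<lambda>x. (-1) * \<psi> x"] tempered_cmult_arg[of f \<psi> "-1"]
    schwartz_cmult[of \<psi> "-1"] by simp

lemma tempered_bound:
  fixes f :: "'n::finite dist"
  assumes "tempered f"
  obtains C N where "C \<ge> 0" "\<And>\<phi>. schwartz \<phi> \<Longrightarrow> cmod (f \<phi>) \<le> C * schwartz_seminorm N \<phi>"
proof -
  from assms obtain C N where C: "\<And>\<phi>. schwartz \<phi> \<Longrightarrow> cmod (f \<phi>) \<le> C * schwartz_seminorm N \<phi>"
    unfolding tempered_def by blast
  show ?thesis
  proof (rule that)
    fix \<phi> :: "real^'n \<Rightarrow> complex" assume "schwartz \<phi>"
    then show "cmod (f \<phi>) \<le> \<bar>C\<bar> * schwartz_seminorm N \<phi>"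
      using C mult_right_mono[OF abs_ge_self[of C] schwartz_seminorm_nonneg] order_trans by blast
  qed simp
qed

lemma tempered_dist_zero: "tempered dist_zero"
  unfolding tempered_def dist_zero_def by (auto intro!: exI[of _ 0])

lemma tempered_dist_add:
  assumes "tempered f" "tempered g"
  shows "tempered (dist_add f g)"
proof -
  obtain C N where C: "C \<ge> 0" "\<And>\<phi>. schwartz \<phi> \<Longrightarrow> cmod (f \<phi>) \<le> C * schwartz_seminorm N \<phi>"
    using tempered_bound[OF assms(1)] by blast
  obtain D M where D: "D \<ge> 0" "\<And>\<phi>. schwartz \<phi> \<Longrightarrow> cmod (g \<phi>) \<le> D * schwartz_seminorm M \<phi>"
    using tempered_bound[OF assms(2)] by blast
  have "cmod (f \<phi> + g \<phi>) \<le> (C + D) * schwartz_seminorm (max N M) \<phi>" if "schwartz \<phi>" for \<phi>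
  proof -
    have "cmod (f \<phi> + g \<phi>) \<le> C * schwartz_seminorm N \<phi> + D * schwartz_seminorm M \<phi>"
      using norm_triangle_ineq[of "f \<phi>" "g \<phi>"] C(2) D(2) that by fastforce
    also have "\<dots> \<le> C * schwartz_seminorm (max N M) \<phi> + D * schwartz_seminorm (max N M) \<phi>"
      by (intro add_mono mult_left_mono schwartz_seminorm_mono that C D) auto
    finally show ?thesis by (simp add: distrib_right)
  qed
  then have "\<exists>C N. \<forall>\<phi>. schwartz \<phi> \<longrightarrow> cmod (f \<phi> + g \<phi>) \<le> C * schwartz_seminorm N \<phi>" by blast
  with assms show ?thesis
    unfolding tempered_def dist_add_def by (simp add: distrib_left)
qed

lemma tempered_dist_scale:
  assumes "tempered f"
  shows "tempered (dist_scale c f)"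
proof -
  obtain C N where C: "\<And>\<phi>. schwartz \<phi> \<Longrightarrow> cmod (f \<phi>) \<le> C * schwartz_seminorm N \<phi>"
    using tempered_bound[OF assms(1)] by blast
  have "cmod (c * f \<phi>) \<le> (cmod c * C) * schwartz_seminorm N \<phi>" if "schwartz \<phi>" for \<phi>
    using mult_left_mono[OF C[OF that], of "cmod c"] by (simp add: norm_mult mult.assoc)
  then have "\<exists>C N. \<forall>\<phi>. schwartz \<phi> \<longrightarrow> cmod (c * f \<phi>) \<le> C * schwartz_seminorm N \<phi>" by blast
  with assms show ?thesis
    unfolding tempered_def dist_scale_def by (simp add: distrib_left)
qed

lemma dist_diff_eq: "dist_diff f g = dist_add f (dist_scale (-1) g)"
  by (simp add: dist_diff_def dist_add_def dist_scale_def)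

lemma tempered_dist_diff: "tempered f \<Longrightarrow> tempered g \<Longrightarrow> tempered (dist_diff f g)"
  by (simp add: dist_diff_eq tempered_dist_add tempered_dist_scale)

text \<open>The factor \<open>1 / R\<close> is gained from one more power of the weight, as \<open>\<theta>\<close> vanishes near \<open>0\<close>.\<close>

lemma cutoff_complement_estimate:
  fixes \<theta> \<phi> :: "real^'n::finite \<Rightarrow> complex"
  assumes "smooth \<theta>" "\<And>js. \<exists>B. \<forall>x. cmod (partial_derivs js \<theta> x) \<le> B"
    and "\<And>x. norm x < r \<Longrightarrow> \<theta> x = 0" "r > 0" "schwartz \<phi>"
  shows "\<exists>C. \<forall>R\<ge>1. \<forall>x. (1 + norm x) ^ N * cmod (partial_derivs is (\<lambda>x. \<theta> ((1 / R) *\<^sub>R x) * \<phi> x) x) \<le> C / R"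
  using assms
\<comment> \<open>The innermost derivative is peeled off. The product rule then gives two functions
  of the same shape, with either \<theta> or \<phi> replaced by its derivative; the hypotheses on
  \<theta> are inherited, and the inner factor 1/R is at most 1.\<close>
proof (induction "is" arbitrary: \<theta> \<phi> rule: rev_induct)
  case Nil
  obtain B where B: "\<And>x. cmod (\<theta> x) \<le> B" using Nil(2)[of "[]"] by auto
  obtain D where D: "D > 0" "\<And>x. (1 + norm x) ^ Suc N * cmod (partial_derivs [] \<phi> x) \<le> D"
    using schwartz_decay[OF Nil(5)] by blast
  have B0: "0 \<le> B" using order_trans[OF norm_ge_zero B] .
  have "(1 + norm x) ^ N * cmod (\<theta> ((1 / R) *\<^sub>R x) * \<phi> x) \<le> (B * D / r) / R" if R: "R \<ge> 1" for R x
  proof (cases "norm ((1 / R) *\<^sub>R x) < r")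
    case True
    then show ?thesis using Nil(3) R B0 D(1) Nil(4) by simp
  next
    case False
    then have "r * R \<le> norm x" using R by (simp add: field_simps)
    then have x: "r * R \<le> 1 + norm x" by simp
    have "(r * R) * ((1 + norm x) ^ N * cmod (\<phi> x)) \<le> (1 + norm x) * ((1 + norm x) ^ N * cmod (\<phi> x))"
      using x by (intro mult_right_mono) auto
    also have "\<dots> \<le> D" using D(2)[of x] by (simp add: mult_ac)
    finally have "(1 + norm x) ^ N * cmod (\<phi> x) \<le> D / r / R"
      using R Nil(4) by (simp add: field_simps)
    then have "cmod (\<theta> ((1 / R) *\<^sub>R x)) * ((1 + norm x) ^ N * cmod (\<phi> x)) \<le> B * (D / r / R)"
      using B B0 by (intro mult_mono) auto
    then show ?thesis by (simp add: norm_mult mult_ac)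
  qed
  then show ?case unfolding partial_derivs.simps(1) by blast
next
  case (snoc i "is")
  have sm: "smooth \<theta>" "smooth \<phi>" using snoc.prems schwartz_smooth by auto
  have B': "\<exists>B. \<forall>x. cmod (partial_derivs js (partial_deriv i \<theta>) x) \<le> B" for js
    using snoc.prems(2)[of "js @ [i]"] by (simp add: partial_derivs_snoc)
  have Z': "partial_deriv i \<theta> x = 0" if "norm x < r" for x
    using partial_derivs_zero_on_open[of "ball 0 r" \<theta> x "[i]"] that snoc.prems(3) by simp
  obtain C1 where C1: "\<And>R x. R \<ge> 1 \<Longrightarrow> (1 + norm x) ^ N *
      cmod (partial_derivs is (\<lambda>x. partial_deriv i \<theta> ((1 / R) *\<^sub>R x) * \<phi> x) x) \<le> C1 / R"
    using snoc.IH[OF smooth_partial_deriv[OF sm(1)] B' Z' snoc.prems(4,5)] by blast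
  obtain C2 where C2: "\<And>R x. R \<ge> 1 \<Longrightarrow> (1 + norm x) ^ N *
      cmod (partial_derivs is (\<lambda>x. \<theta> ((1 / R) *\<^sub>R x) * partial_deriv i \<phi> x) x) \<le> C2 / R"
    using snoc.IH[OF snoc.prems(1-4) schwartz_partial_deriv[OF snoc.prems(5), of i]] by blast
  have "(1 + norm x) ^ N * cmod (partial_derivs (is @ [i]) (\<lambda>x. \<theta> ((1 / R) *\<^sub>R x) * \<phi> x) x) \<le> (C1 + C2) / R"
    if R: "R \<ge> 1" for R x
  proof -
    let ?A = "\<lambda>x. partial_deriv i \<theta> ((1 / R) *\<^sub>R x) * \<phi> x"
    let ?B = "\<lambda>x. \<theta> ((1 / R) *\<^sub>R x) * partial_deriv i \<phi> x"
    have smA: "smooth ?A" and smB: "smooth ?B"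
      by (intro smooth_mult smooth_scale smooth_partial_deriv sm)+
    have "partial_deriv i (\<lambda>x. \<theta> ((1 / R) *\<^sub>R x) * \<phi> x) = (\<lambda>x. of_real (1 / R) * ?A x + ?B x)"
      using sm smooth_scale[OF sm(1)]
      by (simp add: fun_eq_iff partial_deriv_mult smooth_differentiable partial_deriv_scale mult.assoc)
    then have e: "partial_derivs (is @ [i]) (\<lambda>x. \<theta> ((1 / R) *\<^sub>R x) * \<phi> x) x =
        of_real (1 / R) * partial_derivs is ?A x + partial_derivs is ?B x"
      using partial_derivs_add[OF smooth_mult[OF smooth_const smA] smB, of "is" "of_real (1 / R)"]
        partial_derivs_cmult[OF smA, of "is"]
      by (simp only: partial_derivs_snoc)
    have "cmod (partial_derivs (is @ [i]) (\<lambda>x. \<theta> ((1 / R) *\<^sub>R x) * \<phi> x) x) \<le>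
        cmod (of_real (1 / R) * partial_derivs is ?A x) + cmod (partial_derivs is ?B x)"
      unfolding e by (rule norm_triangle_ineq)
    also have "cmod (of_real (1 / R) * partial_derivs is ?A x) \<le> cmod (partial_derivs is ?A x)"
    proof -
      have "cmod (of_real (1 / R)) \<le> 1" using R by (simp add: norm_divide)
      then show ?thesis unfolding norm_mult by (intro mult_left_le_one_le) auto
    qed
    finally have "(1 + norm x) ^ N * cmod (partial_derivs (is @ [i]) (\<lambda>x. \<theta> ((1 / R) *\<^sub>R x) * \<phi> x) x)
       \<le> (1 + norm x) ^ N * (cmod (partial_derivs is ?A x) + cmod (partial_derivs is ?B x))"
      by (intro mult_left_mono) auto
    also have "\<dots> \<le> C1 / R + C2 / R"
      using C1[OF R, of x] C2[OF R, of x] by (simp only: distrib_left)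
    finally show ?thesis by (simp add: add_divide_distrib)
  qed
  then show ?case by blast
qed

text \<open>Cutting \<phi> off at radius R changes it by O(1/R) in each Schwartz seminorm, so |f
  \<phi>| is at most a constant over R. This is the density of test functions, needed because
  \<open>represents\<close> tests only against compact supports.\<close>

lemma tempered_zero_on_test_functions:
  fixes f :: "'n::finite dist"
  assumes f: "tempered f" and z: "\<And>\<phi>. test_function \<phi> \<Longrightarrow> f \<phi> = 0"
  shows "f = dist_zero"
proof -
  have "f \<phi> = 0" if \<phi>: "schwartz \<phi>" for \<phi>
  proof -
    obtain \<eta> :: "real^'n \<Rightarrow> complex" where \<eta>: "cutoff \<eta>" using cutoff_bump by blast
    from \<eta> obtain r where r: "r > 0" "\<And>x. norm x < r \<Longrightarrow> \<eta> x = 1" by (auto simp: cutoff_def)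
    have s\<eta>: "schwartz \<eta>" using \<eta> by (auto simp: cutoff_def test_function_def)
    define \<theta> where "\<theta> x = 1 - \<eta> x" for x
    have sm: "smooth \<theta>" unfolding \<theta>_def by (intro smooth_diff smooth_const schwartz_smooth s\<eta>)
    have bd: "\<exists>B. \<forall>x. cmod (partial_derivs js \<theta> x) \<le> B" for js
    proof -
      obtain C where C: "\<And>x. (1 + norm x) ^ 0 * cmod (partial_derivs js \<eta> x) \<le> C"
        using schwartz_decay[OF s\<eta>] by metis
      have c: "cmod (partial_derivs js (\<lambda>x::real^'n. 1) x) \<le> 1" for x
      proof (cases js)
        case (Cons j js')
        have "partial_derivs js' (\<lambda>x::real^'n. 1) = (\<lambda>x. if js' = [] then 1 else 0)"
          by (induction js') (auto simp: partial_deriv_const)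
        then show ?thesis using Cons by (simp add: partial_deriv_const)
      qed simp
      have "partial_derivs js \<theta> = (\<lambda>x. partial_derivs js (\<lambda>x. 1) x + (-1) * partial_derivs js \<eta> x)"
        using partial_derivs_add[OF smooth_const[of 1] smooth_mult[OF smooth_const[of "-1"] schwartz_smooth[OF s\<eta>]]]
          partial_derivs_cmult[OF schwartz_smooth[OF s\<eta>], of js "-1"]
        by (simp add: \<theta>_def[abs_def])
      then have "cmod (partial_derivs js \<theta> x) \<le> 1 + C" for x
        using norm_triangle_ineq4[of "partial_derivs js (\<lambda>x. 1) x" "partial_derivs js \<eta> x"] c[of x] C[of x]
        by simp
      then show ?thesis by blast
    qed
    have tz: "\<theta> x = 0" if "norm x < r" for x using r that by (simp add: \<theta>_def)
    obtain A N where A: "A \<ge> 0" "\<And>\<phi>. schwartz \<phi> \<Longrightarrow> cmod (f \<phi>) \<le> A * schwartz_seminorm N \<phi>"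
      using tempered_bound[OF f] by blast
    have "\<forall>is. \<exists>C. \<forall>R\<ge>1. \<forall>x. (1 + norm x) ^ N * cmod (partial_derivs is (\<lambda>x. \<theta> ((1 / R) *\<^sub>R x) * \<phi> x) x) \<le> C / R"
      using cutoff_complement_estimate[OF sm bd tz r(1) \<phi>] by blast
    then obtain C where C: "\<And>is R x. R \<ge> 1 \<Longrightarrow>
        (1 + norm x) ^ N * cmod (partial_derivs is (\<lambda>x. \<theta> ((1 / R) *\<^sub>R x) * \<phi> x) x) \<le> C is / R"
      by metis
    define D where "D = (\<Sum>is\<in>{is :: 'n list. length is \<le> N}. \<bar>C is\<bar>)"
    have fin: "finite {is :: 'n list. length is \<le> N}"
      using finite_lists_length_le[of "UNIV :: 'n set" N] by simp
    have main: "cmod (f \<phi>) \<le> A * D / R" if R: "R \<ge> 1" for R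
    proof -
      define \<phi>R where "\<phi>R x = \<eta> ((1 / R) *\<^sub>R x) * \<phi> x" for x
      have "{x. \<phi>R x \<noteq> 0} \<subseteq> (\<lambda>x. R *\<^sub>R x) ` {x. \<eta> x \<noteq> 0}"
      proof
        fix x assume "x \<in> {x. \<phi>R x \<noteq> 0}"
        then show "x \<in> (\<lambda>x. R *\<^sub>R x) ` {x. \<eta> x \<noteq> 0}"
          using R by (intro image_eqI[of _ _ "(1 / R) *\<^sub>R x"]) (auto simp: \<phi>R_def)
      qed
      moreover have "bounded {x. \<eta> x \<noteq> 0}" using \<eta> by (simp add: cutoff_def test_function_def)
      ultimately have "bounded {x. \<phi>R x \<noteq> 0}" using bounded_scaling bounded_subset by blast
      then have tR: "test_function \<phi>R"
        unfolding \<phi>R_def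
        by (intro test_function_intro smooth_mult smooth_scale schwartz_smooth s\<eta> \<phi>)
      then have sR: "schwartz \<phi>R" by (simp add: test_function_def)
      have e: "(\<lambda>x. \<theta> ((1 / R) *\<^sub>R x) * \<phi> x) = (\<lambda>x. \<phi> x - \<phi>R x)"
        by (simp add: \<theta>_def \<phi>R_def algebra_simps)
      have "f \<phi> = f (\<lambda>x. \<phi> x - \<phi>R x)"
        using tempered_diff_arg[OF f \<phi> sR] z[OF tR] by simp
      also have "cmod \<dots> \<le> A * schwartz_seminorm N (\<lambda>x. \<phi> x - \<phi>R x)"
        by (intro A schwartz_diff \<phi> sR)
      also have "schwartz_seminorm N (\<lambda>x. \<phi> x - \<phi>R x) \<le> D / R"
      proof (rule schwartz_seminorm_le)
        fix "is" :: "'n list" and x :: "real^'n" assume l: "length is \<le> N"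
        have "C is \<le> D" unfolding D_def
          using member_le_sum[of "is" "{is. length is \<le> N}" "\<lambda>is. \<bar>C is\<bar>"] l fin by auto
        then show "(1 + norm x) ^ N * cmod (partial_derivs is (\<lambda>x. \<phi> x - \<phi>R x) x) \<le> D / R"
          using C[OF R, of x "is"] R unfolding e by (meson divide_right_mono order_trans zero_le_one)
      qed
      finally show ?thesis using A(1) by (simp add: mult_left_mono)
    qed
    have "((\<lambda>R. A * D / R) \<longlongrightarrow> 0) at_top"
      by (rule real_tendsto_divide_at_top[OF tendsto_const filterlim_ident])
    then have "cmod (f \<phi>) \<le> 0"
      by (rule tendsto_lowerbound) (auto intro: eventually_mono[OF eventually_ge_at_top[of 1]] main)
    then show ?thesis by simp
  qed
  then show ?thesis using tempered_not_schwartz[OF f] by (force simp: dist_zero_def)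
qed

lemma tempered_eqI:
  assumes "tempered f" "tempered g" "\<And>\<phi>. test_function \<phi> \<Longrightarrow> f \<phi> = g \<phi>"
  shows "f = g"
proof -
  have "dist_diff f g = dist_zero"
    by (rule tempered_zero_on_test_functions[OF tempered_dist_diff[OF assms(1,2)]]) (simp add: assms(3) dist_diff_def)
  then show ?thesis by (simp add: dist_diff_def dist_zero_def fun_eq_iff)
qed

section \<open>Integration on Euclidean space\<close>

text \<open>Lebesgue measure on \<open>real^'n\<close> is the image of a finite product measure
  indexed by \<open>Basis\<close>; the bijection between indices and axis vectors transports Fubini
  for products to coordinates.\<close>

lemma
  fixes f :: "'n::finite \<Rightarrow> real \<Rightarrow> 'a::{real_normed_field,banach,second_countable_topology}"
  assumes f: "\<And>i. integrable lborel (f i)"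
  shows integrable_prod_cart: "integrable lborel (\<lambda>x::real^'n. \<Prod>i\<in>UNIV. f i (x $ i))"
    and integral_prod_cart: "(LINT x|lborel. (\<Prod>i\<in>UNIV. f i ((x::real^'n) $ i))) = (\<Prod>i\<in>UNIV. LINT x|lborel. f i x)"
proof -
  let ?B = "Basis :: (real^'n) set"
  have bij: "bij_betw (\<lambda>i. axis i (1::real)) (UNIV :: 'n set) ?B"
    by (auto simp: bij_betw_def inj_on_def Basis_vec_def axis_eq_axis)
  define g where "g b = f (inv_into UNIV (\<lambda>i. axis i (1::real)) b)" for b :: "real^'n"
  have g: "g (axis i 1) = f i" for i
    unfolding g_def using bij by (subst inv_into_f_f) (auto simp: bij_betw_def)
  interpret product_sigma_finite "\<lambda>_::real^'n. lborel :: real measure" ..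
  let ?T = "\<lambda>y::real^'n \<Rightarrow> real. \<Sum>b\<in>?B. y b *\<^sub>R b"
  have [measurable]: "f i \<in> borel_measurable borel" for i
    using borel_measurable_integrable[OF f] by simp
  have e: "(\<Prod>i\<in>UNIV. f i (?T y $ i)) = (\<Prod>b\<in>?B. g b (y b))" for y
  proof -
    have "?T y $ i = y (axis i 1)" for i
    proof -
      have "?T y $ i = ?T y \<bullet> axis i 1" by (simp add: inner_axis)
      also have "\<dots> = y (axis i 1)" by (rule inner_sum_left_Basis) (auto simp: Basis_vec_def)
      finally show ?thesis .
    qed
    then have "(\<Prod>i\<in>UNIV. f i (?T y $ i)) = (\<Prod>i\<in>UNIV. g (axis i 1) (y (axis i 1)))" by (simp add: g)
    also have "\<dots> = (\<Prod>b\<in>?B. g b (y b))"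
      by (rule prod.reindex_bij_betw[OF bij, of "\<lambda>b. g b (y b)"])
    finally show ?thesis .
  qed
  let ?F = "\<lambda>x::real^'n. \<Prod>i\<in>UNIV. f i (x $ i)"
  have tr: "integrable lborel h \<longleftrightarrow> integrable (Pi\<^sub>M ?B (\<lambda>_. lborel)) (\<lambda>y. h (?T y))"
      "integral\<^sup>L lborel h = (LINT y|Pi\<^sub>M ?B (\<lambda>_. lborel). h (?T y))"
    if "h \<in> borel_measurable borel" for h :: "real^'n \<Rightarrow> 'a"
    using that by (subst lborel_eq, subst integrable_distr_eq, simp_all)
      (subst lborel_eq, subst integral_distr, simp_all)
  have ig: "integrable lborel (g b)" for b using f by (simp add: g_def)
  have "integrable (Pi\<^sub>M ?B (\<lambda>_. lborel)) (\<lambda>y. \<Prod>b\<in>?B. g b (y b))"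
    by (rule product_integrable_prod) (use ig in auto)
  then have "integrable (Pi\<^sub>M ?B (\<lambda>_. lborel)) (\<lambda>y. ?F (?T y))" unfolding e .
  then show "integrable lborel ?F" using tr(1)[of ?F] by simp
  have "(LINT x|lborel. (\<Prod>i\<in>UNIV. f i ((x::real^'n) $ i))) = (LINT y|Pi\<^sub>M ?B (\<lambda>_. lborel). (\<Prod>b\<in>?B. g b (y b)))"
    using tr(2)[of ?F] unfolding e by simp
  also have "\<dots> = (\<Prod>b\<in>?B. LINT x|lborel. g b x)"
    by (rule product_integral_prod) (use ig in auto)
  also have "\<dots> = (\<Prod>i\<in>UNIV. LINT x|lborel. f i x)"
    using prod.reindex_bij_betw[OF bij, of "\<lambda>b. LINT x|lborel. g b x"] by (simp add: g)
  finally show "(LINT x|lborel. (\<Prod>i\<in>UNIV. f i ((x::real^'n) $ i))) = (\<Prod>i\<in>UNIV. LINT x|lborel. f i x)" .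
qed

text \<open>The weight (1 + |x|)^(2n) dominates the product of the n factors 1 + x_i^2, whose
  reciprocal is integrable by the product formula.\<close>

lemma integrable_decay:
  fixes f :: "real^'n::finite \<Rightarrow> 'a::{banach,second_countable_topology}"
  assumes f: "f \<in> borel_measurable borel"
    and b: "\<And>x. (1 + norm x) ^ (2 * CARD('n)) * norm (f x) \<le> C"
  shows "integrable lborel f"
proof (rule Bochner_Integration.integrable_bound)
  have "integrable lborel (\<lambda>x::real. inverse (1 + x\<^sup>2))"
    using integrable_inverse_1_plus_square by (simp add: set_integrable_def)
  then have "integrable lborel (\<lambda>x::real^'n. \<Prod>i\<in>UNIV. inverse (1 + (x $ i)\<^sup>2))"
    by (rule integrable_prod_cart)
  then show "integrable lborel (\<lambda>x::real^'n. C * (\<Prod>i\<in>UNIV. inverse (1 + (x $ i)\<^sup>2)))" by simp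
  show "AE x in lborel. norm (f x) \<le> norm (C * (\<Prod>i\<in>UNIV. inverse (1 + (x $ i)\<^sup>2)))"
  proof (rule AE_I2)
    fix x :: "real^'n"
    let ?P = "\<Prod>i\<in>UNIV. (1 + (x $ i)\<^sup>2)"
    have P: "?P > 0" by (intro prod_pos) (auto simp: add_pos_nonneg)
    have "?P \<le> (\<Prod>i\<in>(UNIV::'n set). (1 + norm x)\<^sup>2)"
    proof (rule prod_mono)
      fix i :: 'n
      have "(x $ i)\<^sup>2 \<le> (norm x)\<^sup>2" using component_le_norm_cart[of x i] by (metis abs_ge_zero power2_abs power_mono)
      then show "0 \<le> 1 + (x $ i)\<^sup>2 \<and> 1 + (x $ i)\<^sup>2 \<le> (1 + norm x)\<^sup>2"
        unfolding power2_sum one_power2 using norm_ge_zero[of x] zero_le_power2[of "x $ i"]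
        by (intro conjI) linarith+
    qed
    also have "\<dots> = (1 + norm x) ^ (2 * CARD('n))" by (simp add: power_mult)
    finally have "?P * norm (f x) \<le> C"
      using b[of x] by (meson mult_right_mono norm_ge_zero order_trans)
    then have "norm (f x) \<le> C * inverse ?P" using P by (simp add: field_simps)
    then show "norm (f x) \<le> norm (C * (\<Prod>i\<in>UNIV. inverse (1 + (x $ i)\<^sup>2)))"
      using prod_inversef[of "\<lambda>i. 1 + (x $ i)\<^sup>2" UNIV] by (simp add: o_def)
  qed
qed (use f in simp)

lemma schwartz_borel: "schwartz \<phi> \<Longrightarrow> \<phi> \<in> borel_measurable borel"
  by (simp add: schwartz_smooth smooth_borel)

lemma schwartz_bounded:
  assumes "schwartz \<phi>" obtains C where "C > 0" "\<And>x. cmod (\<phi> x) \<le> C"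
  using schwartz_decay[OF assms, of 0 "[]"] by auto

lemma schwartz_integrable_mult:
  fixes \<phi> :: "real^'n::finite \<Rightarrow> complex"
  assumes "schwartz \<phi>" "g \<in> borel_measurable borel" "\<And>x. cmod (g x) \<le> B"
  shows "integrable lborel (\<lambda>x. g x * \<phi> x)"
proof -
  obtain C where C: "\<And>x. (1 + norm x) ^ (2 * CARD('n)) * cmod (\<phi> x) \<le> C"
    using schwartz_decay[OF assms(1), of _ "[]"] by (metis partial_derivs.simps(1))
  note [measurable] = schwartz_borel[OF assms(1)] assms(2)
  have "(1 + norm x) ^ (2 * CARD('n)) * cmod (g x * \<phi> x) \<le> B * C" for x
  proof -
    have "cmod (g x) * ((1 + norm x) ^ (2 * CARD('n)) * cmod (\<phi> x)) \<le> B * C"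
      using C assms(3) order_trans[OF norm_ge_zero assms(3)] by (intro mult_mono) auto
    then show ?thesis by (simp add: norm_mult mult_ac)
  qed
  then show ?thesis by (intro integrable_decay) auto
qed

lemma schwartz_integrable: "schwartz \<phi> \<Longrightarrow> integrable lborel \<phi>"
  using schwartz_integrable_mult[of \<phi> "\<lambda>x. 1" 1] by simp

lemma schwartz_integrable_prod:
  assumes "schwartz \<phi>" "schwartz \<psi>"
  shows "integrable lebesgue (\<lambda>x. \<psi> x * \<phi> x)"
proof -
  note [measurable] = schwartz_borel[OF assms(1)] schwartz_borel[OF assms(2)]
  obtain C where "\<And>x. cmod (\<psi> x) \<le> C" using schwartz_bounded[OF assms(2)] by blast
  then have "integrable lborel (\<lambda>x. \<psi> x * \<phi> x)"
    by (intro schwartz_integrable_mult[OF assms(1)]) auto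
  then show ?thesis by (subst integrable_completion) simp_all
qed

lemma lebesgue_integral_scale:
  fixes f :: "real^'n::finite \<Rightarrow> complex"
  assumes l: "l > 0"
  shows "(LINT x|lebesgue. f x) = of_real (l ^ CARD('n)) * (LINT x|lebesgue. f (l *\<^sub>R x))"
    and "integrable lebesgue f \<Longrightarrow> integrable lebesgue (\<lambda>x. f (l *\<^sub>R x))"
    and "f \<in> borel_measurable lebesgue \<Longrightarrow> (\<lambda>x. f (l *\<^sub>R x)) \<in> borel_measurable lebesgue"
proof -
  have T: "(\<lambda>x::real^'n. 0 + (\<Sum>j\<in>Basis. (l * (x \<bullet> j)) *\<^sub>R j)) = (\<lambda>x. l *\<^sub>R x)"
    by (simp add: scaleR_scaleR[symmetric] scaleR_sum_right[symmetric] euclidean_representation del: scaleR_scaleR)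
  have L: "lebesgue = density (distr lebesgue lebesgue (\<lambda>x::real^'n. l *\<^sub>R x)) (\<lambda>_. ennreal (l ^ CARD('n)))"
    using lebesgue_affine_euclidean[of "\<lambda>_. l" "0::real^'n"] l unfolding T by (simp add: prod_constant)
  have M[measurable]: "(\<lambda>x::real^'n. l *\<^sub>R x) \<in> lebesgue \<rightarrow>\<^sub>M lebesgue"
    using lebesgue_affine_measurable[of "\<lambda>_. l" "0::real^'n"] l unfolding T by simp
  show me: "(\<lambda>x. f (l *\<^sub>R x)) \<in> borel_measurable lebesgue" if "f \<in> borel_measurable lebesgue" for f :: "real^'n \<Rightarrow> complex"
    using measurable_compose[OF M that] .
  show int: "integrable lebesgue (\<lambda>x. f (l *\<^sub>R x))" if f: "integrable lebesgue f" for f :: "real^'n \<Rightarrow> complex"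
  proof -
    have [measurable]: "f \<in> borel_measurable lebesgue" using f by auto
    have "integrable (density (distr lebesgue lebesgue (\<lambda>x::real^'n. l *\<^sub>R x)) (\<lambda>_. ennreal (l ^ CARD('n)))) f"
      using f L by metis
    then have "integrable (distr lebesgue lebesgue (\<lambda>x::real^'n. l *\<^sub>R x)) (\<lambda>x. (l ^ CARD('n)) *\<^sub>R f x)"
      using l by (subst (asm) integrable_density) auto
    then have "integrable (distr lebesgue lebesgue (\<lambda>x::real^'n. l *\<^sub>R x)) f"
      using l integrable_scaleR_right[of "inverse (l ^ CARD('n))" _ "\<lambda>x. (l ^ CARD('n)) *\<^sub>R f x"] by simp
    then show ?thesis by (subst (asm) integrable_distr_eq) auto
  qed
  show "(LINT x|lebesgue. f x) = of_real (l ^ CARD('n)) * (LINT x|lebesgue. f (l *\<^sub>R x))"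
  proof (cases "f \<in> borel_measurable lebesgue")
    case True
    then have [measurable]: "f \<in> borel_measurable lebesgue" .
    have "(LINT x|lebesgue. f x) =
        (LINT x|density (distr lebesgue lebesgue (\<lambda>x::real^'n. l *\<^sub>R x)) (\<lambda>_. ennreal (l ^ CARD('n))). f x)"
      using L by metis
    also have "\<dots> = (LINT x|distr lebesgue lebesgue (\<lambda>x::real^'n. l *\<^sub>R x). (l ^ CARD('n)) *\<^sub>R f x)"
      using l by (subst integral_density) auto
    also have "\<dots> = (LINT x|lebesgue. (l ^ CARD('n)) *\<^sub>R f (l *\<^sub>R x))"
      by (subst integral_distr) auto
    finally show ?thesis by (simp add: scaleR_conv_of_real)
  next
    case False
    \<comment> \<open>Scaling is invertible, so the dilated function is not measurable either. Both
      integrals then have the default value 0 and the identity survives without a measurability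
      hypothesis.\<close>
    have "(\<lambda>x. f (l *\<^sub>R x)) \<notin> borel_measurable lebesgue"
    proof
      assume "(\<lambda>x. f (l *\<^sub>R x)) \<in> borel_measurable lebesgue"
      moreover have "(\<lambda>x::real^'n. (1 / l) *\<^sub>R x) \<in> lebesgue \<rightarrow>\<^sub>M lebesgue"
        using lebesgue_affine_measurable[of "\<lambda>_. 1 / l" "0::real^'n"] l
        by (simp add: scaleR_scaleR[symmetric] scaleR_sum_right[symmetric] euclidean_representation
             divide_inverse mult.commute[of _ "inverse l"] del: scaleR_scaleR)
      ultimately have "(\<lambda>x. f (l *\<^sub>R ((1 / l) *\<^sub>R x))) \<in> borel_measurable lebesgue"
        using measurable_compose by blast
      with False l show False by simp
    qed
    with False show ?thesis
      by (metis borel_measurable_integrable mult_zero_right not_integrable_integral_eq)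
  qed
qed

section \<open>Locally integrable functions as distributions\<close>

text \<open>Boxes are stable under intersection and generate the Borel sets, so the vanishing
  integrals extend to all measurable sets, and densities are unique. The whole space is not a box;
  \<open>z0\<close> covers it, as complements require.\<close>

lemma AE_zero_of_box_integrals:
  fixes f :: "real^'n::finite \<Rightarrow> real"
  assumes f: "integrable lebesgue f"
    and z: "\<And>a b. (LINT x|lebesgue. indicator (box a b) x * f x) = 0" and z0: "(LINT x|lebesgue. f x) = 0"
  shows "AE x in lebesgue. f x = 0"
proof (rule density_unique_real[OF f, of "\<lambda>x. 0"])
  have [measurable]: "f \<in> borel_measurable lebesgue" using f by auto
  have ind: "integrable lebesgue (\<lambda>x. indicator A x * f x)" if "A \<in> sets lebesgue" for A
    using integrable_mult_indicator[OF that f] by simp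
  have borel: "(LINT x|lebesgue. indicator A x * f x) = 0" if "A \<in> sets borel" for A
  proof -
    have "Int_stable (range (\<lambda>(a, b). box a b :: (real^'n) set))"
      unfolding Int_stable_def by (auto simp: box_Int_box)
    moreover have "range (\<lambda>(a, b). box a b :: (real^'n) set) \<subseteq> Pow UNIV" by simp
    moreover have "A \<in> sigma_sets UNIV (range (\<lambda>(a, b). box a b :: (real^'n) set))"
      using that unfolding borel_eq_box by simp
    ultimately show ?thesis
    proof (induction rule: sigma_sets_induct_disjoint)
      case (basic A)
      then show ?case using z by auto
    next
      case (compl A)
      then have A: "A \<in> sets lebesgue" unfolding borel_eq_box[symmetric]
        by (metis borel_eq_box sets_completionI_sets sets_lborel sets_measure_of top_greatest space_borel
            Pow_UNIV)
      have "(LINT x|lebesgue. indicator (UNIV - A) x * f x) = (LINT x|lebesgue. f x - indicator A x * f x)"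
        by (intro Bochner_Integration.integral_cong) (auto simp: indicator_def)
      also have "\<dots> = 0" using compl(2) z0 by (subst Bochner_Integration.integral_diff[OF f ind[OF A]]) simp
      finally show ?case .
    next
      case (union A)
      have A: "A i \<in> sets lebesgue" for i
        using union(2)[of ] by (metis borel_eq_box range_subsetD sets_completionI_sets sets_lborel sets_measure_of top_greatest Pow_UNIV)
      have sum: "(\<lambda>i. indicator (A i) x * f x) sums (indicator (\<Union>i. A i) x * f x)" for x
        by (intro sums_mult2 indicator_sums) (use union(1) in \<open>auto simp: disjoint_family_on_def\<close>)
      \<comment> \<open>Partial sums over disjoint sets are indicators of finite unions, hence
        dominated by |f|.\<close>
      have "(\<lambda>n. LINT x|lebesgue. (\<Sum>i<n. indicator (A i) x * f x)) \<longlonglongrightarrow> (LINT x|lebesgue. indicator (\<Union>i. A i) x * f x)"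
      proof (rule integral_dominated_convergence[where w = "\<lambda>x. norm (f x)"])
        show "AE x in lebesgue. (\<lambda>n. \<Sum>i<n. indicator (A i) x * f x) \<longlonglongrightarrow> indicator (\<Union>i. A i) x * f x"
          using sum by (auto simp: sums_def)
        show "AE x in lebesgue. norm (\<Sum>i<n. indicator (A i) x * f x) \<le> norm (f x)" for n
        proof (rule AE_I2)
          fix x
          have e: "(\<Sum>i<n. indicator (A i) x * f x) = indicator (\<Union>i<n. A i) x * f x"
            unfolding sum_distrib_right[symmetric]
            using union(1) by (subst indicator_UN_disjoint) (auto simp: disjoint_family_on_def)
          show "norm (\<Sum>i<n. indicator (A i) x * f x) \<le> norm (f x)" unfolding e by (simp add: indicator_def)
        qed
      qed (use A f in \<open>auto intro!: borel_measurable_sum\<close>)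
      moreover have "(LINT x|lebesgue. (\<Sum>i<n. indicator (A i) x * f x)) = 0" for n
        by (subst Bochner_Integration.integral_sum) (use ind[OF A] union(3) in auto)
      ultimately show ?case by (simp add: LIMSEQ_const_iff)
    qed simp
  qed
  \<comment> \<open>A Lebesgue set differs from a Borel set by a subset of a null set, which the
    integral does not see.\<close>
  fix A :: "(real^'n) set" assume "A \<in> sets lebesgue"
  then obtain S N N' where A: "A = S \<union> N" "N \<subseteq> N'" "N' \<in> null_sets lborel" "S \<in> sets lborel"
    by (rule sets_completionE)
  have "N' \<in> null_sets lebesgue" using A(3) null_sets_completionI by blast
  then have "AE x in lebesgue. x \<notin> N'" by (rule AE_not_in)
  then have "AE x in lebesgue. indicator A x * f x = indicator S x * f x"
    by eventually_elim (use A in \<open>auto simp: indicator_def\<close>)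
  then have "(LINT x|lebesgue. indicator A x * f x) = (LINT x|lebesgue. indicator S x * f x)"
    using \<open>A \<in> sets lebesgue\<close> sets_completionI_sets[OF A(4)] by (intro integral_cong_AE) auto
  then show "(LINT x:A|lebesgue. f x) = (LINT x:A|lebesgue. 0)"
    using borel A(4) by (simp add: set_lebesgue_integral_def)
qed simp

text \<open>Bumps are test functions converging boundedly to indicators of boxes, so all box
  integrals of F vanish. The preceding criterion wants a globally integrable real function, hence
  the passage to F cut off to a box and to its real and imaginary parts.\<close>

lemma fundamental_lemma:
  fixes F :: "real^'n::finite \<Rightarrow> complex"
  assumes F: "\<And>S. compact S \<Longrightarrow> F absolutely_integrable_on S"
    and z: "\<And>\<phi>. test_function \<phi> \<Longrightarrow> (LINT x|lebesgue. F x * \<phi> x) = 0"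
  shows "AE x in lebesgue. F x = 0"
proof -
  have int: "integrable lebesgue (\<lambda>x. indicator (box a b) x *\<^sub>R F x)" for a b
    using set_integrable_subset[OF F[OF compact_cbox[of a b]], of "box a b"]
    by (simp add: set_integrable_def box_subset_cbox)
  have box0: "(LINT x|lebesgue. indicator (box a b) x *\<^sub>R F x) = 0" for a b
  proof -
    have [measurable]: "(\<lambda>x. bump k a b x) \<in> borel_measurable borel" for k
      using measurable_compose[OF smooth_borel[OF smooth_bump[of k a b]] borel_measurable_Re] by simp
    have me: "(\<lambda>x. bump k a b x *\<^sub>R F x) \<in> borel_measurable lebesgue" if "k > 0" for k
    proof -
      have [measurable]: "(\<lambda>x. bump k a b x) \<in> borel_measurable lebesgue"
        by (rule measurable_completion) simp
      have "(\<lambda>x. bump k a b x *\<^sub>R F x) = (\<lambda>x. bump k a b x *\<^sub>R (indicator (box a b) x *\<^sub>R F x))"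
      proof
        fix x show "bump k a b x *\<^sub>R F x = bump k a b x *\<^sub>R (indicator (box a b) x *\<^sub>R F x)"
          using bump_eq_0[OF that, of x a b] by (cases "x \<in> box a b") simp_all
      qed
      moreover have "(\<lambda>x. bump k a b x *\<^sub>R (indicator (box a b) x *\<^sub>R F x)) \<in> borel_measurable lebesgue"
        by (intro borel_measurable_scaleR borel_measurable_integrable[OF int]) simp
      ultimately show ?thesis by simp
    qed
    have "(\<lambda>m. LINT x|lebesgue. bump (real (Suc m)) a b x *\<^sub>R F x) \<longlonglongrightarrow> (LINT x|lebesgue. indicator (box a b) x *\<^sub>R F x)"
    proof (rule integral_dominated_convergence[where w = "\<lambda>x. norm (indicator (box a b) x *\<^sub>R F x)"])
      show "AE x in lebesgue. (\<lambda>m. bump (real (Suc m)) a b x *\<^sub>R F x) \<longlonglongrightarrow> indicator (box a b) x *\<^sub>R F x"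
        by (intro AE_I2 tendsto_intros bump_tendsto_indicator)
      show "AE x in lebesgue. norm (bump (real (Suc m)) a b x *\<^sub>R F x) \<le> norm (indicator (box a b) x *\<^sub>R F x)" for m
        using bump_eq_0[of "real (Suc m)" _ a b] bump_bounds[of "real (Suc m)" a b]
        by (intro AE_I2) (auto simp: indicator_def mult_left_le_one_le)
    qed (use me in \<open>auto intro: integrable_norm[OF int] borel_measurable_integrable[OF int] simp del: norm_scaleR scaleR_conv_of_real\<close>)
    moreover have "(LINT x|lebesgue. bump (real (Suc m)) a b x *\<^sub>R F x) = 0" for m
      using z[OF test_function_bump[of "real (Suc m)" a b]] by (simp add: scaleR_conv_of_real mult.commute)
    ultimately show ?thesis by (simp add: LIMSEQ_const_iff)
  qed
  \<comment> \<open>A box met with the cutting box is again a box, so the cut function inherits the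
    vanishing integrals.\<close>
  have local: "AE x in lebesgue. indicator (box a b) x *\<^sub>R F x = 0" for a b
  proof -
    let ?G = "\<lambda>x. indicator (box a b) x *\<^sub>R F x"
    have e: "indicator (box c d) x *\<^sub>R ?G x = indicator (box c d \<inter> box a b) x *\<^sub>R F x" for c d x
      by (simp add: indicator_def)
    have i: "integrable lebesgue (\<lambda>x. indicator (box c d) x *\<^sub>R ?G x)"
      and zz: "(LINT x|lebesgue. indicator (box c d) x *\<^sub>R ?G x) = 0" for c d
      unfolding e box_Int_box by (rule int, rule box0)
    have "AE x in lebesgue. Re (?G x) = 0"
    proof (rule AE_zero_of_box_integrals)
      show "integrable lebesgue (\<lambda>x. Re (?G x))" using int by (rule integrable_Re)
      show "(LINT x|lebesgue. indicator (box c d) x * Re (?G x)) = 0" for c d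
        using integral_Re[OF i[of c d]] zz[of c d] by (simp add: mult.assoc)
      show "(LINT x|lebesgue. Re (?G x)) = 0" using integral_Re[OF int[of a b]] box0 by simp
    qed
    moreover have "AE x in lebesgue. Im (?G x) = 0"
    proof (rule AE_zero_of_box_integrals)
      show "integrable lebesgue (\<lambda>x. Im (?G x))" using int by (rule integrable_Im)
      show "(LINT x|lebesgue. indicator (box c d) x * Im (?G x)) = 0" for c d
        using integral_Im[OF i[of c d]] zz[of c d] by (simp add: mult.assoc)
      show "(LINT x|lebesgue. Im (?G x)) = 0" using integral_Im[OF int[of a b]] box0 by simp
    qed
    ultimately show ?thesis by eventually_elim (simp add: complex_eq_iff)
  qed
  have "AE x in lebesgue. \<forall>k::nat. indicator (box (\<chi> i. - real k) (\<chi> i. real k)) x *\<^sub>R F x = 0"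
    unfolding AE_all_countable using local by blast
  then show ?thesis
  proof eventually_elim
    case (elim x)
    obtain k where "norm x < real k" using reals_Archimedean2 by blast
    then have "x \<in> box (\<chi> i. - real k) (\<chi> i. real k)"
      using component_le_norm_cart[of x] by (auto simp: mem_box_cart) (smt (verit))+
    with elim[rule_format, of k] show ?case by simp
  qed
qed

section \<open>The heat semigroup on Schwartz functions\<close>

text \<open>The kernel is the density of independent centred Gaussians of variance 2t. Mass, moments
  and Fourier transform are thereby reduced to the one-dimensional normal distribution.\<close>

lemma
  assumes t: "t > 0"
  shows heat_kernel_eq_prod: "heat_kernel t (x::real^'n::finite) = (\<Prod>i\<in>UNIV. normal_density 0 (sqrt (2 * t)) (x $ i))"
    and heat_kernel_nonneg: "0 \<le> heat_kernel t x"
proof -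
  have "(norm x)\<^sup>2 = (\<Sum>i\<in>UNIV. (x $ i)\<^sup>2)"
    by (simp add: norm_vec_def L2_set_def sum_nonneg)
  then have "exp (- (norm x)\<^sup>2 / (4 * t)) = exp (\<Sum>i\<in>UNIV. - (x $ i)\<^sup>2 / (4 * t))"
    by (simp add: sum_negf sum_divide_distrib)
  then have e: "exp (- (norm x)\<^sup>2 / (4 * t)) = (\<Prod>i\<in>UNIV. exp (- (x $ i)\<^sup>2 / (4 * t)))"
    by (simp add: exp_sum)
  have c: "(4 * pi * t) powr (- real CARD('n) / 2) = (\<Prod>i\<in>(UNIV::'n set). 1 / sqrt (4 * pi * t))"
    using t by (simp add: powr_half_sqrt[symmetric] powr_powr powr_minus_divide[symmetric] powr_realpow[symmetric] power_one_over[symmetric])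
  show "heat_kernel t x = (\<Prod>i\<in>UNIV. normal_density 0 (sqrt (2 * t)) (x $ i))"
    unfolding heat_kernel_def e c prod.distrib[symmetric]
    using t by (intro prod.cong) (simp_all add: normal_density_def mult_ac)
  show "0 \<le> heat_kernel t x" by (simp add: heat_kernel_def)
qed

lemma heat_kernel_borel [measurable]: "heat_kernel t \<in> borel_measurable borel"
  unfolding heat_kernel_def[abs_def] by measurable

lemma one_plus_sum_le_prod:
  fixes f :: "'a \<Rightarrow> real"
  assumes "finite I" "\<And>i. i \<in> I \<Longrightarrow> f i \<ge> 0"
  shows "1 + (\<Sum>i\<in>I. f i) \<le> (\<Prod>i\<in>I. 1 + f i)"
  using assms
proof (induction I rule: finite_induct)
  case (insert i I)
  have "1 + (\<Sum>i\<in>I. f i) \<le> (\<Prod>i\<in>I. 1 + f i)" "1 \<le> 1 + (\<Sum>i\<in>I. f i)"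
    using insert by (auto intro: sum_nonneg)
  then have "(1 + (\<Sum>i\<in>I. f i)) + f i * 1 \<le> (\<Prod>i\<in>I. 1 + f i) + f i * (\<Prod>i\<in>I. 1 + f i)"
    using insert.prems[of i] by (intro add_mono mult_left_mono) auto
  then show ?case using insert by (simp add: algebra_simps)
qed simp

text \<open>Since 1 + |z| is at most the product of the 1 + |z_i|, the weight factorises as well,
  and each factor is a finite combination of absolute Gaussian moments.\<close>

lemma heat_kernel_weighted_integrable:
  assumes t: "t > 0"
  shows "integrable lborel (\<lambda>z::real^'n::finite. (1 + norm z) ^ N * heat_kernel t z)"
proof (rule Bochner_Integration.integrable_bound)
  let ?d = "normal_density 0 (sqrt (2 * t))"
  have s: "sqrt (2 * t) > 0" using t by simp
  have "integrable lborel (\<lambda>x. (1 + \<bar>x\<bar>) ^ N * ?d x)"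
  proof -
    have "integrable lborel (\<lambda>x. ?d x * \<bar>x\<bar> ^ k)" for k
      using integrable_normal_moment_abs[OF s, of 0 k] by simp
    then have "integrable lborel (\<lambda>x. \<Sum>k\<le>N. real (N choose k) * (?d x * \<bar>x\<bar> ^ k))"
      by (intro Bochner_Integration.integrable_sum integrable_mult_right)
    moreover have "(\<Sum>k\<le>N. real (N choose k) * (?d x * \<bar>x\<bar> ^ k)) = (1 + \<bar>x\<bar>) ^ N * ?d x" for x
      using binomial_ring[of "\<bar>x\<bar>" 1 N] by (simp add: add.commute sum_distrib_left mult_ac)
    ultimately show ?thesis by simp
  qed
  then show "integrable lborel (\<lambda>z::real^'n. \<Prod>i\<in>UNIV. (1 + \<bar>z $ i\<bar>) ^ N * ?d (z $ i))"
    by (rule integrable_prod_cart)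
  show "AE z::real^'n in lborel. norm ((1 + norm z) ^ N * heat_kernel t z) \<le>
      norm (\<Prod>i\<in>UNIV. (1 + \<bar>z $ i\<bar>) ^ N * ?d (z $ i))"
  proof (rule AE_I2)
    fix z :: "real^'n"
    have "1 + norm z \<le> 1 + (\<Sum>i\<in>UNIV. \<bar>z $ i\<bar>)" using norm_le_l1_cart[of z] by simp
    also have "\<dots> \<le> (\<Prod>i\<in>UNIV. 1 + \<bar>z $ i\<bar>)" by (rule one_plus_sum_le_prod) auto
    finally have "(1 + norm z) ^ N \<le> (\<Prod>i\<in>UNIV. 1 + \<bar>z $ i\<bar>) ^ N" by (intro power_mono) auto
    then have "(1 + norm z) ^ N * heat_kernel t z \<le> (\<Prod>i\<in>UNIV. 1 + \<bar>z $ i\<bar>) ^ N * heat_kernel t z"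
      by (intro mult_right_mono heat_kernel_nonneg t)
    also have "\<dots> = (\<Prod>i\<in>UNIV. (1 + \<bar>z $ i\<bar>) ^ N * ?d (z $ i))"
      using t by (simp add: heat_kernel_eq_prod prod.distrib prod_power_distrib)
    finally show "norm ((1 + norm z) ^ N * heat_kernel t z) \<le> norm (\<Prod>i\<in>UNIV. (1 + \<bar>z $ i\<bar>) ^ N * ?d (z $ i))"
      using heat_kernel_nonneg[OF t, of z] by (simp add: abs_mult)
  qed
qed measurable

lemma heat_kernel_integrable: "t > 0 \<Longrightarrow> integrable lborel (heat_kernel t :: real^'n::finite \<Rightarrow> real)"
  using heat_kernel_weighted_integrable[of t 0] by simp

lemma heat_kernel_integral:
  assumes "t > 0" shows "(LINT z|lborel. heat_kernel t (z::real^'n::finite)) = 1"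
proof -
  have "(LINT z|lborel. heat_kernel t (z::real^'n)) = (\<Prod>i\<in>(UNIV::'n set). LINT x|lborel. normal_density 0 (sqrt (2 * t)) x)"
    unfolding heat_kernel_eq_prod[OF assms] using assms by (intro integral_prod_cart integrable_normal_density) simp
  then show ?thesis using assms by simp
qed

text \<open>Substituting x = \<sigma> y reduces this to the characteristic function of the standard
  normal law at -\<xi>\<sigma>.\<close>

lemma fourier_normal_density:
  assumes s: "\<sigma> > 0"
  shows "(LINT x|lborel. exp (- (\<i> * of_real (\<xi> * x))) * of_real (normal_density 0 \<sigma> x)) = of_real (exp (- (\<sigma>\<^sup>2 * \<xi>\<^sup>2 / 2)))"
proof -
  have nd: "\<bar>\<sigma>\<bar> * normal_density 0 \<sigma> (0 + \<sigma> * y) = std_normal_density y" for y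
    using s by (simp add: normal_density_def real_sqrt_mult power_mult_distrib field_simps)
  have "(LINT x|lborel. exp (- (\<i> * of_real (\<xi> * x))) * of_real (normal_density 0 \<sigma> x)) =
      \<bar>\<sigma>\<bar> *\<^sub>R (LINT y|lborel. exp (- (\<i> * of_real (\<xi> * (0 + \<sigma> * y)))) * of_real (normal_density 0 \<sigma> (0 + \<sigma> * y)))"
    by (rule lborel_integral_real_affine) (use s in simp)
  also have "\<dots> = (LINT y|lborel. exp (- (\<i> * of_real (\<xi> * (0 + \<sigma> * y)))) * of_real (std_normal_density y))"
    unfolding nd[symmetric] by (simp add: scaleR_conv_of_real mult_ac flip: integral_mult_right_zero)
  also have "\<dots> = char std_normal_distribution (- (\<xi> * \<sigma>))"
    unfolding char_def by (subst integral_density) (auto simp: scaleR_conv_of_real mult_ac)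
  also have "\<dots> = of_real (exp (- (\<sigma>\<^sup>2 * \<xi>\<^sup>2 / 2)))"
    by (simp add: char_std_normal_distribution power_mult_distrib mult_ac)
  finally show ?thesis .
qed

lemma fourier_heat_kernel:
  fixes \<xi> :: "real^'n::finite"
  assumes t: "t > 0"
  shows "(LINT z|lborel. exp (- (\<i> * of_real (\<xi> \<bullet> z))) * of_real (heat_kernel t z)) = of_real (exp (- t * (norm \<xi>)\<^sup>2))"
proof -
  let ?d = "normal_density 0 (sqrt (2 * t))"
  have e: "exp (- (\<i> * of_real (\<xi> \<bullet> z))) * of_real (heat_kernel t z) =
      (\<Prod>i\<in>UNIV. exp (- (\<i> * of_real (\<xi> $ i * z $ i))) * of_real (?d (z $ i)))" for z :: "real^'n"
    by (simp add: heat_kernel_eq_prod[OF t] prod.distrib exp_sum[symmetric] inner_vec_def sum_distrib_left sum_negf)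
  have "integrable lborel (\<lambda>x. exp (- (\<i> * of_real (c * x))) * complex_of_real (?d x))" for c
    by (rule Bochner_Integration.integrable_bound[of lborel ?d]) (use t in \<open>auto simp: norm_mult\<close>)
  then have "(LINT z|lborel. exp (- (\<i> * of_real (\<xi> \<bullet> z))) * of_real (heat_kernel t z)) =
      (\<Prod>i\<in>UNIV. LINT x|lborel. exp (- (\<i> * of_real (\<xi> $ i * x))) * of_real (?d x))"
    unfolding e by (rule integral_prod_cart)
  also have "\<dots> = (\<Prod>i\<in>UNIV. of_real (exp (- t * (\<xi> $ i)\<^sup>2)))"
    using t by (subst fourier_normal_density) auto
  also have "\<dots> = of_real (exp (- t * (norm \<xi>)\<^sup>2))"
    by (simp add: exp_sum[symmetric] norm_vec_def L2_set_def sum_nonneg sum_distrib_left sum_negf flip: of_real_prod)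
  finally show ?thesis .
qed

section \<open>Convolution with the heat kernel\<close>

text \<open>The translation is put on \<phi> instead of the kernel, so that derivatives fall on
  \<phi> and the measure stays fixed.\<close>

definition heat_conv :: "real \<Rightarrow> (real^'n::finite \<Rightarrow> complex) \<Rightarrow> real^'n \<Rightarrow> complex" where
  "heat_conv t \<phi> x = (LINT z|lborel. of_real (heat_kernel t z) * \<phi> (x - z))"

lemma
  fixes f :: "real^'n::finite \<Rightarrow> complex"
  assumes "f \<in> borel_measurable borel"
  shows lborel_integral_reflect: "(LINT z|lborel. f (x - z)) = (LINT z|lborel. f z)"
    and lborel_integral_translate: "(LINT z|lborel. f (x + z)) = (LINT z|lborel. f z)"
    and lborel_integrable_translate: "integrable lborel (\<lambda>z. f (x + z)) \<longleftrightarrow> integrable lborel f"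
proof -
  have l: "lborel = distr lborel borel (\<lambda>z::real^'n. x - z)"
    using lborel_affine[of "-1" x] by (simp add: density_1)
  have l2: "lborel = distr lborel borel (\<lambda>z::real^'n. x + z)"
    using lborel_affine[of "1" x] by (simp add: density_1)
  show "(LINT z|lborel. f (x - z)) = (LINT z|lborel. f z)"
    by (subst (2) l) (use assms in \<open>simp add: integral_distr\<close>)
  show "(LINT z|lborel. f (x + z)) = (LINT z|lborel. f z)"
    by (subst (2) l2) (use assms in \<open>simp add: integral_distr\<close>)
  show "integrable lborel (\<lambda>z. f (x + z)) \<longleftrightarrow> integrable lborel f"
    by (subst (2) l2) (use assms in \<open>simp add: integrable_distr_eq\<close>)
qed

lemma heat_apply:
  assumes "t > 0" "schwartz \<phi>"
  shows "heat t f \<phi> = f (heat_conv t \<phi>)"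
proof -
  note [measurable] = schwartz_borel[OF assms(2)]
  have "(LINT y|lebesgue. of_real (heat_kernel t (x - y)) * \<phi> y) = heat_conv t \<phi> x" for x
  proof -
    have "(LINT y|lebesgue. of_real (heat_kernel t (x - y)) * \<phi> y) = (LINT y|lborel. of_real (heat_kernel t (x - y)) * \<phi> y)"
      by (rule integral_completion) measurable
    also have "\<dots> = heat_conv t \<phi> x"
      using lborel_integral_reflect[of "\<lambda>y. of_real (heat_kernel t (x - y)) * \<phi> y" x]
      by (simp add: heat_conv_def)
    finally show ?thesis .
  qed
  with assms show ?thesis by (simp add: heat_def)
qed

lemma heat_conv_integrand_integrable:
  assumes "t > 0" "\<phi> \<in> borel_measurable borel" "\<And>x. cmod (\<phi> x) \<le> B"
  shows "integrable lborel (\<lambda>z::real^'n::finite. complex_of_real (heat_kernel t z) * \<phi> (x - z))"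
proof (rule Bochner_Integration.integrable_bound)
  show "integrable lborel (\<lambda>z::real^'n. B * heat_kernel t z)"
    by (intro integrable_mult_right heat_kernel_integrable assms)
  note [measurable] = assms(2)
  show "(\<lambda>z::real^'n. complex_of_real (heat_kernel t z) * \<phi> (x - z)) \<in> borel_measurable lborel" by measurable
  show "AE z::real^'n in lborel. norm (complex_of_real (heat_kernel t z) * \<phi> (x - z)) \<le> norm (B * heat_kernel t z)"
  proof (rule AE_I2)
    fix z :: "real^'n"
    have "\<bar>heat_kernel t z\<bar> * cmod (\<phi> (x - z)) \<le> \<bar>heat_kernel t z\<bar> * \<bar>B\<bar>"
      using assms(3)[of "x - z"] by (intro mult_left_mono) auto
    then show "norm (complex_of_real (heat_kernel t z) * \<phi> (x - z)) \<le> norm (B * heat_kernel t z)"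
      by (simp add: norm_mult abs_mult mult.commute)
  qed
qed

text \<open>Uses 1 + |x| \<le> (1 + |z|)(1 + |x - z|): the weight splits between kernel and
  function, at the price of a Gaussian moment that does not depend on \<phi>.\<close>

lemma heat_conv_decay:
  fixes \<phi> :: "real^'n::finite \<Rightarrow> complex"
  assumes t: "t > 0" and \<phi>: "\<phi> \<in> borel_measurable borel"
    and b: "\<And>x. (1 + norm x) ^ N * cmod (\<phi> x) \<le> B"
  shows "(1 + norm x) ^ N * cmod (heat_conv t \<phi> x) \<le> B * (LINT z|lborel. (1 + norm z) ^ N * heat_kernel t (z::real^'n::finite))"
proof -
  note [measurable] = \<phi>
  have "(1 + norm x) ^ N * cmod (heat_conv t \<phi> x) = cmod (LINT z|lborel. of_real ((1 + norm x) ^ N) * (of_real (heat_kernel t z) * \<phi> (x - z)))"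
    by (simp add: heat_conv_def norm_mult norm_power del: of_real_power)
  also have "\<dots> \<le> (LINT z|lborel. B * ((1 + norm z) ^ N * heat_kernel t (z::real^'n)))"
  proof (rule Bochner_Integration.integral_norm_bound_integral)
    show "integrable lborel (\<lambda>z::real^'n. B * ((1 + norm z) ^ N * heat_kernel t z))"
      by (intro integrable_mult_right heat_kernel_weighted_integrable t)
    have B: "cmod (\<phi> y) \<le> B" for y
    proof -
      have "1 * cmod (\<phi> y) \<le> (1 + norm y) ^ N * cmod (\<phi> y)" by (intro mult_right_mono one_le_power) auto
      with b[of y] show ?thesis by simp
    qed
    show "integrable lborel (\<lambda>z. of_real ((1 + norm x) ^ N) * (of_real (heat_kernel t z) * \<phi> (x - z)))"
      by (intro integrable_mult_right heat_conv_integrand_integrable[OF t \<phi> B])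
    fix z :: "real^'n"
    have "1 + norm x \<le> (1 + norm z) * (1 + norm (x - z))"
    proof -
      have "norm x \<le> norm z + norm (x - z)" using norm_triangle_ineq[of z "x - z"] by simp
      moreover have "0 \<le> norm z * norm (x - z)" by simp
      ultimately show ?thesis by (simp only: distrib_left distrib_right)
    qed
    then have "(1 + norm x) ^ N \<le> (1 + norm z) ^ N * (1 + norm (x - z)) ^ N"
      unfolding power_mult_distrib[symmetric] by (intro power_mono) auto
    then have "(1 + norm x) ^ N * (heat_kernel t z * cmod (\<phi> (x - z))) \<le>
        ((1 + norm z) ^ N * (1 + norm (x - z)) ^ N) * (heat_kernel t z * cmod (\<phi> (x - z)))"
      using heat_kernel_nonneg[OF t, of z] by (intro mult_right_mono) auto
    also have "\<dots> = ((1 + norm z) ^ N * heat_kernel t z) * ((1 + norm (x - z)) ^ N * cmod (\<phi> (x - z)))" by simp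
    also have "\<dots> \<le> ((1 + norm z) ^ N * heat_kernel t z) * B"
      using heat_kernel_nonneg[OF t, of z] b by (intro mult_left_mono) auto
    finally show "cmod (of_real ((1 + norm x) ^ N) * (of_real (heat_kernel t z) * \<phi> (x - z))) \<le> B * ((1 + norm z) ^ N * heat_kernel t z)"
      using heat_kernel_nonneg[OF t, of z] by (simp add: norm_mult mult_ac del: of_real_power of_real_add)
  qed
  finally show ?thesis by simp
qed

lemma smooth_lipschitz:
  fixes \<psi> :: "real^'n::finite \<Rightarrow> complex"
  assumes "smooth \<psi>" "\<And>j x. cmod (partial_deriv j \<psi> x) \<le> B"
  shows "cmod (\<psi> x - \<psi> y) \<le> (real CARD('n) * B) * norm (x - y)"
proof -
  have "\<exists>D. \<forall>x. (\<psi> has_derivative D x) (at x)"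
    using smooth_differentiable[OF assms(1)] unfolding differentiable_def by metis
  then obtain D where D: "\<And>x. (\<psi> has_derivative D x) (at x)" by blast
  have B: "onorm (D x) \<le> real CARD('n) * B" for x
  proof (rule onorm_le)
    fix h :: "real^'n"
    have "cmod (D x h) \<le> (\<Sum>i\<in>UNIV. cmod ((h $ i) *\<^sub>R partial_deriv i \<psi> x))"
      unfolding frechet_derivative_partial[OF D] by (rule norm_sum)
    also have "\<dots> \<le> (\<Sum>i\<in>(UNIV::'n set). norm h * B)"
      unfolding norm_scaleR by (intro sum_mono mult_mono assms) (auto simp: component_le_norm_cart)
    finally show "cmod (D x h) \<le> real CARD('n) * B * norm h" by (simp add: mult_ac)
  qed
  show ?thesis
    using differentiable_bound[of UNIV \<psi> D "real CARD('n) * B" x y] D B by simp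
qed

text \<open>The derivative is Lipschitz with constant n (n B), one factor n for each sum over
  coordinates. What matters is that the bound is uniform in the base point \<open>y\<close>.\<close>

lemma smooth_taylor:
  fixes \<phi> :: "real^'n::finite \<Rightarrow> complex"
  assumes sm: "smooth \<phi>" and B: "\<And>i j x. cmod (partial_deriv j (partial_deriv i \<phi>) x) \<le> B"
  shows "cmod (\<phi> (y + h) - \<phi> y - (\<Sum>i\<in>UNIV. (h $ i) *\<^sub>R partial_deriv i \<phi> y)) \<le> (real CARD('n) * (real CARD('n) * B)) * (norm h)\<^sup>2"
proof -
  have "\<exists>D. \<forall>x. (\<phi> has_derivative D x) (at x)"
    using smooth_differentiable[OF sm] unfolding differentiable_def by metis
  then obtain D where D: "\<And>x. (\<phi> has_derivative D x) (at x)" by blast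
  have B0: "0 \<le> B" using order_trans[OF norm_ge_zero B] .
  have lip: "cmod (partial_deriv i \<phi> x - partial_deriv i \<phi> z) \<le> (real CARD('n) * B) * norm (x - z)" for i x z
    by (rule smooth_lipschitz[OF smooth_partial_deriv[OF sm] B])
  have "norm (\<phi> (y + h) - \<phi> y - D y (y + h - y)) \<le> norm (y + h - y) * (real CARD('n) * (real CARD('n) * B * norm h))"
  proof (rule differentiable_bound_linearization)
    show "\<And>t. t \<in> {0..1} \<Longrightarrow> y + t *\<^sub>R (y + h - y) \<in> cball y (norm h)"
      by (auto simp: dist_norm intro: mult_left_le_one_le)
    show "(\<phi> has_derivative D x) (at x within cball y (norm h))" for x
      using D has_derivative_at_withinI by blast
    fix x assume x: "x \<in> cball y (norm h)"
    then have x': "norm (x - y) \<le> norm h" by (simp add: dist_norm norm_minus_commute)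
    show "onorm (D x - D y) \<le> real CARD('n) * (real CARD('n) * B * norm h)"
      unfolding fun_diff_def
    proof (rule onorm_le)
      fix k :: "real^'n"
      have "D x k - D y k = (\<Sum>i\<in>UNIV. (k $ i) *\<^sub>R (partial_deriv i \<phi> x - partial_deriv i \<phi> y))"
        unfolding frechet_derivative_partial[OF D] by (simp add: scaleR_diff_right sum_subtractf)
      also have "cmod \<dots> \<le> (\<Sum>i\<in>UNIV. cmod ((k $ i) *\<^sub>R (partial_deriv i \<phi> x - partial_deriv i \<phi> y)))"
        by (rule norm_sum)
      also have "\<dots> \<le> (\<Sum>i\<in>(UNIV::'n set). norm k * (real CARD('n) * B * norm h))"
        unfolding norm_scaleR
        by (intro sum_mono mult_mono order_trans[OF lip] mult_left_mono x') (auto simp: component_le_norm_cart B0)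
      finally show "cmod (D x k - D y k) \<le> real CARD('n) * (real CARD('n) * B * norm h) * norm k"
        by (simp add: mult_ac)
    qed
  qed simp
  then show ?thesis
    unfolding frechet_derivative_partial[OF D] by (simp add: power2_eq_square mult_ac)
qed

text \<open>The Taylor remainder of \<phi> is quadratic uniformly in the base point. Integrating it
  against a nonnegative kernel of mass 1 keeps the same bound.\<close>

lemma heat_conv_has_derivative:
  fixes \<phi> :: "real^'n::finite \<Rightarrow> complex"
  assumes t: "t > 0" and \<phi>: "schwartz \<phi>"
  shows "(heat_conv t \<phi> has_derivative (\<lambda>h. \<Sum>i\<in>UNIV. (h $ i) *\<^sub>R heat_conv t (partial_deriv i \<phi>) x)) (at x)"
proof -
  have int: "integrable lborel (\<lambda>z. complex_of_real (heat_kernel t z) * \<psi> (x - z))" if \<psi>: "schwartz \<psi>" for \<psi> x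
  proof -
    obtain C where "\<And>x. cmod (\<psi> x) \<le> C" using schwartz_bounded[OF \<psi>] by blast
    then show ?thesis by (rule heat_conv_integrand_integrable[OF t schwartz_borel[OF \<psi>]])
  qed
  have "\<forall>i j. \<exists>C. \<forall>x. cmod (partial_deriv j (partial_deriv i \<phi>) x) \<le> C"
    using schwartz_bounded[OF schwartz_partial_deriv[OF schwartz_partial_deriv[OF \<phi>]]] by metis
  then obtain C where C: "\<And>i j x. cmod (partial_deriv j (partial_deriv i \<phi>) x) \<le> C i j" by metis
  define B where "B = (\<Sum>i\<in>UNIV. \<Sum>j\<in>UNIV. \<bar>C i j\<bar>)"
  have B: "cmod (partial_deriv j (partial_deriv i \<phi>) x) \<le> B" for i j x
  proof -
    have "C i j \<le> (\<Sum>j\<in>UNIV. \<bar>C i j\<bar>)"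
      using member_le_sum[of j UNIV "\<lambda>j. \<bar>C i j\<bar>"] by simp
    also have "\<dots> \<le> B" unfolding B_def
      using member_le_sum[of i UNIV "\<lambda>i. \<Sum>j\<in>UNIV. \<bar>C i j\<bar>"] by (simp add: sum_nonneg)
    finally show ?thesis using C order_trans by blast
  qed
  define M where "M = real CARD('n) * (real CARD('n) * B)"
  let ?L = "\<lambda>h. \<Sum>i\<in>UNIV. (h $ i) *\<^sub>R heat_conv t (partial_deriv i \<phi>) x"
  have bound: "cmod (heat_conv t \<phi> y - heat_conv t \<phi> x - ?L (y - x)) \<le> M * (norm (y - x))\<^sup>2" for y
  proof -
    let ?g = "\<lambda>z. complex_of_real (heat_kernel t z) * (\<phi> (y - z) - \<phi> (x - z) - (\<Sum>i\<in>UNIV. ((y - x) $ i) *\<^sub>R partial_deriv i \<phi> (x - z)))"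
    have gi: "?g z = complex_of_real (heat_kernel t z) * \<phi> (y - z) - complex_of_real (heat_kernel t z) * \<phi> (x - z)
        - (\<Sum>i\<in>UNIV. ((y - x) $ i) *\<^sub>R (complex_of_real (heat_kernel t z) * partial_deriv i \<phi> (x - z)))" for z
      by (simp add: algebra_simps sum_distrib_left)
    have i1: "integrable lborel (\<lambda>z. \<Sum>i\<in>UNIV. ((y - x) $ i) *\<^sub>R (complex_of_real (heat_kernel t z) * partial_deriv i \<phi> (x - z)))"
      by (intro Bochner_Integration.integrable_sum integrable_scaleR_right int schwartz_partial_deriv \<phi>)
    have gint: "integrable lborel ?g" unfolding gi
      by (intro Bochner_Integration.integrable_diff i1 int \<phi>)
    have "heat_conv t \<phi> y - heat_conv t \<phi> x - ?L (y - x) = (LINT z|lborel. ?g z)"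
    proof -
      have "?L (y - x) = (LINT z|lborel. (\<Sum>i\<in>UNIV. ((y - x) $ i) *\<^sub>R (complex_of_real (heat_kernel t z) * partial_deriv i \<phi> (x - z))))"
        unfolding heat_conv_def
        by (subst Bochner_Integration.integral_sum)
           (intro integrable_scaleR_right int schwartz_partial_deriv \<phi>, simp only: integral_scaleR_right)
      moreover have "heat_conv t \<phi> y - heat_conv t \<phi> x =
          (LINT z|lborel. complex_of_real (heat_kernel t z) * \<phi> (y - z) - complex_of_real (heat_kernel t z) * \<phi> (x - z))"
        unfolding heat_conv_def by (intro Bochner_Integration.integral_diff[symmetric] int \<phi>)
      ultimately show ?thesis unfolding gi
        using Bochner_Integration.integral_diff[OF Bochner_Integration.integrable_diff[OF int[OF \<phi>, of y] int[OF \<phi>, of x]] i1]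
        by simp
    qed
    also have "cmod \<dots> \<le> (LINT z|lborel. (M * (norm (y - x))\<^sup>2) * heat_kernel t (z::real^'n))"
    proof (rule Bochner_Integration.integral_norm_bound_integral[OF gint])
      show "integrable lborel (\<lambda>z. (M * (norm (y - x))\<^sup>2) * heat_kernel t (z::real^'n))"
        by (intro integrable_mult_right heat_kernel_integrable t)
      fix z :: "real^'n"
      have "cmod (\<phi> (y - z) - \<phi> (x - z) - (\<Sum>i\<in>UNIV. ((y - x) $ i) *\<^sub>R partial_deriv i \<phi> (x - z))) \<le> M * (norm (y - x))\<^sup>2"
        using smooth_taylor[OF schwartz_smooth[OF \<phi>] B, of "x - z" "y - x"] by (simp add: M_def)
      then have "heat_kernel t z * cmod (\<phi> (y - z) - \<phi> (x - z) - (\<Sum>i\<in>UNIV. ((y - x) $ i) *\<^sub>R partial_deriv i \<phi> (x - z)))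
          \<le> heat_kernel t z * (M * (norm (y - x))\<^sup>2)"
        by (intro mult_left_mono heat_kernel_nonneg t)
      then show "cmod (?g z) \<le> (M * (norm (y - x))\<^sup>2) * heat_kernel t z"
        using heat_kernel_nonneg[OF t, of z] by (simp only: norm_mult norm_of_real abs_of_nonneg mult.commute)
    qed
    also have "\<dots> = M * (norm (y - x))\<^sup>2" using heat_kernel_integral[OF t, where 'n = 'n] by simp
    finally show ?thesis .
  qed
  show ?thesis
  proof (rule has_derivativeI_sandwich[of 1])
    show "bounded_linear ?L"
      by (intro bounded_linear_sum bounded_linear_compose[OF bounded_linear_scaleR_left bounded_linear_vec_nth])
    show "norm (heat_conv t \<phi> y - heat_conv t \<phi> x - ?L (y - x)) / norm (y - x) \<le> M * norm (y - x)" if "y \<noteq> x" for y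
      using bound[of y] that by (simp add: field_simps power2_eq_square)
    show "((\<lambda>y. M * norm (y - x)) \<longlongrightarrow> 0) (at x)"
      by (auto intro!: tendsto_eq_intros)
  qed simp
qed

text \<open>Iterating the derivative formula: derivatives pass through the convolution, so
  smoothness and all Schwartz bounds follow from those of \<phi>.\<close>

lemma
  fixes \<phi> :: "real^'n::finite \<Rightarrow> complex"
  assumes t: "t > 0" and \<phi>: "schwartz \<phi>"
  shows partial_derivs_heat_conv: "partial_derivs is (heat_conv t \<phi>) = heat_conv t (partial_derivs is \<phi>)"
    and smooth_heat_conv: "smooth (heat_conv t \<phi>)"
proof -
  have pd: "partial_deriv i (heat_conv t \<psi>) = heat_conv t (partial_deriv i \<psi>)" if "schwartz \<psi>"
    for i and \<psi> :: "real^'n \<Rightarrow> complex"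
    using partial_deriv_has_derivative[OF heat_conv_has_derivative[OF t that]]
    by (auto simp: axis_def if_distrib[of "\<lambda>c. c *\<^sub>R _"] cong: if_cong)
  show *: "partial_derivs is (heat_conv t \<phi>) = heat_conv t (partial_derivs is \<phi>)" for "is"
    by (induction "is") (simp_all add: pd schwartz_partial_derivs \<phi>)
  show "smooth (heat_conv t \<phi>)"
    unfolding smooth_def * differentiable_def
    using heat_conv_has_derivative[OF t schwartz_partial_derivs[OF \<phi>]] by blast
qed

lemma
  fixes \<phi> :: "real^'n::finite \<Rightarrow> complex"
  assumes t: "t > 0" and \<phi>: "schwartz \<phi>"
  shows schwartz_heat_conv: "schwartz (heat_conv t \<phi>)"
    and schwartz_seminorm_heat_conv: "schwartz_seminorm N (heat_conv t \<phi>) \<le>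
      schwartz_seminorm N \<phi> * (LINT z|lborel. (1 + norm z) ^ N * heat_kernel t (z::real^'n))"
proof -
  have "\<exists>C. \<forall>x. (1 + norm x) ^ N * cmod (partial_derivs is (heat_conv t \<phi>) x) \<le> C" for "is" N
  proof -
    obtain C where "\<And>x. (1 + norm x) ^ N * cmod (partial_derivs is \<phi> x) \<le> C"
      using schwartz_decay[OF \<phi>] by blast
    from heat_conv_decay[OF t schwartz_borel[OF schwartz_partial_derivs[OF \<phi>]] this]
    show ?thesis unfolding partial_derivs_heat_conv[OF t \<phi>] by blast
  qed
  then show "schwartz (heat_conv t \<phi>)" by (simp add: schwartz_iff smooth_heat_conv[OF t \<phi>])
  show "schwartz_seminorm N (heat_conv t \<phi>) \<le>
      schwartz_seminorm N \<phi> * (LINT z|lborel. (1 + norm z) ^ N * heat_kernel t (z::real^'n))"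
    unfolding partial_derivs_heat_conv[OF t \<phi>]
    by (rule schwartz_seminorm_le, unfold partial_derivs_heat_conv[OF t \<phi>])
       (intro heat_conv_decay t schwartz_borel schwartz_partial_derivs \<phi> schwartz_seminorm_ge)
qed

lemma heat_conv_add:
  fixes \<phi> \<psi> :: "real^'n::finite \<Rightarrow> complex"
  assumes "t > 0" "schwartz \<phi>" "schwartz \<psi>"
  shows "heat_conv t (\<lambda>x. \<phi> x + \<psi> x) = (\<lambda>x. heat_conv t \<phi> x + heat_conv t \<psi> x)"
proof
  fix x :: "real^'n"
  have int: "integrable lborel (\<lambda>z. complex_of_real (heat_kernel t z) * \<psi> (x - z))" if "schwartz \<psi>" for \<psi> :: "real^'n \<Rightarrow> complex"
    using schwartz_bounded[OF that] heat_conv_integrand_integrable[OF assms(1) schwartz_borel[OF that]] by metis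
  show "heat_conv t (\<lambda>x. \<phi> x + \<psi> x) x = heat_conv t \<phi> x + heat_conv t \<psi> x"
    using Bochner_Integration.integral_add[OF int[OF assms(2)] int[OF assms(3)]] by (simp add: heat_conv_def distrib_left)
qed

lemma heat_conv_cmult: "heat_conv t (\<lambda>x. c * \<phi> x) = (\<lambda>x. c * heat_conv t \<phi> x)"
  by (simp add: heat_conv_def fun_eq_iff mult.left_commute)

lemma tempered_heat:
  fixes f :: "'n::finite dist"
  assumes t: "t > 0" and f: "tempered f"
  shows "tempered (heat t f)"
proof -
  obtain C N where C: "C \<ge> 0" "\<And>\<phi>. schwartz \<phi> \<Longrightarrow> cmod (f \<phi>) \<le> C * schwartz_seminorm N \<phi>"
    using tempered_bound[OF f] by blast
  define M where "M = (LINT z|lborel. (1 + norm z) ^ N * heat_kernel t (z::real^'n))"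
  have "cmod (heat t f \<phi>) \<le> (C * M) * schwartz_seminorm N \<phi>" if "schwartz \<phi>" for \<phi>
  proof -
    have "cmod (heat t f \<phi>) \<le> C * schwartz_seminorm N (heat_conv t \<phi>)"
      unfolding heat_apply[OF t that] by (intro C schwartz_heat_conv t that)
    also have "\<dots> \<le> C * (schwartz_seminorm N \<phi> * M)"
      unfolding M_def by (intro mult_left_mono C schwartz_seminorm_heat_conv t that)
    finally show ?thesis by (simp add: mult_ac)
  qed
  then have "\<exists>C N. \<forall>\<phi>. schwartz \<phi> \<longrightarrow> cmod (heat t f \<phi>) \<le> C * schwartz_seminorm N \<phi>" by blast
  moreover have "\<not> schwartz \<phi> \<Longrightarrow> heat t f \<phi> = 0" for \<phi> using t by (simp add: heat_def)
  moreover have "heat t f (\<lambda>x. \<phi> x + \<psi> x) = heat t f \<phi> + heat t f \<psi>" if "schwartz \<phi>" "schwartz \<psi>" for \<phi> \<psi>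
    using that t by (simp add: heat_apply schwartz_add heat_conv_add tempered_add_arg[OF f] schwartz_heat_conv)
  moreover have "heat t f (\<lambda>x. c * \<phi> x) = c * heat t f \<phi>" if "schwartz \<phi>" for c \<phi>
    using that t by (simp add: heat_apply schwartz_cmult heat_conv_cmult tempered_cmult_arg[OF f] schwartz_heat_conv)
  ultimately show ?thesis unfolding tempered_def by blast
qed

text \<open>Fubini and translation invariance, with the character split as a product. It will
  identify a Gaussian factor of a symbol with the action of the heat semigroup on the test
  function.\<close>

lemma fourier_heat_conv:
  fixes \<phi> :: "real^'n::finite \<Rightarrow> complex"
  assumes t: "t > 0" and \<phi>: "schwartz \<phi>"
  shows "fourier (heat_conv t \<phi>) \<xi> = of_real (exp (- t * (norm \<xi>)\<^sup>2)) * fourier \<phi> \<xi>"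
proof -
  note [measurable] = schwartz_borel[OF \<phi>] schwartz_borel[OF schwartz_heat_conv[OF t \<phi>]]
  let ?e = "\<lambda>x. exp (- (\<i> * of_real (\<xi> \<bullet> x))) :: complex"
  have e1: "cmod (?e x) = 1" for x by simp
  have e2: "?e (x + y) = ?e x * ?e y" for x y by (simp add: inner_add_right distrib_left flip: exp_add)
  let ?G = "\<lambda>z x. ?e x * (of_real (heat_kernel t z) * \<phi> (x - z))"
  have tr: "(LINT x|lborel. g (x - z)) = (LINT x|lborel. g x)" "integrable lborel (\<lambda>x. g (x - z)) \<longleftrightarrow> integrable lborel g"
    if "g \<in> borel_measurable borel" for g :: "real^'n \<Rightarrow> complex" and z
    using lborel_integral_translate[OF that, of "- z"] lborel_integrable_translate[OF that, of "- z"] by simp_all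
  have "integrable lborel \<phi>" by (rule schwartz_integrable[OF \<phi>])
  then have i0: "integrable lborel (\<lambda>x. complex_of_real (cmod (\<phi> x)))" by simp
  have int: "integrable lborel (\<lambda>x. \<phi> (x - z))" for z using schwartz_integrable[OF \<phi>] by (simp add: tr)
  have nrm: "(LINT x|lborel. cmod (?G z x)) = heat_kernel t z * (LINT x|lborel. cmod (\<phi> x))" for z
  proof -
    have "complex_of_real (LINT x|lborel. cmod (\<phi> (x - z))) = complex_of_real (LINT x|lborel. cmod (\<phi> x))"
      using tr(1)[of "\<lambda>x. complex_of_real (cmod (\<phi> x))" z] by simp
    then have "(LINT x|lborel. cmod (\<phi> (x - z))) = (LINT x|lborel. cmod (\<phi> x))" using of_real_eq_iff by blast
    then show ?thesis using heat_kernel_nonneg[OF t, of z] by (simp add: norm_mult)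
  qed
  have sl: "integrable lborel (?G z)" for z
  proof (rule Bochner_Integration.integrable_bound[of lborel "\<lambda>x. of_real (heat_kernel t z) * \<phi> (x - z)"])
    show "integrable lborel (\<lambda>x. complex_of_real (heat_kernel t z) * \<phi> (x - z))" using int by simp
  qed (auto simp: norm_mult)
  have "integrable (lborel \<Otimes>\<^sub>M lborel) (case_prod ?G)"
  proof (rule lborel_pair.Fubini_integrable)
    show "integrable lborel (\<lambda>z. LINT x|lborel. norm (case (z, x) of (z, x) \<Rightarrow> ?G z x))"
      unfolding case_prod_conv nrm by (intro integrable_mult_left heat_kernel_integrable t)
  qed (use sl in auto)
  from lborel_pair.Fubini_integral[OF this]
  have F: "(LINT x|lborel. (LINT z|lborel. ?G z x)) = (LINT z|lborel. (LINT x|lborel. ?G z x))" .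
  have f\<phi>: "fourier \<phi> \<xi> = (LINT x|lborel. ?e x * \<phi> x)"
    unfolding fourier_def by (rule integral_completion) measurable
  have "fourier (heat_conv t \<phi>) \<xi> = (LINT x|lborel. ?e x * heat_conv t \<phi> x)"
    unfolding fourier_def by (rule integral_completion) measurable
  also have "\<dots> = (LINT x|lborel. (LINT z|lborel. ?G z x))" by (simp add: heat_conv_def)
  also have "\<dots> = (LINT z|lborel. (?e z * of_real (heat_kernel t z)) * fourier \<phi> \<xi>)"
    unfolding F
  proof (intro Bochner_Integration.integral_cong refl)
    fix z :: "real^'n"
    have "?G z x = (?e z * of_real (heat_kernel t z)) * (?e (x - z) * \<phi> (x - z))" for x
      using e2[of z "x - z"] by simp
    then have "(LINT x|lborel. ?G z x) = (?e z * of_real (heat_kernel t z)) * (LINT x|lborel. ?e (x - z) * \<phi> (x - z))"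
      by (simp only: integral_mult_right_zero)
    also have "(LINT x|lborel. ?e (x - z) * \<phi> (x - z)) = fourier \<phi> \<xi>"
      unfolding f\<phi> by (rule tr(1)[of "\<lambda>x. ?e x * \<phi> x"]) measurable
    finally show "(LINT x|lborel. ?G z x) = (?e z * of_real (heat_kernel t z)) * fourier \<phi> \<xi>" .
  qed
  also have "\<dots> = of_real (exp (- t * (norm \<xi>)\<^sup>2)) * fourier \<phi> \<xi>"
    using fourier_heat_kernel[OF t, of \<xi>] by (simp only: integral_mult_left_zero)
  finally show ?thesis .
qed

section \<open>Duals of spaces in which the Schwartz functions are dense\<close>

lemma dist_of_schwartz_add:
  assumes "schwartz \<phi>" "schwartz \<psi>"
  shows "dist_of_schwartz (\<lambda>x. \<phi> x + \<psi> x) = dist_add (dist_of_schwartz \<phi>) (dist_of_schwartz \<psi>)"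
  using Bochner_Integration.integral_add[OF schwartz_integrable_prod[OF _ assms(1)] schwartz_integrable_prod[OF _ assms(2)]]
  by (auto simp: dist_of_schwartz_def dist_add_def fun_eq_iff distrib_right)

lemma dist_of_schwartz_cmult:
  "dist_of_schwartz (\<lambda>x. c * \<phi> x) = dist_scale c (dist_of_schwartz \<phi>)"
  by (auto simp: dist_of_schwartz_def dist_scale_def fun_eq_iff mult.assoc)

lemma dist_of_schwartz_diff:
  assumes "schwartz \<phi>" "schwartz \<psi>"
  shows "dist_of_schwartz (\<lambda>x. \<phi> x - \<psi> x) = dist_diff (dist_of_schwartz \<phi>) (dist_of_schwartz \<psi>)"
  using dist_of_schwartz_add[OF assms(1) schwartz_cmult[OF assms(2), of "-1"]] dist_of_schwartz_cmult[of "-1" \<psi>]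
  by (simp add: dist_diff_eq)

lemma dist_of_schwartz_zero: "dist_of_schwartz (\<lambda>x. 0) = dist_zero"
  by (auto simp: dist_of_schwartz_def dist_zero_def)

lemma dist_diff_self: "dist_diff f f = dist_zero"
  by (simp add: dist_diff_def dist_zero_def)

lemma dist_diff_zero: "dist_diff f dist_zero = f"
  by (simp add: dist_diff_def dist_zero_def)

locale dense_space =
  fixes F :: "('n::finite) dist_space"
  assumes banach: "banach_dist_space F" and dense: "schwartz_dense F"
begin

lemma points_zero: "dist_zero \<in> points F"
  and points_add: "f \<in> points F \<Longrightarrow> g \<in> points F \<Longrightarrow> dist_add f g \<in> points F"
  and nrm_add: "f \<in> points F \<Longrightarrow> g \<in> points F \<Longrightarrow> nrm F (dist_add f g) \<le> nrm F f + nrm F g"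
  and points_scale: "f \<in> points F \<Longrightarrow> dist_scale c f \<in> points F"
  and nrm_scale: "f \<in> points F \<Longrightarrow> nrm F (dist_scale c f) = cmod c * nrm F f"
  and nrm_nonneg: "f \<in> points F \<Longrightarrow> 0 \<le> nrm F f"
  using banach unfolding banach_dist_space_def by blast+

lemma points_diff: "f \<in> points F \<Longrightarrow> g \<in> points F \<Longrightarrow> dist_diff f g \<in> points F"
  by (simp add: dist_diff_eq points_add points_scale)

lemma nrm_diff_commute: "f \<in> points F \<Longrightarrow> g \<in> points F \<Longrightarrow> nrm F (dist_diff f g) = nrm F (dist_diff g f)"
  using nrm_scale[OF points_diff, of f g "-1"] by (simp add: dist_scale_def dist_diff_def)

lemma nrm_diff_triangle:
  assumes "f \<in> points F" "g \<in> points F" "h \<in> points F"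
  shows "nrm F (dist_diff f h) \<le> nrm F (dist_diff f g) + nrm F (dist_diff g h)"
  using nrm_add[OF points_diff[OF assms(1,2)] points_diff[OF assms(2,3)]]
  by (simp add: dist_diff_def dist_add_def)

lemma nrm_zero: "nrm F dist_zero = 0"
  using nrm_scale[OF points_zero, of 0] by (simp add: dist_scale_def dist_zero_def)

lemma schwartz_points: "schwartz \<phi> \<Longrightarrow> dist_of_schwartz \<phi> \<in> points F"
  using dense by (simp add: schwartz_dense_def)

lemma schwartz_approx:
  assumes "f \<in> points F" "e > 0"
  obtains \<phi> where "schwartz \<phi>" "nrm F (dist_diff f (dist_of_schwartz \<phi>)) < e"
  using dense assms unfolding schwartz_dense_def by blast

lemma bounded_functional_diff:
  assumes "bounded_functional F L" "f \<in> points F" "g \<in> points F"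
  shows "L (dist_diff f g) = L f - L g"
proof -
  have "L (dist_add f (dist_scale (-1) g)) = L f + L (dist_scale (-1) g)"
    using assms points_scale unfolding bounded_functional_def by blast
  also have "L (dist_scale (-1) g) = (-1) * L g"
    using assms unfolding bounded_functional_def by blast
  finally show ?thesis by (simp add: dist_diff_eq)
qed

lemma bounded_functional_bound:
  assumes "bounded_functional F L"
  obtains C where "C \<ge> 0" "\<And>f. f \<in> points F \<Longrightarrow> cmod (L f) \<le> C * nrm F f"
proof -
  from assms obtain C where C: "\<And>f. f \<in> points F \<Longrightarrow> cmod (L f) \<le> C * nrm F f"
    unfolding bounded_functional_def by blast
  show ?thesis
  proof (rule that[of "\<bar>C\<bar>"])
    fix f assume f: "f \<in> points F"
    have "C * nrm F f \<le> \<bar>C\<bar> * nrm F f" by (intro mult_right_mono nrm_nonneg f) simp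
    with C[OF f] show "cmod (L f) \<le> \<bar>C\<bar> * nrm F f" by simp
  qed simp
qed

text \<open>Two bounded functionals that agree on a dense set agree. It makes the choice in
  \<open>pairing\<close> harmless.\<close>

lemma induces_unique:
  assumes L: "induces F L f" and M: "induces F M f" and e: "e \<in> points F"
  shows "L e = M e"
proof -
  have bL: "bounded_functional F L" and bM: "bounded_functional F M"
    using L M by (auto simp: induces_def)
  obtain C where C: "C \<ge> 0" "\<And>f. f \<in> points F \<Longrightarrow> cmod (L f) \<le> C * nrm F f"
    using bounded_functional_bound[OF bL] by blast
  obtain D where D: "D \<ge> 0" "\<And>f. f \<in> points F \<Longrightarrow> cmod (M f) \<le> D * nrm F f"
    using bounded_functional_bound[OF bM] by blast
  have "cmod (L e - M e) \<le> 0 + \<epsilon>" if "\<epsilon> > 0" for \<epsilon>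
  proof -
    define r where "r = \<epsilon> / (C + D + 1)"
    have r: "r > 0" using that C D by (simp add: r_def)
    obtain \<phi> where \<phi>: "schwartz \<phi>" "nrm F (dist_diff e (dist_of_schwartz \<phi>)) < r"
      using schwartz_approx[OF e r] by blast
    let ?d = "dist_of_schwartz \<phi>"
    have d: "?d \<in> points F" using \<phi> schwartz_points by blast
    have "L ?d = M ?d" using L M \<phi> by (metis induces_def)
    then have "L e - M e = L (dist_diff e ?d) - M (dist_diff e ?d)"
      using bounded_functional_diff[OF bL e d] bounded_functional_diff[OF bM e d] by simp
    also have "cmod \<dots> \<le> C * nrm F (dist_diff e ?d) + D * nrm F (dist_diff e ?d)"
      using C(2)[OF points_diff[OF e d]] D(2)[OF points_diff[OF e d]] norm_triangle_ineq4 by smt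
    also have "\<dots> \<le> (C + D) * r" using \<phi>(2) C D by (simp add: distrib_right add_mono mult_left_mono)
    also have "\<dots> \<le> (C + D + 1) * r" using r by (simp add: mult_right_mono)
    also have "\<dots> = \<epsilon>" using C D by (simp add: r_def)
    finally show ?thesis by simp
  qed
  then have "cmod (L e - M e) \<le> 0" by (rule field_le_epsilon)
  then show ?thesis by simp
qed

lemma dual_points_iff: "f \<in> points (dual F) \<longleftrightarrow> tempered f \<and> (\<exists>L. induces F L f)"
  by (simp add: dual_def)

lemma dual_tempered: "f \<in> points (dual F) \<Longrightarrow> tempered f"
  by (simp add: dual_points_iff)

lemma pairing_induces: "f \<in> points (dual F) \<Longrightarrow> induces F (pairing F f) f"
  unfolding dual_points_iff pairing_def by (metis someI_ex)

lemma pairing_eq: "induces F L f \<Longrightarrow> tempered f \<Longrightarrow> e \<in> points F \<Longrightarrow> pairing F f e = L e"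
  using induces_unique[OF pairing_induces] dual_points_iff by blast

lemma pairing_schwartz: "f \<in> points (dual F) \<Longrightarrow> schwartz \<phi> \<Longrightarrow> pairing F f (dist_of_schwartz \<phi>) = f \<phi>"
  using pairing_induces by (simp add: induces_def)

lemma induces_add:
  assumes "induces F L f" "induces F M g"
  shows "induces F (\<lambda>e. L e + M e) (dist_add f g)"
proof -
  obtain C where C: "\<And>f. f \<in> points F \<Longrightarrow> cmod (L f) \<le> C * nrm F f"
    using bounded_functional_bound assms unfolding induces_def by metis
  obtain D where D: "\<And>f. f \<in> points F \<Longrightarrow> cmod (M f) \<le> D * nrm F f"
    using bounded_functional_bound assms unfolding induces_def by metis
  have "cmod (L e + M e) \<le> (C + D) * nrm F e" if "e \<in> points F" for e
    using C[OF that] D[OF that] norm_triangle_ineq[of "L e" "M e"] by (simp add: distrib_right)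
  then have "\<exists>C. \<forall>e\<in>points F. cmod (L e + M e) \<le> C * nrm F e" by blast
  with assms show ?thesis
    by (simp add: induces_def bounded_functional_def dist_add_def distrib_left)
qed

lemma induces_scale:
  assumes "induces F L f"
  shows "induces F (\<lambda>e. c * L e) (dist_scale c f)"
proof -
  obtain C where C: "\<And>f. f \<in> points F \<Longrightarrow> cmod (L f) \<le> C * nrm F f"
    using bounded_functional_bound assms unfolding induces_def by metis
  have "cmod (c * L e) \<le> (cmod c * C) * nrm F e" if "e \<in> points F" for e
    using mult_left_mono[OF C[OF that], of "cmod c"] by (simp add: norm_mult mult.assoc)
  then have "\<exists>C. \<forall>e\<in>points F. cmod (c * L e) \<le> C * nrm F e" by blast
  with assms show ?thesis
    by (simp add: induces_def bounded_functional_def dist_scale_def distrib_left)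
qed

lemma dual_add:
  assumes "f \<in> points (dual F)" "g \<in> points (dual F)"
  shows "dist_add f g \<in> points (dual F)"
    and "e \<in> points F \<Longrightarrow> pairing F (dist_add f g) e = pairing F f e + pairing F g e"
  using induces_add[OF pairing_induces[OF assms(1)] pairing_induces[OF assms(2)]]
    tempered_dist_add[OF assms[THEN dual_tempered]]
  by (auto simp: dual_points_iff dest: pairing_eq)

lemma dual_scale:
  assumes "f \<in> points (dual F)"
  shows "dist_scale c f \<in> points (dual F)"
    and "e \<in> points F \<Longrightarrow> pairing F (dist_scale c f) e = c * pairing F f e"
  using induces_scale[OF pairing_induces[OF assms]] tempered_dist_scale[OF dual_tempered[OF assms]]
  by (auto simp: dual_points_iff dest: pairing_eq)

lemma dual_diff:
  assumes "f \<in> points (dual F)" "g \<in> points (dual F)"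
  shows "dist_diff f g \<in> points (dual F)"
  by (simp add: dist_diff_eq dual_add dual_scale assms)

lemma dual_zero: "dist_zero \<in> points (dual F)"
proof -
  have "induces F (\<lambda>_. 0) dist_zero"
    by (auto simp: induces_def bounded_functional_def dist_zero_def intro!: exI[of _ 0])
  then show ?thesis using tempered_dist_zero by (auto simp: dual_points_iff)
qed

lemma nrm_dual: "nrm (dual F) f = (SUP e \<in> {e \<in> points F. nrm F e \<le> 1}. cmod (pairing F f e))"
  by (simp add: dual_def)

lemma dual_bdd:
  assumes "f \<in> points (dual F)"
  shows "bdd_above ((\<lambda>e. cmod (pairing F f e)) ` {e \<in> points F. nrm F e \<le> 1})"
proof -
  obtain C where C: "C \<ge> 0" "\<And>e. e \<in> points F \<Longrightarrow> cmod (pairing F f e) \<le> C * nrm F e"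
    using bounded_functional_bound pairing_induces[OF assms] unfolding induces_def by metis
  show ?thesis
  proof (rule bdd_aboveI2[of _ _ C])
    fix e assume e: "e \<in> {e \<in> points F. nrm F e \<le> 1}"
    have "C * nrm F e \<le> C * 1" using e C by (intro mult_left_mono) auto
    then show "cmod (pairing F f e) \<le> C" using C(2)[of e] e by simp
  qed
qed

lemma nrm_dual_nonneg: "f \<in> points (dual F) \<Longrightarrow> 0 \<le> nrm (dual F) f"
  unfolding nrm_dual
  by (rule order_trans[OF norm_ge_zero cSUP_upper[OF _ dual_bdd]])
     (auto simp: points_zero nrm_zero intro!: points_zero)

lemma pairing_bound:
  assumes f: "f \<in> points (dual F)" and e: "e \<in> points F"
  shows "cmod (pairing F f e) \<le> nrm (dual F) f * nrm F e"
proof (cases "nrm F e = 0")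
  \<comment> \<open>Normalising \<open>e\<close> is impossible here; the bound by an unspecified
    constant times \<open>nrm F e\<close> already gives 0.\<close>
  case True
  obtain C where C: "C \<ge> 0" "\<And>e. e \<in> points F \<Longrightarrow> cmod (pairing F f e) \<le> C * nrm F e"
    using bounded_functional_bound pairing_induces[OF f] unfolding induces_def by metis
  from C(2)[OF e] True show ?thesis by simp
next
  case False
  then have p: "nrm F e > 0" using nrm_nonneg[OF e] by simp
  let ?c = "complex_of_real (1 / nrm F e)"
  have s: "dist_scale ?c e \<in> points F" "nrm F (dist_scale ?c e) = 1"
    using p by (simp_all add: points_scale nrm_scale e norm_divide)
  have "cmod (pairing F f (dist_scale ?c e)) \<le> nrm (dual F) f"
    unfolding nrm_dual by (rule cSUP_upper[OF _ dual_bdd[OF f]]) (simp only: s mem_Collect_eq order_refl simp_thms)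
  moreover have "pairing F f (dist_scale ?c e) = ?c * pairing F f e"
    using pairing_induces[OF f] e unfolding induces_def bounded_functional_def by blast
  then have "cmod (pairing F f (dist_scale ?c e)) = cmod (pairing F f e) / nrm F e"
    using p by (simp add: norm_mult norm_divide)
  ultimately show ?thesis using p by (simp add: pos_divide_le_eq)
qed

lemma nrm_dual_le:
  assumes C: "C \<ge> 0" and b: "\<And>e. e \<in> points F \<Longrightarrow> cmod (pairing F f e) \<le> C * nrm F e"
  shows "nrm (dual F) f \<le> C"
  unfolding nrm_dual
proof (rule cSUP_least)
  show "{e \<in> points F. nrm F e \<le> 1} \<noteq> {}" using points_zero nrm_zero by force
  fix e assume e: "e \<in> {e \<in> points F. nrm F e \<le> 1}"
  have "C * nrm F e \<le> C * 1" using e C by (intro mult_left_mono) auto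
  then show "cmod (pairing F f e) \<le> C" using b[of e] e by simp
qed

lemma nrm_dual_add:
  assumes "f \<in> points (dual F)" "g \<in> points (dual F)"
  shows "nrm (dual F) (dist_add f g) \<le> nrm (dual F) f + nrm (dual F) g"
proof (rule nrm_dual_le)
  fix e assume e: "e \<in> points F"
  show "cmod (pairing F (dist_add f g) e) \<le> (nrm (dual F) f + nrm (dual F) g) * nrm F e"
    unfolding dual_add(2)[OF assms e] distrib_right
    by (rule order_trans[OF norm_triangle_ineq add_mono[OF pairing_bound[OF assms(1) e] pairing_bound[OF assms(2) e]]])
qed (simp add: nrm_dual_nonneg assms)

lemma nrm_dual_scale_le:
  assumes "f \<in> points (dual F)"
  shows "nrm (dual F) (dist_scale c f) \<le> cmod c * nrm (dual F) f"
proof (rule nrm_dual_le)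
  fix e assume e: "e \<in> points F"
  show "cmod (pairing F (dist_scale c f) e) \<le> cmod c * nrm (dual F) f * nrm F e"
    unfolding dual_scale(2)[OF assms e] norm_mult mult.assoc
    by (intro mult_left_mono pairing_bound assms e) simp
qed (simp add: nrm_dual_nonneg assms)

lemma nrm_dual_diff:
  assumes "f \<in> points (dual F)" "g \<in> points (dual F)"
  shows "nrm (dual F) (dist_diff f g) \<le> nrm (dual F) f + nrm (dual F) g"
  unfolding dist_diff_eq
  using nrm_dual_add[OF assms(1) dual_scale(1)[OF assms(2)], of "-1"] nrm_dual_scale_le[OF assms(2), of "-1"] by simp

lemma nrm_dual_diff_commute:
  assumes "f \<in> points (dual F)" "g \<in> points (dual F)"
  shows "nrm (dual F) (dist_diff f g) \<le> nrm (dual F) (dist_diff g f)"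
  using nrm_dual_scale_le[OF dual_diff[OF assms(2,1)], of "-1"] by (simp add: dist_diff_def dist_scale_def)

lemma nrm_dual_zero: "nrm (dual F) dist_zero = 0"
  using nrm_dual_scale_le[OF dual_zero, of 0] nrm_dual_nonneg[OF dual_zero]
  by (simp add: dist_scale_def dist_zero_def)

lemma dual_eqI:
  assumes f: "f \<in> points (dual F)" and g: "g \<in> points (dual F)"
    and eq: "\<And>e. e \<in> points F \<Longrightarrow> pairing F f e = pairing F g e"
  shows "f = g"
proof
  fix \<phi>
  show "f \<phi> = g \<phi>"
  proof (cases "schwartz \<phi>")
    case True
    then show ?thesis using eq[OF schwartz_points[OF True]] by (simp add: pairing_schwartz f g)
  next
    case False
    then show ?thesis using tempered_not_schwartz dual_tempered f g by metis
  qed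
qed

lemma nrm_dual_eq_0:
  assumes f: "f \<in> points (dual F)" and z: "nrm (dual F) f \<le> 0"
  shows "f = dist_zero"
proof (rule dual_eqI[OF f dual_zero])
  have n: "nrm (dual F) f = 0" using z nrm_dual_nonneg[OF f] by simp
  fix e assume e: "e \<in> points F"
  show "pairing F f e = pairing F dist_zero e"
    using pairing_bound[OF f e] pairing_bound[OF dual_zero e] n nrm_dual_zero by simp
qed

lemma dual_apply_bound:
  assumes "f \<in> points (dual F)" "schwartz \<phi>"
  shows "cmod (f \<phi>) \<le> nrm (dual F) f * nrm F (dist_of_schwartz \<phi>)"
  using pairing_bound[OF assms(1) schwartz_points[OF assms(2)]] by (simp add: pairing_schwartz assms)

text \<open>Extension by density: a bound on Schwartz functions alone yields membership in the dual.
  It lets a time integral defined by testing against one space be recognised as an element of the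
  dual of another.\<close>

lemma dual_extension:
  assumes f: "tempered f" and C: "C \<ge> 0"
    and b: "\<And>\<phi>. schwartz \<phi> \<Longrightarrow> cmod (f \<phi>) \<le> C * nrm F (dist_of_schwartz \<phi>)"
  shows "f \<in> points (dual F)"
proof -
  have fd: "cmod (f \<phi> - f \<psi>) \<le> C * nrm F (dist_diff (dist_of_schwartz \<phi>) (dist_of_schwartz \<psi>))"
    if "schwartz \<phi>" "schwartz \<psi>" for \<phi> \<psi>
    using b[OF schwartz_diff[OF that]] by (simp add: tempered_diff_arg f that dist_of_schwartz_diff)
  \<comment> \<open>The value at \<open>e\<close> is the limit along Schwartz functions approaching
    \<open>e\<close>. It is recorded by this single inequality, from which boundedness, additivity
    and homogeneity are then read off.\<close>
  have "\<exists>c. \<forall>\<psi>. schwartz \<psi> \<longrightarrow> cmod (c - f \<psi>) \<le> C * nrm F (dist_diff e (dist_of_schwartz \<psi>))"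
    if e: "e \<in> points F" for e
  proof -
    have "\<forall>k::nat. \<exists>\<phi>. schwartz \<phi> \<and> nrm F (dist_diff e (dist_of_schwartz \<phi>)) < inverse (real (Suc k))"
      using schwartz_approx[OF e] by (metis inverse_positive_iff_positive of_nat_0_less_iff zero_less_Suc)
    then obtain \<phi> where \<phi>: "\<And>k. schwartz (\<phi> k)"
        "\<And>k. nrm F (dist_diff e (dist_of_schwartz (\<phi> k))) < inverse (real (Suc k))" by metis
    have lim0: "(\<lambda>k. nrm F (dist_diff e (dist_of_schwartz (\<phi> k)))) \<longlonglongrightarrow> 0"
    proof (rule tendsto_sandwich[OF _ _ tendsto_const LIMSEQ_inverse_real_of_nat]; intro always_eventually allI)
      fix k
      show "0 \<le> nrm F (dist_diff e (dist_of_schwartz (\<phi> k)))" by (intro nrm_nonneg points_diff e schwartz_points \<phi>)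
      show "nrm F (dist_diff e (dist_of_schwartz (\<phi> k))) \<le> inverse (real (Suc k))"
        using \<phi>(2)[of k] by simp
    qed
    have diffb: "cmod (f (\<phi> k) - f \<psi>) \<le> C * (nrm F (dist_diff e (dist_of_schwartz (\<phi> k))) + nrm F (dist_diff e (dist_of_schwartz \<psi>)))"
      if \<psi>: "schwartz \<psi>" for k \<psi>
    proof -
      have "cmod (f (\<phi> k) - f \<psi>) \<le> C * nrm F (dist_diff (dist_of_schwartz (\<phi> k)) (dist_of_schwartz \<psi>))"
        by (rule fd) (use \<phi> \<psi> in auto)
      also have "nrm F (dist_diff (dist_of_schwartz (\<phi> k)) (dist_of_schwartz \<psi>)) \<le>
          nrm F (dist_diff (dist_of_schwartz (\<phi> k)) e) + nrm F (dist_diff e (dist_of_schwartz \<psi>))"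
        by (intro nrm_diff_triangle schwartz_points \<phi> \<psi> e)
      also have "nrm F (dist_diff (dist_of_schwartz (\<phi> k)) e) = nrm F (dist_diff e (dist_of_schwartz (\<phi> k)))"
        by (intro nrm_diff_commute schwartz_points \<phi> e)
      finally show ?thesis using C by (simp add: mult_left_mono)
    qed
    have "Cauchy (\<lambda>k. f (\<phi> k))"
    proof (rule metric_CauchyI)
      fix \<epsilon> :: real assume \<epsilon>: "\<epsilon> > 0"
      have "(\<lambda>k. C * nrm F (dist_diff e (dist_of_schwartz (\<phi> k)))) \<longlonglongrightarrow> C * 0"
        by (intro tendsto_intros lim0)
      then have "eventually (\<lambda>k. C * nrm F (dist_diff e (dist_of_schwartz (\<phi> k))) < \<epsilon> / 2) sequentially"
        using \<epsilon> by (intro order_tendstoD(2)[where y = "C * 0"]) auto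
      then obtain M where M: "\<And>k. k \<ge> M \<Longrightarrow> C * nrm F (dist_diff e (dist_of_schwartz (\<phi> k))) < \<epsilon> / 2"
        by (auto simp: eventually_sequentially)
      show "\<exists>M. \<forall>m\<ge>M. \<forall>n\<ge>M. dist (f (\<phi> m)) (f (\<phi> n)) < \<epsilon>"
      proof (intro exI allI impI)
        fix m n assume "m \<ge> M" "n \<ge> M"
        with M[of m] M[of n] diffb[OF \<phi>(1), of m n] show "dist (f (\<phi> m)) (f (\<phi> n)) < \<epsilon>"
          by (simp add: dist_norm distrib_left)
      qed
    qed
    then obtain c where c: "(\<lambda>k. f (\<phi> k)) \<longlonglongrightarrow> c" using Cauchy_convergent_iff convergent_def by blast
    have "cmod (c - f \<psi>) \<le> C * nrm F (dist_diff e (dist_of_schwartz \<psi>))" if \<psi>: "schwartz \<psi>" for \<psi>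
    proof -
      have "(\<lambda>k. cmod (f (\<phi> k) - f \<psi>)) \<longlonglongrightarrow> cmod (c - f \<psi>)"
        by (intro tendsto_intros c)
      moreover have "(\<lambda>k. C * (nrm F (dist_diff e (dist_of_schwartz (\<phi> k))) + nrm F (dist_diff e (dist_of_schwartz \<psi>))))
          \<longlonglongrightarrow> C * (0 + nrm F (dist_diff e (dist_of_schwartz \<psi>)))"
        by (intro tendsto_intros lim0)
      ultimately show ?thesis
        using LIMSEQ_le[of _ "cmod (c - f \<psi>)"] diffb[OF \<psi>] by fastforce
    qed
    then show ?thesis by blast
  qed
  then have "\<exists>L. \<forall>e\<in>points F. \<forall>\<psi>. schwartz \<psi> \<longrightarrow> cmod (L e - f \<psi>) \<le> C * nrm F (dist_diff e (dist_of_schwartz \<psi>))"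
    by (intro bchoice) blast
  then obtain L where L: "\<And>e \<psi>. e \<in> points F \<Longrightarrow> schwartz \<psi> \<Longrightarrow> cmod (L e - f \<psi>) \<le> C * nrm F (dist_diff e (dist_of_schwartz \<psi>))"
    by blast
  have ext: "c = d" if le: "\<And>\<epsilon>. \<epsilon> > 0 \<Longrightarrow> cmod (c - d) \<le> B * \<epsilon>" and B: "B \<ge> 0" for c d :: complex and B
  proof -
    have "cmod (c - d) \<le> 0 + \<epsilon>" if "\<epsilon> > 0" for \<epsilon>
    proof -
      have "\<epsilon> / (B + 1) > 0" using B \<open>\<epsilon> > 0\<close> by simp
      then have "cmod (c - d) \<le> B * (\<epsilon> / (B + 1))" by (rule le)
      also have "\<dots> \<le> \<epsilon>" using B \<open>\<epsilon> > 0\<close> by (simp add: field_simps)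
      finally show ?thesis by simp
    qed
    then have "cmod (c - d) \<le> 0" by (rule field_le_epsilon)
    then show ?thesis by simp
  qed
  have Lschwartz: "L (dist_of_schwartz \<phi>) = f \<phi>" if "schwartz \<phi>" for \<phi>
    using L[OF schwartz_points[OF that] that] by (simp add: dist_diff_self nrm_zero)
  have f0: "f (\<lambda>x. 0) = 0" using tempered_cmult_arg[OF f schwartz_zero, of 0] by simp
  have Lbound: "cmod (L e) \<le> C * nrm F e" if "e \<in> points F" for e
    using L[OF that schwartz_zero] by (simp add: f0 dist_of_schwartz_zero dist_diff_zero)
  have Ladd: "L (dist_add a b) = L a + L b" if a: "a \<in> points F" and b: "b \<in> points F" for a b
  \<comment> \<open>Approximating both arguments within \<epsilon> costs C (2 \<epsilon>) for the
    sum and C \<epsilon> for each summand.\<close>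
  proof (rule ext[of _ _ "4 * C"])
    fix \<epsilon> :: real assume \<epsilon>: "\<epsilon> > 0"
    obtain \<phi> where \<phi>: "schwartz \<phi>" "nrm F (dist_diff a (dist_of_schwartz \<phi>)) < \<epsilon>"
      using schwartz_approx[OF a \<epsilon>] by blast
    obtain \<psi> where \<psi>: "schwartz \<psi>" "nrm F (dist_diff b (dist_of_schwartz \<psi>)) < \<epsilon>"
      using schwartz_approx[OF b \<epsilon>] by blast
    have "dist_diff (dist_add a b) (dist_of_schwartz (\<lambda>x. \<phi> x + \<psi> x)) =
        dist_add (dist_diff a (dist_of_schwartz \<phi>)) (dist_diff b (dist_of_schwartz \<psi>))"
      by (simp add: dist_of_schwartz_add \<phi> \<psi> dist_diff_def dist_add_def fun_eq_iff)
    then have "nrm F (dist_diff (dist_add a b) (dist_of_schwartz (\<lambda>x. \<phi> x + \<psi> x))) \<le> 2 * \<epsilon>"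
      using nrm_add[OF points_diff[OF a schwartz_points[OF \<phi>(1)]] points_diff[OF b schwartz_points[OF \<psi>(1)]]] \<phi> \<psi>
      by simp
    then have 1: "cmod (L (dist_add a b) - (f \<phi> + f \<psi>)) \<le> C * (2 * \<epsilon>)"
      using L[OF points_add[OF a b] schwartz_add[OF \<phi>(1) \<psi>(1)]] C
      by (simp add: tempered_add_arg f \<phi> \<psi>) (meson mult_left_mono order_trans)
    have 2: "cmod (L a - f \<phi>) \<le> C * \<epsilon>" "cmod (L b - f \<psi>) \<le> C * \<epsilon>"
      using L[OF a \<phi>(1)] L[OF b \<psi>(1)] \<phi>(2) \<psi>(2) C by (meson less_imp_le mult_left_mono order_trans)+
    have "L (dist_add a b) - (L a + L b) = (L (dist_add a b) - (f \<phi> + f \<psi>)) - ((L a - f \<phi>) + (L b - f \<psi>))" by simp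
    also have "cmod \<dots> \<le> C * (2 * \<epsilon>) + (C * \<epsilon> + C * \<epsilon>)"
      by (rule order_trans[OF norm_triangle_ineq4 add_mono[OF 1 order_trans[OF norm_triangle_ineq add_mono[OF 2]]]])
    finally show "cmod (L (dist_add a b) - (L a + L b)) \<le> 4 * C * \<epsilon>" by simp
  qed (use C in simp)
  have Lscale: "L (dist_scale c a) = c * L a" if a: "a \<in> points F" for c a
  proof (rule ext[of _ _ "2 * (C * cmod c)"])
    fix \<epsilon> :: real assume \<epsilon>: "\<epsilon> > 0"
    obtain \<phi> where \<phi>: "schwartz \<phi>" "nrm F (dist_diff a (dist_of_schwartz \<phi>)) < \<epsilon>"
      using schwartz_approx[OF a \<epsilon>] by blast
    have "dist_diff (dist_scale c a) (dist_of_schwartz (\<lambda>x. c * \<phi> x)) = dist_scale c (dist_diff a (dist_of_schwartz \<phi>))"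
      by (simp add: dist_of_schwartz_cmult dist_diff_def dist_scale_def right_diff_distrib)
    then have "nrm F (dist_diff (dist_scale c a) (dist_of_schwartz (\<lambda>x. c * \<phi> x))) \<le> cmod c * \<epsilon>"
      using nrm_scale[OF points_diff[OF a schwartz_points[OF \<phi>(1)]]] \<phi> by (simp add: mult_left_mono)
    then have 1: "cmod (L (dist_scale c a) - c * f \<phi>) \<le> C * (cmod c * \<epsilon>)"
      using L[OF points_scale[OF a] schwartz_cmult[OF \<phi>(1)], of c c] C
      by (simp add: tempered_cmult_arg f \<phi>) (meson mult_left_mono order_trans)
    have "cmod (L a - f \<phi>) \<le> C * \<epsilon>"
      using L[OF a \<phi>(1)] \<phi>(2) C by (meson less_imp_le mult_left_mono order_trans)
    then have 2: "cmod (c * (L a - f \<phi>)) \<le> cmod c * (C * \<epsilon>)" by (simp add: norm_mult mult_left_mono)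
    have "L (dist_scale c a) - c * L a = (L (dist_scale c a) - c * f \<phi>) - c * (L a - f \<phi>)"
      by (simp add: right_diff_distrib)
    also have "cmod \<dots> \<le> C * (cmod c * \<epsilon>) + cmod c * (C * \<epsilon>)"
      by (rule order_trans[OF norm_triangle_ineq4 add_mono[OF 1 2]])
    finally show "cmod (L (dist_scale c a) - c * L a) \<le> 2 * (C * cmod c) * \<epsilon>" by (simp add: mult_ac)
  qed (use C in simp)
  have "induces F L f"
    unfolding induces_def bounded_functional_def using Lschwartz Lbound Ladd Lscale by metis
  then show ?thesis using f by (auto simp: dual_points_iff)
qed

end

section \<open>Vector fields with components in a dual space\<close>

definition vadd :: "('n \<Rightarrow> 'n::finite dist) \<Rightarrow> ('n \<Rightarrow> 'n dist) \<Rightarrow> 'n \<Rightarrow> 'n dist" where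
  "vadd u v = (\<lambda>j. dist_add (u j) (v j))"

definition vdiff :: "('n \<Rightarrow> 'n::finite dist) \<Rightarrow> ('n \<Rightarrow> 'n dist) \<Rightarrow> 'n \<Rightarrow> 'n dist" where
  "vdiff u v = (\<lambda>j. dist_diff (u j) (v j))"

definition vzero :: "'n \<Rightarrow> 'n::finite dist" where
  "vzero = (\<lambda>j. dist_zero)"

lemma vdiff_algebra:
  "vadd v (vdiff u v) = u" "vdiff (vadd u v) v = u" "vdiff u u = vzero" "vdiff u vzero = u" "vadd u vzero = u"
  "vadd vzero u = u"
  by (simp_all add: vadd_def vdiff_def vzero_def dist_add_def dist_diff_def dist_zero_def)

context dense_space
begin

lemma vfield_vadd: "vfield_in (dual F) u \<Longrightarrow> vfield_in (dual F) v \<Longrightarrow> vfield_in (dual F) (vadd u v)"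
  and vfield_vdiff: "vfield_in (dual F) u \<Longrightarrow> vfield_in (dual F) v \<Longrightarrow> vfield_in (dual F) (vdiff u v)"
  and vfield_vzero: "vfield_in (dual F) vzero"
  by (auto simp: vfield_in_def vadd_def vdiff_def vzero_def dual_add dual_diff dual_zero)

lemma vnorm_nonneg: "vfield_in (dual F) u \<Longrightarrow> 0 \<le> vnorm (dual F) u"
  by (auto simp: vfield_in_def vnorm_def intro!: sum_nonneg nrm_dual_nonneg)

lemma vnorm_vzero: "vnorm (dual F) vzero = 0"
  by (simp add: vnorm_def vzero_def nrm_dual_zero)

lemma vnorm_vadd: "vfield_in (dual F) u \<Longrightarrow> vfield_in (dual F) v \<Longrightarrow>
    vnorm (dual F) (vadd u v) \<le> vnorm (dual F) u + vnorm (dual F) v"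
  unfolding vnorm_def vadd_def vfield_in_def sum.distrib[symmetric] by (intro sum_mono nrm_dual_add) auto

lemma vnorm_vdiff: "vfield_in (dual F) u \<Longrightarrow> vfield_in (dual F) v \<Longrightarrow>
    vnorm (dual F) (vdiff u v) \<le> vnorm (dual F) u + vnorm (dual F) v"
  unfolding vnorm_def vdiff_def vfield_in_def sum.distrib[symmetric] by (intro sum_mono nrm_dual_diff) auto

lemma vnorm_vdiff_commute: "vfield_in (dual F) u \<Longrightarrow> vfield_in (dual F) v \<Longrightarrow>
    vnorm (dual F) (vdiff u v) = vnorm (dual F) (vdiff v u)"
  unfolding vnorm_def vdiff_def vfield_in_def by (intro sum.cong antisym nrm_dual_diff_commute) auto

lemma vnorm_vdiff_triangle:
  assumes "vfield_in (dual F) u" "vfield_in (dual F) v" "vfield_in (dual F) w"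
  shows "vnorm (dual F) (vdiff u w) \<le> vnorm (dual F) (vdiff u v) + vnorm (dual F) (vdiff v w)"
proof -
  have "vdiff u w = vadd (vdiff u v) (vdiff v w)"
    by (simp add: vadd_def vdiff_def dist_add_def dist_diff_def)
  then show ?thesis using vnorm_vadd[OF vfield_vdiff vfield_vdiff, of u v v w] assms by simp
qed

lemma vnorm_eq_0: "vfield_in (dual F) u \<Longrightarrow> vnorm (dual F) u \<le> 0 \<Longrightarrow> u = vzero"
proof
  fix j assume u: "vfield_in (dual F) u" and z: "vnorm (dual F) u \<le> 0"
  have "nrm (dual F) (u j) \<le> vnorm (dual F) u"
    unfolding vnorm_def using u by (intro member_le_sum) (auto simp: vfield_in_def nrm_dual_nonneg)
  with z show "u j = vzero j" using u nrm_dual_eq_0[of "u j"] by (simp add: vfield_in_def vzero_def)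
qed

lemma nrm_le_vnorm: "vfield_in (dual F) u \<Longrightarrow> nrm (dual F) (u j) \<le> vnorm (dual F) u"
  unfolding vnorm_def by (intro member_le_sum) (auto simp: vfield_in_def nrm_dual_nonneg)

end

section \<open>Pointwise products\<close>

lemma test_function_times_integrable:
  fixes F :: "real^'n::finite \<Rightarrow> complex"
  assumes F: "\<And>S. compact S \<Longrightarrow> F absolutely_integrable_on S" and \<phi>: "test_function \<phi>"
  shows "integrable lebesgue (\<lambda>x. F x * \<phi> x)"
proof -
  from \<phi> obtain R where R: "\<And>x. \<phi> x \<noteq> 0 \<Longrightarrow> norm x \<le> R"
    unfolding test_function_def bounded_iff by auto
  have s: "schwartz \<phi>" using \<phi> by (simp add: test_function_def)
  obtain C where C: "C > 0" "\<And>x. cmod (\<phi> x) \<le> C" using schwartz_bounded[OF s] by blast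
  let ?G = "\<lambda>x. indicator (cball 0 R) x *\<^sub>R F x"
  have G: "integrable lebesgue ?G" using F[OF compact_cball[of 0 R]] by (simp add: set_integrable_def)
  have e: "F x * \<phi> x = ?G x * \<phi> x" for x using R[of x] by (cases "\<phi> x = 0") auto
  have "\<phi> \<in> borel_measurable lebesgue" by (rule measurable_completion) (simp add: schwartz_borel[OF s])
  then have me: "(\<lambda>x. ?G x * \<phi> x) \<in> borel_measurable lebesgue"
    using borel_measurable_integrable[OF G] by (intro borel_measurable_times)
  have "integrable lebesgue (\<lambda>x. ?G x * \<phi> x)"
  proof (rule Bochner_Integration.integrable_bound[OF integrable_mult_right[OF integrable_norm[OF G], of C] me])
    show "AE x in lebesgue. norm (?G x * \<phi> x) \<le> norm (C * norm (?G x))"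
    proof (rule AE_I2)
      fix x
      have *: "norm (C * a) = a * C" if "a \<ge> 0" for a using C(1) that by simp
      show "norm (?G x * \<phi> x) \<le> norm (C * norm (?G x))"
        unfolding norm_mult[of "?G x"] *[OF norm_ge_zero] by (intro mult_left_mono C) simp
    qed
  qed
  then show ?thesis unfolding e[symmetric] .
qed

lemma represents_integrable: "represents F f \<Longrightarrow> test_function \<phi> \<Longrightarrow> integrable lebesgue (\<lambda>x. F x * \<phi> x)"
  by (rule test_function_times_integrable) (auto simp: represents_def)

text \<open>The difference of two representatives integrates to zero against all test functions, so
  the fundamental lemma applies.\<close>

lemma represents_unique:
  assumes F: "represents F f" and G: "represents G f"
  shows "AE x in lebesgue. F x = G x"
proof -
  have "AE x in lebesgue. F x - G x = 0"
  proof (rule fundamental_lemma)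
    show "(\<lambda>x. F x - G x) absolutely_integrable_on S" if "compact S" for S
      using F G that unfolding represents_def by (intro set_integral_diff) auto
    show "(LINT x|lebesgue. (F x - G x) * \<phi> x) = 0" if "test_function \<phi>" for \<phi>
    proof -
      have "f \<phi> = (LINT x|lebesgue. F x * \<phi> x)" "f \<phi> = (LINT x|lebesgue. G x * \<phi> x)"
        using F G that unfolding represents_def by blast+
      then show ?thesis
        using Bochner_Integration.integral_diff[OF represents_integrable[OF F that] represents_integrable[OF G that]]
        by (simp add: left_diff_distrib)
    qed
  qed
  then show ?thesis by simp
qed

text \<open>Completeness of Lebesgue measure makes the modified function measurable, so local
  integrability carries over.\<close>

lemma represents_cong_AE:
  assumes F: "represents F f" and eq: "AE x in lebesgue. F x = G x"
  shows "represents G f"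
proof -
  obtain N where N0: "N \<in> null_sets lebesgue" and eqN: "{x \<in> space lebesgue. F x \<noteq> G x} \<subseteq> N"
    using eq unfolding eventually_ae_filter by blast
  have N1: "negligible N" using N0 by (simp only: negligible_iff_null_sets)
  have N2: "F x = G x" if "x \<notin> N" for x
  proof (rule ccontr)
    assume "F x \<noteq> G x"
    then have "x \<in> {x \<in> space lebesgue. F x \<noteq> G x}" by simp
    with eqN that show False by blast
  qed
  have ai: "G absolutely_integrable_on S" if S: "compact S" for S
  proof (rule absolutely_integrable_spike[OF _ N1])
    show "F absolutely_integrable_on S" using F S unfolding represents_def by blast
    show "G x = F x" if "x \<in> S - N" for x using N2[of x] that by simp
  qed
  have "(LINT x|lebesgue. F x * \<phi> x) = (LINT x|lebesgue. G x * \<phi> x)" if "test_function \<phi>" for \<phi>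
  proof (rule integral_cong_AE)
    show "AE x in lebesgue. F x * \<phi> x = G x * \<phi> x" using eq by eventually_elim simp
  qed (use borel_measurable_integrable[OF represents_integrable[OF F that]]
      borel_measurable_integrable[OF test_function_times_integrable[OF ai that]] in blast)+
  moreover have "f \<phi> = (LINT x|lebesgue. F x * \<phi> x)" if "test_function \<phi>" for \<phi>
    using F that unfolding represents_def by blast
  ultimately have "\<forall>\<phi>. test_function \<phi> \<longrightarrow> f \<phi> = (LINT x|lebesgue. G x * \<phi> x)" by metis
  with F ai show ?thesis unfolding represents_def by blast
qed

lemma represents_add:
  assumes F: "represents F f" and G: "represents G g"
  shows "represents (\<lambda>x. F x + G x) (dist_add f g)"
  unfolding represents_def
proof (intro conjI allI impI)
  show "tempered (dist_add f g)" using F G by (intro tempered_dist_add) (auto simp: represents_def)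
  show "(\<lambda>x. F x + G x) absolutely_integrable_on S" if "compact S" for S
    using F G that unfolding represents_def by (intro set_integral_add) auto
  show "dist_add f g \<phi> = (LINT x|lebesgue. (F x + G x) * \<phi> x)" if "test_function \<phi>" for \<phi>
  proof -
    have "f \<phi> = (LINT x|lebesgue. F x * \<phi> x)" "g \<phi> = (LINT x|lebesgue. G x * \<phi> x)"
      using F G that unfolding represents_def by blast+
    then show ?thesis
      using Bochner_Integration.integral_add[OF represents_integrable[OF F that] represents_integrable[OF G that]]
      by (simp add: distrib_right dist_add_def)
  qed
qed

lemma represents_eqI:
  assumes f: "represents F f" and g: "represents G g" and eq: "AE x in lebesgue. F x = G x"
  shows "f = g"
proof (rule tempered_eqI)
  show "tempered f" "tempered g" using f g by (auto simp: represents_def)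
  show "f \<phi> = g \<phi>" if "test_function \<phi>" for \<phi>
    using represents_cong_AE[OF f eq] g that by (simp add: represents_def)
qed

text \<open>Different representatives of the factors agree almost everywhere, hence so do their
  products, and a tempered distribution is determined by a representative.\<close>

lemma is_product_unique:
  assumes "is_product f g h" "is_product f g h'"
  shows "h = h'"
proof -
  obtain F G where 1: "represents F f" "represents G g" "represents (\<lambda>x. F x * G x) h"
    using assms(1) by (auto simp: is_product_def)
  obtain F' G' where 2: "represents F' f" "represents G' g" "represents (\<lambda>x. F' x * G' x) h'"
    using assms(2) by (auto simp: is_product_def)
  have "AE x in lebesgue. F x * G x = F' x * G' x"
    using represents_unique[OF 1(1) 2(1)] represents_unique[OF 1(2) 2(2)] by eventually_elim simp
  then show ?thesis by (rule represents_eqI[OF 1(3) 2(3)])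
qed

lemma is_product_commute: "is_product f g h \<longleftrightarrow> is_product g f h"
proof -
  have "is_product g f h" if fgh: "is_product f g h" for f g h :: "'n::finite dist"
  proof -
    obtain F G where FG: "represents F f" "represents G g" "represents (\<lambda>x. F x * G x) h"
      using fgh by (auto simp: is_product_def)
    from FG(3) have "represents (\<lambda>x. G x * F x) h" by (simp add: mult.commute)
    with FG show ?thesis by (auto simp: is_product_def)
  qed
  then show ?thesis by blast
qed

text \<open>The two products may come with different representatives of \<open>g\<close>; one of
  them is replaced on a null set before adding.\<close>

lemma is_product_add_left:
  assumes "is_product f g h" "is_product f' g h'"
  shows "is_product (dist_add f f') g (dist_add h h')"
proof -
  obtain F G where 1: "represents F f" "represents G g" "represents (\<lambda>x. F x * G x) h"
    using assms(1) by (auto simp: is_product_def)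
  obtain F' G' where 2: "represents F' f'" "represents G' g" "represents (\<lambda>x. F' x * G' x) h'"
    using assms(2) by (auto simp: is_product_def)
  have "AE x in lebesgue. F' x * G' x = F' x * G x"
    using represents_unique[OF 2(2) 1(2)] by eventually_elim simp
  then have "represents (\<lambda>x. F' x * G x) h'" by (rule represents_cong_AE[OF 2(3)])
  from represents_add[OF 1(3) this] have "represents (\<lambda>x. (F x + F' x) * G x) (dist_add h h')"
    by (simp add: distrib_right)
  with represents_add[OF 1(1) 2(1)] 1(2) show ?thesis by (auto simp: is_product_def)
qed

lemma is_product_add_right:
  "is_product g f h \<Longrightarrow> is_product g f' h' \<Longrightarrow> is_product g (dist_add f f') (dist_add h h')"
  using is_product_add_left is_product_commute by metis

lemma test_function_scale:
  fixes \<phi> :: "real^'n::finite \<Rightarrow> complex"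
  assumes "test_function \<phi>" "c \<noteq> 0"
  shows "test_function (\<lambda>x. \<phi> (c *\<^sub>R x))"
proof (rule test_function_intro)
  show "smooth (\<lambda>x. \<phi> (c *\<^sub>R x))"
    using assms by (intro smooth_scale schwartz_smooth) (simp add: test_function_def)
  have "{x. \<phi> (c *\<^sub>R x) \<noteq> 0} \<subseteq> (\<lambda>x. (1 / c) *\<^sub>R x) ` {x. \<phi> x \<noteq> 0}"
  proof
    fix x assume "x \<in> {x. \<phi> (c *\<^sub>R x) \<noteq> 0}"
    then show "x \<in> (\<lambda>x. (1 / c) *\<^sub>R x) ` {x. \<phi> x \<noteq> 0}"
      using assms(2) by (intro image_eqI[of _ _ "c *\<^sub>R x"]) auto
  qed
  moreover have "bounded {x. \<phi> x \<noteq> 0}" using assms(1) by (simp add: test_function_def)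
  ultimately show "bounded {x. \<phi> (c *\<^sub>R x) \<noteq> 0}" using bounded_scaling bounded_subset by blast
qed

text \<open>Change of variables; the Jacobian l^n cancels the normalising factor in
  \<open>dilate\<close>.\<close>

lemma represents_dilate:
  fixes f :: "'n::finite dist"
  assumes l: "l > 0" and F: "represents F f" and t: "tempered (dilate l f)"
  shows "represents (\<lambda>x. F (l *\<^sub>R x)) (dilate l f)"
  unfolding represents_def
proof (intro conjI allI impI t)
  fix S :: "(real^'n) set" assume S: "compact S"
  let ?lS = "(\<lambda>x. l *\<^sub>R x) ` S"
  have "compact ?lS" using S by (rule compact_scaling)
  then have "integrable lebesgue (\<lambda>x. indicator ?lS x *\<^sub>R F x)"
    using F by (simp add: represents_def set_integrable_def)
  from lebesgue_integral_scale(2)[OF l this]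
  have "integrable lebesgue (\<lambda>x. indicator ?lS (l *\<^sub>R x) *\<^sub>R F (l *\<^sub>R x))" .
  moreover have "indicator ?lS (l *\<^sub>R x) = (indicator S x :: real)" for x
    using l by (auto simp: indicator_def image_iff)
  ultimately show "(\<lambda>x. F (l *\<^sub>R x)) absolutely_integrable_on S"
    by (simp add: set_integrable_def)
next
  fix \<phi> :: "real^'n \<Rightarrow> complex" assume \<phi>: "test_function \<phi>"
  have s: "schwartz \<phi>" using \<phi> by (simp add: test_function_def)
  have "f (\<lambda>x. \<phi> (x /\<^sub>R l)) = (LINT x|lebesgue. F x * \<phi> (x /\<^sub>R l))"
    using F test_function_scale[OF \<phi>, of "inverse l"] l by (simp add: represents_def)
  also have "\<dots> = of_real (l ^ CARD('n)) * (LINT x|lebesgue. F (l *\<^sub>R x) * \<phi> x)"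
    using lebesgue_integral_scale(1)[OF l, of "\<lambda>x. F x * \<phi> (x /\<^sub>R l)"] l by simp
  finally show "dilate l f \<phi> = (LINT x|lebesgue. F (l *\<^sub>R x) * \<phi> x)"
    using l s by (simp add: dilate_def)
qed

lemma is_product_dilate:
  assumes "l > 0" "is_product f g h" "tempered (dilate l f)" "tempered (dilate l g)" "tempered (dilate l h)"
  shows "is_product (dilate l f) (dilate l g) (dilate l h)"
proof -
  obtain F G where FG: "represents F f" "represents G g" "represents (\<lambda>x. F x * G x) h"
    using assms(2) by (auto simp: is_product_def)
  have "represents (\<lambda>x. F (l *\<^sub>R x)) (dilate l f)" "represents (\<lambda>x. G (l *\<^sub>R x)) (dilate l g)"
      "represents (\<lambda>x. F (l *\<^sub>R x) * G (l *\<^sub>R x)) (dilate l h)"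
    using represents_dilate[OF assms(1)] FG assms by blast+
  then show ?thesis unfolding is_product_def
    by (intro exI[of _ "\<lambda>x. F (l *\<^sub>R x)"] exI[of _ "\<lambda>x. G (l *\<^sub>R x)"]) simp
qed

lemma dilate_dilate_inverse:
  assumes "l > 0" "tempered f"
  shows "dilate (1 / l) (dilate l f) = f"
proof
  fix \<phi>
  show "dilate (1 / l) (dilate l f) \<phi> = f \<phi>"
  proof (cases "schwartz \<phi>")
    case True
    then have "schwartz (\<lambda>x. \<phi> (l *\<^sub>R x))" using assms(1) by (intro schwartz_scale) auto
    then show ?thesis using True assms(1) by (simp add: dilate_def field_simps)
  next
    case False
    then show ?thesis using tempered_not_schwartz[OF assms(2)] by (simp add: dilate_def)
  qed
qed

section \<open>Fourier multipliers\<close>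

text \<open>For any one cutoff, both distributions are the limit of the same expression as
  \<epsilon> tends to 0.\<close>

lemma is_multiplier_unique:
  fixes f :: "'n::finite dist"
  assumes "is_multiplier m f g" "is_multiplier m f g'"
  shows "g = g'"
proof
  fix \<phi>
  obtain \<eta> :: "real^'n \<Rightarrow> complex" where \<eta>: "cutoff \<eta>" using cutoff_bump by blast
  show "g \<phi> = g' \<phi>"
  proof (cases "schwartz \<phi>")
    case True
    let ?h = "\<lambda>\<epsilon>. f (inv_fourier (\<lambda>\<xi>. (1 - \<eta> (- \<xi> /\<^sub>R \<epsilon>)) * m (- \<xi>) * fourier \<phi> \<xi>))"
    have "(?h \<longlongrightarrow> g \<phi>) (at_right 0)" "(?h \<longlongrightarrow> g' \<phi>) (at_right 0)"
      using assms \<eta> True unfolding is_multiplier_def by blast+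
    then show ?thesis by (rule tendsto_unique[OF trivial_limit_at_right_real])
  next
    case False
    then show ?thesis using assms tempered_not_schwartz by (metis is_multiplier_def)
  qed
qed

lemma is_multiplier_add:
  fixes f :: "'n::finite dist"
  assumes "is_multiplier m f g" "is_multiplier m f' g'"
  shows "is_multiplier m (dist_add f f') (dist_add g g')"
  unfolding is_multiplier_def
proof (intro conjI allI impI)
  show "tempered (dist_add f f')" "tempered (dist_add g g')"
    using assms by (simp_all add: is_multiplier_def tempered_dist_add)
  fix \<eta> \<phi> :: "real^'n \<Rightarrow> complex" assume "cutoff \<eta>" "schwartz \<phi>"
  with assms show "((\<lambda>\<epsilon>. dist_add f f' (inv_fourier (\<lambda>\<xi>. (1 - \<eta> (- \<xi> /\<^sub>R \<epsilon>)) * m (- \<xi>) * fourier \<phi> \<xi>)))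
      \<longlongrightarrow> dist_add g g' \<phi>) (at_right 0)"
    unfolding dist_add_def is_multiplier_def by (intro tendsto_add) blast+
qed

text \<open>The additional factor exp(-r |\<xi>|^2) is even and so unaffected by the reflection in
  the transposed multiplier. Absorbed into the Fourier transform of the test function, it turns
  \<phi> into \<open>heat_conv r \<phi>\<close>, which is how \<open>heat r\<close> acts.\<close>

lemma is_multiplier_heat:
  fixes f g :: "'n::finite dist"
  assumes m: "is_multiplier (grad_heat_leray_symbol s l j k) f g" and r: "r > 0"
  shows "is_multiplier (grad_heat_leray_symbol (s + r) l j k) f (heat r g)"
  unfolding is_multiplier_def
proof (intro conjI allI impI)
  show "tempered f" "tempered (heat r g)" using m r by (auto simp: is_multiplier_def tempered_heat)
  fix \<eta> \<phi> :: "real^'n \<Rightarrow> complex" assume \<eta>: "cutoff \<eta>" and \<phi>: "schwartz \<phi>"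
  have e: "(\<lambda>\<xi>. (1 - \<eta> (- \<xi> /\<^sub>R \<epsilon>)) * grad_heat_leray_symbol (s + r) l j k (- \<xi>) * fourier \<phi> \<xi>) =
      (\<lambda>\<xi>. (1 - \<eta> (- \<xi> /\<^sub>R \<epsilon>)) * grad_heat_leray_symbol s l j k (- \<xi>) * fourier (heat_conv r \<phi>) \<xi>)" for \<epsilon>
  proof
    fix \<xi> :: "real^'n"
    have "exp (- (s + r) * (norm \<xi>)\<^sup>2) = exp (- s * (norm \<xi>)\<^sup>2) * exp (- r * (norm \<xi>)\<^sup>2)"
      by (simp add: algebra_simps flip: exp_add)
    then have "grad_heat_leray_symbol (s + r) l j k (- \<xi>) =
        grad_heat_leray_symbol s l j k (- \<xi>) * of_real (exp (- r * (norm \<xi>)\<^sup>2))"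
      by (simp add: grad_heat_leray_symbol_def)
    then show "(1 - \<eta> (- \<xi> /\<^sub>R \<epsilon>)) * grad_heat_leray_symbol (s + r) l j k (- \<xi>) * fourier \<phi> \<xi> =
        (1 - \<eta> (- \<xi> /\<^sub>R \<epsilon>)) * grad_heat_leray_symbol s l j k (- \<xi>) * fourier (heat_conv r \<phi>) \<xi>"
      unfolding fourier_heat_conv[OF r \<phi>] by (simp only: mult.assoc)
  qed
  show "((\<lambda>\<epsilon>. f (inv_fourier (\<lambda>\<xi>. (1 - \<eta> (- \<xi> /\<^sub>R \<epsilon>)) * grad_heat_leray_symbol (s + r) l j k (- \<xi>) * fourier \<phi> \<xi>)))
      \<longlongrightarrow> heat r g \<phi>) (at_right 0)"
    unfolding e heat_apply[OF r \<phi>]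
    using m \<eta> schwartz_heat_conv[OF r \<phi>] unfolding is_multiplier_def by blast
qed

lemma grad_heat_leray_unique:
  assumes "grad_heat_leray s f l j g" "grad_heat_leray s f l j g'"
  shows "g = g'"
proof -
  obtain h where h: "\<And>k. is_multiplier (grad_heat_leray_symbol s l j k) (f k) (h k)" "g = (\<lambda>\<phi>. \<Sum>k\<in>UNIV. h k \<phi>)"
    using assms(1) by (auto simp: grad_heat_leray_def)
  obtain h' where h': "\<And>k. is_multiplier (grad_heat_leray_symbol s l j k) (f k) (h' k)" "g' = (\<lambda>\<phi>. \<Sum>k\<in>UNIV. h' k \<phi>)"
    using assms(2) by (auto simp: grad_heat_leray_def)
  have "h k = h' k" for k by (rule is_multiplier_unique[OF h(1) h'(1)])
  then show ?thesis by (simp add: h(2) h'(2))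
qed

lemma grad_heat_leray_add:
  assumes "grad_heat_leray s f l j g" "grad_heat_leray s f' l j g'"
  shows "grad_heat_leray s (vadd f f') l j (dist_add g g')"
proof -
  obtain h where h: "\<And>k. is_multiplier (grad_heat_leray_symbol s l j k) (f k) (h k)" "g = (\<lambda>\<phi>. \<Sum>k\<in>UNIV. h k \<phi>)"
    using assms(1) by (auto simp: grad_heat_leray_def)
  obtain h' where h': "\<And>k. is_multiplier (grad_heat_leray_symbol s l j k) (f' k) (h' k)" "g' = (\<lambda>\<phi>. \<Sum>k\<in>UNIV. h' k \<phi>)"
    using assms(2) by (auto simp: grad_heat_leray_def)
  show ?thesis unfolding grad_heat_leray_def vadd_def
    by (rule exI[of _ "\<lambda>k. dist_add (h k) (h' k)"])
       (simp add: h h' is_multiplier_add, simp add: dist_add_def sum.distrib)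
qed

lemma heat_sum: "t > 0 \<Longrightarrow> heat t (\<lambda>\<phi>. \<Sum>k\<in>K. h k \<phi>) = (\<lambda>\<phi>. \<Sum>k\<in>K. heat t (h k) \<phi>)"
  by (auto simp: heat_def fun_eq_iff)

lemma grad_heat_leray_heat:
  assumes "grad_heat_leray s f l j g" "r > 0"
  shows "grad_heat_leray (s + r) f l j (heat r g)"
proof -
  obtain h where h: "\<And>k. is_multiplier (grad_heat_leray_symbol s l j k) (f k) (h k)" "g = (\<lambda>\<phi>. \<Sum>k\<in>UNIV. h k \<phi>)"
    using assms(1) by (auto simp: grad_heat_leray_def)
  then show ?thesis unfolding grad_heat_leray_def
    by (intro exI[of _ "\<lambda>k. heat r (h k)"]) (simp add: is_multiplier_heat heat_sum assms(2))
qed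

lemma div_heat_leray_tensor_unique:
  assumes "div_heat_leray_tensor s u v g" "div_heat_leray_tensor s u v g'"
  shows "g = g'"
proof -
  obtain W D where 1: "\<And>l k. is_product (u l) (v k) (W l k)" "\<And>l j. grad_heat_leray s (W l) l j (D l j)"
      "\<And>j. g j = (\<lambda>\<phi>. \<Sum>l\<in>UNIV. D l j \<phi>)"
    using assms(1) by (auto simp: div_heat_leray_tensor_def)
  obtain W' D' where 2: "\<And>l k. is_product (u l) (v k) (W' l k)" "\<And>l j. grad_heat_leray s (W' l) l j (D' l j)"
      "\<And>j. g' j = (\<lambda>\<phi>. \<Sum>l\<in>UNIV. D' l j \<phi>)"
    using assms(2) by (auto simp: div_heat_leray_tensor_def)
  have W: "W' l = W l" for l by (rule ext) (rule is_product_unique[OF 2(1) 1(1)])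
  have "D l j = D' l j" for l j by (rule grad_heat_leray_unique[OF 1(2) 2(2)[unfolded W]])
  then show ?thesis using 1(3) 2(3) by (intro ext) simp
qed

lemma div_heat_leray_tensor_add_left:
  assumes "div_heat_leray_tensor s u v g" "div_heat_leray_tensor s u' v g'"
  shows "div_heat_leray_tensor s (vadd u u') v (vadd g g')"
proof -
  obtain W D where 1: "\<And>l k. is_product (u l) (v k) (W l k)" "\<And>l j. grad_heat_leray s (W l) l j (D l j)"
      "\<And>j. g j = (\<lambda>\<phi>. \<Sum>l\<in>UNIV. D l j \<phi>)"
    using assms(1) by (auto simp: div_heat_leray_tensor_def)
  obtain W' D' where 2: "\<And>l k. is_product (u' l) (v k) (W' l k)" "\<And>l j. grad_heat_leray s (W' l) l j (D' l j)"
      "\<And>j. g' j = (\<lambda>\<phi>. \<Sum>l\<in>UNIV. D' l j \<phi>)"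
    using assms(2) by (auto simp: div_heat_leray_tensor_def)
  show ?thesis unfolding div_heat_leray_tensor_def
  proof (rule exI[of _ "\<lambda>l. vadd (W l) (W' l)"], rule exI[of _ "\<lambda>l j. dist_add (D l j) (D' l j)"], intro conjI allI)
    show "is_product (vadd u u' l) (v k) (vadd (W l) (W' l) k)" for l k
      unfolding vadd_def by (intro is_product_add_left 1 2)
    show "grad_heat_leray s (vadd (W l) (W' l)) l j (dist_add (D l j) (D' l j))" for l j
      by (intro grad_heat_leray_add 1 2)
  qed (simp add: vadd_def dist_add_def 1(3) 2(3) sum.distrib)
qed

lemma div_heat_leray_tensor_add_right:
  assumes "div_heat_leray_tensor s u v g" "div_heat_leray_tensor s u v' g'"
  shows "div_heat_leray_tensor s u (vadd v v') (vadd g g')"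
proof -
  obtain W D where 1: "\<And>l k. is_product (u l) (v k) (W l k)" "\<And>l j. grad_heat_leray s (W l) l j (D l j)"
      "\<And>j. g j = (\<lambda>\<phi>. \<Sum>l\<in>UNIV. D l j \<phi>)"
    using assms(1) by (auto simp: div_heat_leray_tensor_def)
  obtain W' D' where 2: "\<And>l k. is_product (u l) (v' k) (W' l k)" "\<And>l j. grad_heat_leray s (W' l) l j (D' l j)"
      "\<And>j. g' j = (\<lambda>\<phi>. \<Sum>l\<in>UNIV. D' l j \<phi>)"
    using assms(2) by (auto simp: div_heat_leray_tensor_def)
  show ?thesis unfolding div_heat_leray_tensor_def
  proof (rule exI[of _ "\<lambda>l. vadd (W l) (W' l)"], rule exI[of _ "\<lambda>l j. dist_add (D l j) (D' l j)"], intro conjI allI)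
    show "is_product (u l) (vadd v v' k) (vadd (W l) (W' l) k)" for l k
      unfolding vadd_def by (intro is_product_add_right 1 2)
    show "grad_heat_leray s (vadd (W l) (W' l)) l j (dist_add (D l j) (D' l j))" for l j
      by (intro grad_heat_leray_add 1 2)
  qed (simp add: vadd_def dist_add_def 1(3) 2(3) sum.distrib)
qed

lemma div_heat_leray_tensor_heat:
  assumes "div_heat_leray_tensor s u v g" "r > 0"
  shows "div_heat_leray_tensor (s + r) u v (\<lambda>j. heat r (g j))"
proof -
  obtain W D where 1: "\<And>l k. is_product (u l) (v k) (W l k)" "\<And>l j. grad_heat_leray s (W l) l j (D l j)"
      "\<And>j. g j = (\<lambda>\<phi>. \<Sum>l\<in>UNIV. D l j \<phi>)"
    using assms(1) by (auto simp: div_heat_leray_tensor_def)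
  show ?thesis unfolding div_heat_leray_tensor_def
    by (rule exI[of _ W], rule exI[of _ "\<lambda>l j. heat r (D l j)"], intro conjI allI)
       (simp_all add: 1 heat_sum assms(2) grad_heat_leray_heat)
qed

section \<open>The bilinear operator\<close>

text \<open>Reflecting s to t - s moves the singularity to 0, where \<beta> > -1 makes the power
  integrable.\<close>

lemma
  fixes \<beta> a t :: real
  assumes b: "\<beta> > -1" and a: "0 \<le> a" "a \<le> t"
  shows powr_kernel_integrable: "integrable lebesgue (\<lambda>s. indicator {a<..<t} s * (t - s) powr \<beta>)"
    and powr_kernel_integral: "(LINT s|lebesgue. indicator {a<..<t} s * (t - s) powr \<beta>) = (t - a) powr (\<beta> + 1) / (\<beta> + 1)"
proof -
  have "((\<lambda>x. x powr \<beta>) has_integral ((t - a) powr (\<beta> + 1) / (\<beta> + 1))) {0..t - a}"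
    using has_integral_powr_from_0[of \<beta> "t - a"] b a by simp
  then have "((\<lambda>x. x powr \<beta>) has_integral ((t - a) powr (\<beta> + 1) / (\<beta> + 1))) (cbox 0 (t - a))" by simp
  from has_integral_affinity[OF this, of "-1" t]
  have "((\<lambda>s. (t - s) powr \<beta>) has_integral ((t - a) powr (\<beta> + 1) / (\<beta> + 1))) ((\<lambda>x. - x + t) ` cbox 0 (t - a))"
    by simp
  moreover have "(\<lambda>x. - x + t) ` cbox 0 (t - a) = {a..t}"
  proof (intro equalityI subsetI)
    fix s assume "s \<in> {a..t}"
    then show "s \<in> (\<lambda>x. - x + t) ` cbox 0 (t - a)" by (intro image_eqI[of _ _ "t - s"]) auto
  qed auto
  ultimately have h: "((\<lambda>s. (t - s) powr \<beta>) has_integral ((t - a) powr (\<beta> + 1) / (\<beta> + 1))) {a..t}" by simp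
  have "((\<lambda>s. (t - s) powr \<beta>) has_integral ((t - a) powr (\<beta> + 1) / (\<beta> + 1))) {a<..<t}"
    using h by (simp add: has_integral_Icc_iff_Ioo)
  moreover from this have "(\<lambda>s. (t - s) powr \<beta>) absolutely_integrable_on {a<..<t}"
    by (intro nonnegative_absolutely_integrable_1) auto
  ultimately show "integrable lebesgue (\<lambda>s. indicator {a<..<t} s * (t - s) powr \<beta>)"
    and "(LINT s|lebesgue. indicator {a<..<t} s * (t - s) powr \<beta>) = (t - a) powr (\<beta> + 1) / (\<beta> + 1)"
    using set_lebesgue_integral_eq_integral(2)[of "{a<..<t}" "\<lambda>s. (t - s) powr \<beta>"]
    by (auto simp: set_integrable_def set_lebesgue_integral_def dest: integral_unique)
qed

text \<open>By completeness of the measure, measurability of \<open>g\<close> comes for free. This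
  suits integrands that are specified only almost everywhere.\<close>

lemma integrable_lebesgue_cong_AE:
  fixes f g :: "'a::euclidean_space \<Rightarrow> 'b::euclidean_space"
  assumes f: "integrable lebesgue f" and eq: "AE x in lebesgue. f x = g x"
  shows "integrable lebesgue g"
proof -
  obtain N where N0: "N \<in> null_sets lebesgue" and eqN: "{x \<in> space lebesgue. f x \<noteq> g x} \<subseteq> N"
    using eq unfolding eventually_ae_filter by blast
  have "g absolutely_integrable_on UNIV"
  proof (rule absolutely_integrable_spike)
    show "f absolutely_integrable_on UNIV" using f by (simp add: set_integrable_def)
    show "negligible N" using N0 by (simp only: negligible_iff_null_sets)
    show "g x = f x" if "x \<in> UNIV - N" for x
    proof (rule ccontr)
      assume "g x \<noteq> f x"
      then have "x \<in> {x \<in> space lebesgue. f x \<noteq> g x}" by simp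
      with eqN that show False by blast
    qed
  qed
  then show ?thesis by (simp add: set_integrable_def)
qed

context dense_space
begin

lemma is_bilinear_iff:
  "is_bilinear F u v t w \<longleftrightarrow> vfield_in (dual F) w \<and>
     (\<exists>G. (AE s in lebesgue. s \<in> {0<..<t} \<longrightarrow>
             div_heat_leray_tensor (t - s) (u s) (v s) (G s) \<and> vfield_in (dual F) (G s)) \<and>
          (\<forall>j. \<forall>e\<in>points F.
             integrable lebesgue (\<lambda>s. indicator {0<..<t} s *\<^sub>R pairing F (G s j) e) \<and>
             pairing F (w j) e = - (LINT s|lebesgue. indicator {0<..<t} s *\<^sub>R pairing F (G s j) e)))"
proof -
  have "(AE s in lebesgue_on {0<..<t}. P s) \<longleftrightarrow> (AE s in lebesgue. s \<in> {0<..<t} \<longrightarrow> P s)" for P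
    by (subst AE_restrict_space_iff) auto
  then show ?thesis unfolding is_bilinear_def set_integrable_def set_lebesgue_integral_def by (simp only:)
qed

lemma is_bilinear_cong:
  assumes "\<And>s. s \<in> {0<..<t} \<Longrightarrow> u s = u' s" "\<And>s. s \<in> {0<..<t} \<Longrightarrow> v s = v' s"
  shows "is_bilinear F u v t w \<longleftrightarrow> is_bilinear F u' v' t w"
proof -
  have "(AE s in lebesgue. s \<in> {0<..<t} \<longrightarrow> div_heat_leray_tensor (t - s) (u s) (v s) (G s) \<and> vfield_in (dual F) (G s)) \<longleftrightarrow>
      (AE s in lebesgue. s \<in> {0<..<t} \<longrightarrow> div_heat_leray_tensor (t - s) (u' s) (v' s) (G s) \<and> vfield_in (dual F) (G s))" for G
    using assms by (intro AE_cong) auto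
  then show ?thesis unfolding is_bilinear_iff by simp
qed

text \<open>The integrands agree for almost every time because the tensor relation is single-valued,
  and an element of the dual is determined by its pairings. Different expansions of one bilinear
  term can therefore be equated.\<close>

lemma is_bilinear_unique:
  assumes "is_bilinear F u v t w" "is_bilinear F u v t w'"
  shows "w = w'"
proof -
  obtain G where w: "vfield_in (dual F) w"
    and G: "AE s in lebesgue. s \<in> {0<..<t} \<longrightarrow> div_heat_leray_tensor (t - s) (u s) (v s) (G s) \<and> vfield_in (dual F) (G s)"
      "\<And>j e. e \<in> points F \<Longrightarrow> integrable lebesgue (\<lambda>s. indicator {0<..<t} s *\<^sub>R pairing F (G s j) e)"
      "\<And>j e. e \<in> points F \<Longrightarrow> pairing F (w j) e = - (LINT s|lebesgue. indicator {0<..<t} s *\<^sub>R pairing F (G s j) e)"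
    using assms(1) unfolding is_bilinear_iff by blast
  obtain G' where w': "vfield_in (dual F) w'"
    and G': "AE s in lebesgue. s \<in> {0<..<t} \<longrightarrow> div_heat_leray_tensor (t - s) (u s) (v s) (G' s) \<and> vfield_in (dual F) (G' s)"
      "\<And>j e. e \<in> points F \<Longrightarrow> integrable lebesgue (\<lambda>s. indicator {0<..<t} s *\<^sub>R pairing F (G' s j) e)"
      "\<And>j e. e \<in> points F \<Longrightarrow> pairing F (w' j) e = - (LINT s|lebesgue. indicator {0<..<t} s *\<^sub>R pairing F (G' s j) e)"
    using assms(2) unfolding is_bilinear_iff by blast
  have eq: "AE s in lebesgue. s \<in> {0<..<t} \<longrightarrow> G s = G' s"
    using G(1) G'(1) by eventually_elim (use div_heat_leray_tensor_unique in blast)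
  show ?thesis
  proof
    fix j
    show "w j = w' j"
    proof (rule dual_eqI)
      show "w j \<in> points (dual F)" "w' j \<in> points (dual F)" using w w' by (auto simp: vfield_in_def)
      fix e assume e: "e \<in> points F"
      have "AE s in lebesgue. indicator {0<..<t} s *\<^sub>R pairing F (G s j) e = indicator {0<..<t} s *\<^sub>R pairing F (G' s j) e"
        using eq by eventually_elim (auto simp: indicator_def)
      then have "(LINT s|lebesgue. indicator {0<..<t} s *\<^sub>R pairing F (G s j) e) =
          (LINT s|lebesgue. indicator {0<..<t} s *\<^sub>R pairing F (G' s j) e)"
        by (rule integral_cong_AE[OF borel_measurable_integrable[OF G(2)[OF e]] borel_measurable_integrable[OF G'(2)[OF e]]])
      then show "pairing F (w j) e = pairing F (w' j) e" by (simp only: G(3)[OF e] G'(3)[OF e])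
    qed
  qed
qed

text \<open>The hypothesis \<open>tensor\<close> leaves open which slot is split, so one proof
  covers additivity in both arguments.\<close>

lemma is_bilinear_add:
  assumes "is_bilinear F u v t w" "is_bilinear F u' v' t w'"
    and tensor: "\<And>s g g'. div_heat_leray_tensor (t - s) (u s) (v s) g \<Longrightarrow> div_heat_leray_tensor (t - s) (u' s) (v' s) g' \<Longrightarrow>
      div_heat_leray_tensor (t - s) (a s) (b s) (vadd g g')"
  shows "is_bilinear F a b t (vadd w w')"
proof -
  obtain G where w: "vfield_in (dual F) w"
    and G: "AE s in lebesgue. s \<in> {0<..<t} \<longrightarrow> div_heat_leray_tensor (t - s) (u s) (v s) (G s) \<and> vfield_in (dual F) (G s)"
      "\<And>j e. e \<in> points F \<Longrightarrow> integrable lebesgue (\<lambda>s. indicator {0<..<t} s *\<^sub>R pairing F (G s j) e)"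
      "\<And>j e. e \<in> points F \<Longrightarrow> pairing F (w j) e = - (LINT s|lebesgue. indicator {0<..<t} s *\<^sub>R pairing F (G s j) e)"
    using assms(1) unfolding is_bilinear_iff by blast
  obtain G' where w': "vfield_in (dual F) w'"
    and G': "AE s in lebesgue. s \<in> {0<..<t} \<longrightarrow> div_heat_leray_tensor (t - s) (u' s) (v' s) (G' s) \<and> vfield_in (dual F) (G' s)"
      "\<And>j e. e \<in> points F \<Longrightarrow> integrable lebesgue (\<lambda>s. indicator {0<..<t} s *\<^sub>R pairing F (G' s j) e)"
      "\<And>j e. e \<in> points F \<Longrightarrow> pairing F (w' j) e = - (LINT s|lebesgue. indicator {0<..<t} s *\<^sub>R pairing F (G' s j) e)"
    using assms(2) unfolding is_bilinear_iff by blast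
  define H where "H s = (if vfield_in (dual F) (G s) \<and> vfield_in (dual F) (G' s) then vadd (G s) (G' s) else vzero)" for s
  have ae: "AE s in lebesgue. s \<in> {0<..<t} \<longrightarrow> vfield_in (dual F) (G s) \<and> vfield_in (dual F) (G' s)"
    using G(1) G'(1) by eventually_elim blast
  have H1: "AE s in lebesgue. s \<in> {0<..<t} \<longrightarrow> div_heat_leray_tensor (t - s) (a s) (b s) (H s) \<and> vfield_in (dual F) (H s)"
    using G(1) G'(1) by eventually_elim (auto simp: H_def intro: tensor vfield_vadd)
  have H2: "AE s in lebesgue. indicator {0<..<t} s *\<^sub>R pairing F (G s j) e + indicator {0<..<t} s *\<^sub>R pairing F (G' s j) e =
      indicator {0<..<t} s *\<^sub>R pairing F (H s j) e" if "e \<in> points F" for j e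
    using ae by eventually_elim (auto simp: indicator_def H_def vadd_def vfield_in_def dual_add(2) that)
  have int: "integrable lebesgue (\<lambda>s. indicator {0<..<t} s *\<^sub>R pairing F (G s j) e + indicator {0<..<t} s *\<^sub>R pairing F (G' s j) e)"
    if "e \<in> points F" for j e
    using G(2)[OF that] G'(2)[OF that] by (rule Bochner_Integration.integrable_add)
  have H3: "integrable lebesgue (\<lambda>s. indicator {0<..<t} s *\<^sub>R pairing F (H s j) e)" if "e \<in> points F" for j e
    by (rule integrable_lebesgue_cong_AE[OF int[OF that] H2[OF that]])
  have H4: "pairing F (vadd w w' j) e = - (LINT s|lebesgue. indicator {0<..<t} s *\<^sub>R pairing F (H s j) e)" if "e \<in> points F" for j e
  proof -
    have "pairing F (vadd w w' j) e = pairing F (w j) e + pairing F (w' j) e"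
      using w w' that by (simp add: vadd_def vfield_in_def dual_add(2))
    also have "\<dots> = - (LINT s|lebesgue. indicator {0<..<t} s *\<^sub>R pairing F (G s j) e + indicator {0<..<t} s *\<^sub>R pairing F (G' s j) e)"
      unfolding G(3)[OF that] G'(3)[OF that] Bochner_Integration.integral_add[OF G(2)[OF that] G'(2)[OF that]] by simp
    also have "\<dots> = - (LINT s|lebesgue. indicator {0<..<t} s *\<^sub>R pairing F (H s j) e)"
      using integral_cong_AE[OF borel_measurable_integrable[OF int[OF that]] borel_measurable_integrable[OF H3[OF that]] H2[OF that]]
      by (simp only:)
    finally show ?thesis .
  qed
  show ?thesis unfolding is_bilinear_iff using vfield_vadd[OF w w'] H1 H3 H4 by blast
qed

lemma is_bilinear_add_left:
  "is_bilinear F u v t w \<Longrightarrow> is_bilinear F u' v t w' \<Longrightarrow> is_bilinear F (\<lambda>s. vadd (u s) (u' s)) v t (vadd w w')"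
  by (rule is_bilinear_add) (auto intro: div_heat_leray_tensor_add_left)

lemma is_bilinear_add_right:
  "is_bilinear F u v t w \<Longrightarrow> is_bilinear F u v' t w' \<Longrightarrow> is_bilinear F u (\<lambda>s. vadd (v s) (v' s)) t (vadd w w')"
  by (rule is_bilinear_add) (auto intro: div_heat_leray_tensor_add_right)

text \<open>The weak integral is estimated pairing by pairing; the integrable majorant
  \<open>M\<close> replaces the norm of the integrand, about whose measurability nothing is known.
  Each component is bounded by the whole integral, and summing the components gives the factor
  n.\<close>

lemma is_bilinear_bound:
  assumes B: "is_bilinear F a b t w"
    and M: "integrable lebesgue (\<lambda>s. indicator {0<..<t} s * M s)" "\<And>s. s \<in> {0<..<t} \<Longrightarrow> 0 \<le> M s"
    and D: "\<And>s. s \<in> {0<..<t} \<Longrightarrow> \<exists>D. div_heat_leray_tensor (t - s) (a s) (b s) D \<and> vfield_in (dual F) D \<and> vnorm (dual F) D \<le> M s"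
  shows "vnorm (dual F) w \<le> real CARD('n) * (LINT s|lebesgue. indicator {0<..<t} s * M s)"
proof -
  obtain G where w: "vfield_in (dual F) w"
    and G: "AE s in lebesgue. s \<in> {0<..<t} \<longrightarrow> div_heat_leray_tensor (t - s) (a s) (b s) (G s) \<and> vfield_in (dual F) (G s)"
      "\<And>j e. e \<in> points F \<Longrightarrow> integrable lebesgue (\<lambda>s. indicator {0<..<t} s *\<^sub>R pairing F (G s j) e)"
      "\<And>j e. e \<in> points F \<Longrightarrow> pairing F (w j) e = - (LINT s|lebesgue. indicator {0<..<t} s *\<^sub>R pairing F (G s j) e)"
    using B unfolding is_bilinear_iff by blast
  have nn: "0 \<le> indicator {0<..<t} s * M s" for s using M(2)[of s] by (cases "s \<in> {0<..<t}") auto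
  have comp: "nrm (dual F) (w j) \<le> (LINT s|lebesgue. indicator {0<..<t} s * M s)" for j
  proof (rule nrm_dual_le)
    show "0 \<le> (LINT s|lebesgue. indicator {0<..<t} s * M s)" by (rule integral_nonneg_AE) (simp add: nn)
    fix e assume e: "e \<in> points F"
    have "cmod (pairing F (w j) e) \<le> (LINT s|lebesgue. norm (indicator {0<..<t} s *\<^sub>R pairing F (G s j) e))"
      unfolding G(3)[OF e] norm_minus_cancel by (rule integral_norm_bound)
    also have "\<dots> \<le> (LINT s|lebesgue. (indicator {0<..<t} s * M s) * nrm F e)"
    proof (rule integral_mono_AE)
      show "integrable lebesgue (\<lambda>s. norm (indicator {0<..<t} s *\<^sub>R pairing F (G s j) e))"
        by (rule integrable_norm[OF G(2)[OF e]])
      show "integrable lebesgue (\<lambda>s. (indicator {0<..<t} s * M s) * nrm F e)"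
        using M(1) by (rule integrable_mult_left)
      show "AE s in lebesgue. norm (indicator {0<..<t} s *\<^sub>R pairing F (G s j) e) \<le> (indicator {0<..<t} s * M s) * nrm F e"
        using G(1)
      proof eventually_elim
        case (elim s)
        show ?case
        proof (cases "s \<in> {0<..<t}")
          case True
          obtain D where D: "div_heat_leray_tensor (t - s) (a s) (b s) D" "vfield_in (dual F) D" "vnorm (dual F) D \<le> M s"
            using assms(4)[OF True] by blast
          have "G s = D" using elim True D(1) div_heat_leray_tensor_unique by blast
          then have "cmod (pairing F (G s j) e) \<le> nrm (dual F) (D j) * nrm F e"
            using pairing_bound[OF _ e, of "D j"] D(2) by (simp add: vfield_in_def)
          also have "\<dots> \<le> M s * nrm F e"
            using nrm_le_vnorm[OF D(2), of j] D(3) nrm_nonneg[OF e] by (intro mult_right_mono) auto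
          finally show ?thesis using True by simp
        qed simp
      qed
    qed
    also have "\<dots> = (LINT s|lebesgue. indicator {0<..<t} s * M s) * nrm F e" by (rule integral_mult_left_zero)
    finally show "cmod (pairing F (w j) e) \<le> (LINT s|lebesgue. indicator {0<..<t} s * M s) * nrm F e" .
  qed
  have "vnorm (dual F) w \<le> (\<Sum>j\<in>(UNIV::'n set). (LINT s|lebesgue. indicator {0<..<t} s * M s))"
    unfolding vnorm_def by (intro sum_mono comp)
  then show ?thesis by simp
qed

text \<open>On Schwartz functions the pairings of both spaces are evaluation of the same
  distribution. A uniform bound in the second dual thus bounds the integral on Schwartz functions by
  t N times the norm, and extension by density does the rest.\<close>

lemma is_bilinear_in_dual:
  assumes F': "dense_space F'" and B: "is_bilinear F a b t w" and t: "t > 0" and N: "N \<ge> 0"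
    and D: "\<And>s. s \<in> {0<..<t} \<Longrightarrow> \<exists>D. div_heat_leray_tensor (t - s) (a s) (b s) D \<and>
        vfield_in (dual F) D \<and> vfield_in (dual F') D \<and> vnorm (dual F') D \<le> N"
  shows "vfield_in (dual F') w"
  unfolding vfield_in_def
proof
  fix j
  interpret F': dense_space F' by (rule F')
  obtain G where w: "vfield_in (dual F) w"
    and G: "AE s in lebesgue. s \<in> {0<..<t} \<longrightarrow> div_heat_leray_tensor (t - s) (a s) (b s) (G s) \<and> vfield_in (dual F) (G s)"
      "\<And>j e. e \<in> points F \<Longrightarrow> integrable lebesgue (\<lambda>s. indicator {0<..<t} s *\<^sub>R pairing F (G s j) e)"
      "\<And>j e. e \<in> points F \<Longrightarrow> pairing F (w j) e = - (LINT s|lebesgue. indicator {0<..<t} s *\<^sub>R pairing F (G s j) e)"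
    using B unfolding is_bilinear_iff by blast
  have wj: "w j \<in> points (dual F)" using w by (simp add: vfield_in_def)
  show "w j \<in> points (dual F')"
  proof (rule F'.dual_extension[OF dual_tempered[OF wj]])
    show "0 \<le> t * N" using t N by simp
    fix \<phi> :: "real^'n \<Rightarrow> complex" assume \<phi>: "schwartz \<phi>"
    let ?e = "dist_of_schwartz \<phi>"
    have e: "?e \<in> points F" by (rule schwartz_points[OF \<phi>])
    have nn: "0 \<le> nrm F' ?e" by (rule F'.nrm_nonneg[OF F'.schwartz_points[OF \<phi>]])
    have ci: "integrable lebesgue (\<lambda>s. indicator {0<..<t} s * (N * nrm F' ?e) :: real)"
      using t by (intro integrable_mult_left integrable_real_indicator) simp_all
    have "cmod (w j \<phi>) = cmod (pairing F (w j) ?e)" by (simp add: pairing_schwartz wj \<phi>)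
    also have "\<dots> \<le> (LINT s|lebesgue. norm (indicator {0<..<t} s *\<^sub>R pairing F (G s j) ?e))"
      unfolding G(3)[OF e] norm_minus_cancel by (rule integral_norm_bound)
    also have "\<dots> \<le> (LINT s|lebesgue. indicator {0<..<t} s * (N * nrm F' ?e))"
    proof (rule integral_mono_AE[OF integrable_norm[OF G(2)[OF e]] ci])
      show "AE s in lebesgue. norm (indicator {0<..<t} s *\<^sub>R pairing F (G s j) ?e) \<le> indicator {0<..<t} s * (N * nrm F' ?e)"
        using G(1)
      proof eventually_elim
        case (elim s)
        show ?case
        proof (cases "s \<in> {0<..<t}")
          case True
          obtain D where D: "div_heat_leray_tensor (t - s) (a s) (b s) D" "vfield_in (dual F) D"
              "vfield_in (dual F') D" "vnorm (dual F') D \<le> N"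
            using assms(5)[OF True] by blast
          have GD: "G s = D" using elim True D(1) div_heat_leray_tensor_unique by blast
          have "cmod (pairing F (G s j) ?e) = cmod (D j \<phi>)"
            unfolding GD using D(2) \<phi> by (simp add: pairing_schwartz vfield_in_def)
          also have "\<dots> \<le> nrm (dual F') (D j) * nrm F' ?e"
            using D(3) \<phi> by (intro F'.dual_apply_bound) (simp_all add: vfield_in_def)
          also have "\<dots> \<le> N * nrm F' ?e"
            using F'.nrm_le_vnorm[OF D(3), of j] D(4) nn by (intro mult_right_mono) auto
          finally show ?thesis using True by simp
        qed simp
      qed
    qed
    also have "\<dots> = t * N * nrm F' ?e" using t by simp
    finally show "cmod (w j \<phi>) \<le> t * N * nrm F' ?e" .
  qed
qed

text \<open>The interval of integration is empty, so all pairings vanish.\<close>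

lemma is_bilinear_zero_time:
  assumes "is_bilinear F u v 0 w" shows "w = vzero"
proof
  fix j
  have "vfield_in (dual F) w" and p: "\<And>e. e \<in> points F \<Longrightarrow> pairing F (w j) e = 0"
    using assms unfolding is_bilinear_iff by auto
  then have wj: "w j \<in> points (dual F)" by (simp add: vfield_in_def)
  have "nrm (dual F) (w j) \<le> 0" by (rule nrm_dual_le) (simp_all add: p)
  then show "w j = vzero j" using nrm_dual_eq_0[OF wj] by (simp add: vzero_def)
qed

end

section \<open>Regulated functions of time\<close>

context dense_space
begin

text \<open>A class of bounded functions, stable under differences and truncation, for which strong
  measurability is evident.\<close>

definition regulated :: "real \<Rightarrow> (real \<Rightarrow> 'n \<Rightarrow> 'n dist) \<Rightarrow> bool" where
  "regulated t a \<longleftrightarrow> (\<forall>s\<in>{0<..<t}. vfield_in (dual F) (a s)) \<and>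
     (\<forall>\<epsilon>>0. \<exists>f. simple_function lebesgue f \<and> (\<forall>s. vfield_in (dual F) (f s)) \<and>
        (\<forall>s\<in>{0<..<t}. vnorm (dual F) (vdiff (a s) (f s)) < \<epsilon>))"

lemma regulatedE:
  assumes "regulated t a" "\<epsilon> > 0"
  obtains f where "simple_function lebesgue f" "\<And>s. vfield_in (dual F) (f s)"
    "\<And>s. s \<in> {0<..<t} \<Longrightarrow> vnorm (dual F) (vdiff (a s) (f s)) < \<epsilon>"
proof -
  have "\<exists>f. simple_function lebesgue f \<and> (\<forall>s. vfield_in (dual F) (f s)) \<and>
        (\<forall>s\<in>{0<..<t}. vnorm (dual F) (vdiff (a s) (f s)) < \<epsilon>)"
    using assms by (simp add: regulated_def)
  then show ?thesis using that by (elim exE conjE) simp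
qed

lemma regulated_vfield: "regulated t a \<Longrightarrow> s \<in> {0<..<t} \<Longrightarrow> vfield_in (dual F) (a s)"
  by (simp add: regulated_def)

lemma regulated_simple:
  "simple_function lebesgue f \<Longrightarrow> (\<And>s. vfield_in (dual F) (f s)) \<Longrightarrow> regulated t f"
  unfolding regulated_def
  by (intro conjI ballI allI impI exI[of _ f]) (simp_all add: vdiff_algebra vnorm_vzero)

lemma regulated_vdiff:
  assumes a: "regulated t a" and b: "regulated t b"
  shows "regulated t (\<lambda>s. vdiff (a s) (b s))"
  unfolding regulated_def
proof (intro conjI ballI allI impI)
  show "vfield_in (dual F) (vdiff (a s) (b s))" if "s \<in> {0<..<t}" for s
    by (intro vfield_vdiff regulated_vfield[OF a that] regulated_vfield[OF b that])
  fix \<epsilon> :: real assume "\<epsilon> > 0"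
  then have e: "\<epsilon> / 2 > 0" by simp
  obtain f where f: "simple_function lebesgue f" "\<And>s. vfield_in (dual F) (f s)"
    "\<And>s. s \<in> {0<..<t} \<Longrightarrow> vnorm (dual F) (vdiff (a s) (f s)) < \<epsilon> / 2"
    using regulatedE[OF a e] by blast
  obtain g where g: "simple_function lebesgue g" "\<And>s. vfield_in (dual F) (g s)"
    "\<And>s. s \<in> {0<..<t} \<Longrightarrow> vnorm (dual F) (vdiff (b s) (g s)) < \<epsilon> / 2"
    using regulatedE[OF b e] by blast
  show "\<exists>h. simple_function lebesgue h \<and> (\<forall>s. vfield_in (dual F) (h s)) \<and>
      (\<forall>s\<in>{0<..<t}. vnorm (dual F) (vdiff (vdiff (a s) (b s)) (h s)) < \<epsilon>)"
  proof (intro exI[of _ "\<lambda>s. vdiff (f s) (g s)"] conjI allI ballI)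
    show "simple_function lebesgue (\<lambda>s. vdiff (f s) (g s))"
      by (rule simple_function_compose2[OF f(1) g(1)])
    show "vfield_in (dual F) (vdiff (f s) (g s))" for s by (intro vfield_vdiff f g)
    fix s assume s: "s \<in> {0<..<t}"
    have "vdiff (vdiff (a s) (b s)) (vdiff (f s) (g s)) = vdiff (vdiff (a s) (f s)) (vdiff (b s) (g s))"
      by (simp add: vdiff_def dist_diff_def fun_eq_iff)
    then show "vnorm (dual F) (vdiff (vdiff (a s) (b s)) (vdiff (f s) (g s))) < \<epsilon>"
      using vnorm_vdiff[OF vfield_vdiff[OF regulated_vfield[OF a s] f(2)] vfield_vdiff[OF regulated_vfield[OF b s] g(2)], of s s]
        f(3)[OF s] g(3)[OF s] by simp
  qed
qed

lemma regulated_truncate: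
  assumes a: "regulated t a" and A: "A \<in> sets lebesgue"
  shows "regulated t (\<lambda>s. if s \<in> A then a s else vzero)"
  unfolding regulated_def
proof (intro conjI ballI allI impI)
  show "vfield_in (dual F) (if s \<in> A then a s else vzero)" if "s \<in> {0<..<t}" for s
    using regulated_vfield[OF a that] by (simp add: vfield_vzero)
  fix \<epsilon> :: real assume e: "\<epsilon> > 0"
  obtain f where f: "simple_function lebesgue f" "\<And>s. vfield_in (dual F) (f s)"
    "\<And>s. s \<in> {0<..<t} \<Longrightarrow> vnorm (dual F) (vdiff (a s) (f s)) < \<epsilon>"
    using regulatedE[OF a e] by blast
  show "\<exists>h. simple_function lebesgue h \<and> (\<forall>s. vfield_in (dual F) (h s)) \<and>
      (\<forall>s\<in>{0<..<t}. vnorm (dual F) (vdiff (if s \<in> A then a s else vzero) (h s)) < \<epsilon>)"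
  proof (intro exI[of _ "\<lambda>s. if s \<in> A then f s else vzero"] conjI allI ballI)
    show "simple_function lebesgue (\<lambda>s. if s \<in> A then f s else vzero)"
      by (intro simple_function_If_set f) (use A in simp_all)
    show "vfield_in (dual F) (if s \<in> A then f s else vzero)" for s by (simp add: f vfield_vzero)
    show "vnorm (dual F) (vdiff (if s \<in> A then a s else vzero) (if s \<in> A then f s else vzero)) < \<epsilon>"
      if "s \<in> {0<..<t}" for s using f(3)[OF that] e by (simp add: vdiff_algebra vnorm_vzero)
  qed
qed

lemma simple_function_bounded:
  fixes h :: "'b \<Rightarrow> real"
  assumes "simple_function M f"
  obtains B where "B \<ge> 0" "\<And>s. s \<in> space M \<Longrightarrow> h (f s) \<le> B"
proof -
  have fin: "finite ((\<lambda>s. h (f s)) ` space M)"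
    using finite_imageI[OF simple_functionD(1)[OF assms], of h] by (simp add: image_image)
  show ?thesis
  proof (rule that[of "Max (insert 0 ((\<lambda>s. h (f s)) ` space M))"])
    show "0 \<le> Max (insert 0 ((\<lambda>s. h (f s)) ` space M))" using fin by (intro Max_ge) auto
    show "h (f s) \<le> Max (insert 0 ((\<lambda>s. h (f s)) ` space M))" if "s \<in> space M" for s
      using fin that by (intro Max_ge) auto
  qed
qed

lemma regulated_bounded:
  assumes a: "regulated t a"
  obtains B where "B \<ge> 0" "\<And>s. s \<in> {0<..<t} \<Longrightarrow> vnorm (dual F) (a s) \<le> B"
proof -
  obtain f where f: "simple_function lebesgue f" "\<And>s. vfield_in (dual F) (f s)"
    "\<And>s. s \<in> {0<..<t} \<Longrightarrow> vnorm (dual F) (vdiff (a s) (f s)) < 1"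
    using regulatedE[OF a zero_less_one] by blast
  obtain B where B: "B \<ge> 0" "\<And>s. s \<in> space lebesgue \<Longrightarrow> vnorm (dual F) (f s) \<le> B"
    using simple_function_bounded[OF f(1), of "vnorm (dual F)"] by blast
  show ?thesis
  proof (rule that[of "1 + B"])
    fix s assume s: "s \<in> {0<..<t}"
    have "vnorm (dual F) (vadd (f s) (vdiff (a s) (f s))) \<le> vnorm (dual F) (f s) + vnorm (dual F) (vdiff (a s) (f s))"
      by (intro vnorm_vadd vfield_vdiff f regulated_vfield[OF a s])
    moreover have "vnorm (dual F) (f s) \<le> B" by (rule B) simp
    ultimately show "vnorm (dual F) (a s) \<le> 1 + B" using f(3)[OF s] by (simp add: vdiff_algebra)
  qed (use B in simp)
qed

text \<open>Step functions within 1/(k+1) of \<open>a\<close>, set to zero off the interval,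
  converge at every time and witness strong measurability. The extension by zero leaves the suprema
  controlled by the bound on (0,t).\<close>

lemma regulated_Linfty:
  assumes a: "regulated t a"
    and A: "A \<ge> 0" "\<And>s. s \<in> {0<..<t} \<Longrightarrow> vnorm (dual F) (a s) \<le> A"
  defines "ta \<equiv> \<lambda>s. if s \<in> {0<..<t} then a s else vzero"
  shows "Linfty {0<..} (dual F) ta"
    and "(SUP s\<in>{0<..}. vnorm (dual F) (ta s)) \<le> A" and "0 \<le> (SUP s\<in>{0<..}. vnorm (dual F) (ta s))"
proof -
  have ta: "vfield_in (dual F) (ta s)" for s
    using regulated_vfield[OF a] by (simp add: ta_def vfield_vzero)
  have le: "vnorm (dual F) (ta s) \<le> A" for s using A by (simp add: ta_def vnorm_vzero)
  have bdd: "bdd_above ((\<lambda>s. vnorm (dual F) (ta s)) ` {0<..})" by (rule bdd_aboveI2[of _ _ A]) (rule le)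
  show "(SUP s\<in>{0<..}. vnorm (dual F) (ta s)) \<le> A" by (rule cSUP_least) (auto simp: le)
  have "0 \<le> vnorm (dual F) (ta 1)" by (rule vnorm_nonneg[OF ta])
  also have "\<dots> \<le> (SUP s\<in>{0<..}. vnorm (dual F) (ta s))" by (rule cSUP_upper[OF _ bdd]) simp
  finally show "0 \<le> (SUP s\<in>{0<..}. vnorm (dual F) (ta s))" .
  have meas: "strongly_measurable_on {0<..} (dual F) (\<lambda>s. ta s j)" for j
  proof -
    have "\<forall>k::nat. \<exists>f. simple_function lebesgue f \<and> (\<forall>s. vfield_in (dual F) (f s)) \<and>
        (\<forall>s\<in>{0<..<t}. vnorm (dual F) (vdiff (a s) (f s)) < inverse (real (Suc k)))"
      using a unfolding regulated_def by simp
    from choice[OF this] obtain f where "\<forall>k. simple_function lebesgue (f k) \<and> (\<forall>s. vfield_in (dual F) (f k s)) \<and>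
        (\<forall>s\<in>{0<..<t}. vnorm (dual F) (vdiff (a s) (f k s)) < inverse (real (Suc k)))" by blast
    then have f: "\<And>k. simple_function lebesgue (f k)" "\<And>k s. vfield_in (dual F) (f k s)"
        "\<And>k s. s \<in> {0<..<t} \<Longrightarrow> vnorm (dual F) (vdiff (a s) (f k s)) < inverse (real (Suc k))"
      by blast+
    define g where "g k s = (if s \<in> {0<..<t} then f k s else vzero) j" for k s
    have gs: "simple_function lebesgue (g k)" for k
    proof -
      have "simple_function lebesgue (\<lambda>s. if s \<in> {0<..<t} then f k s else vzero)"
        by (intro simple_function_If_set f) simp_all
      from simple_function_compose1[OF this, of "\<lambda>x. x j"] show ?thesis by (simp add: g_def[abs_def])
    qed
    have gI: "simple_function (lebesgue_on {0<..}) (g k)" for k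
    proof -
      have "finite (g k ` {0<..})"
        using simple_functionD(1)[OF gs[of k]] by (rule finite_subset[rotated]) auto
      moreover have "g k -` {x} \<inter> {0<..} \<in> sets (lebesgue_on {0<..})" for x
      proof -
        have "g k -` {x} \<inter> space lebesgue \<in> sets lebesgue" by (rule simple_functionD(2)[OF gs])
        moreover have "g k -` {x} \<inter> {0<..} = {0<..} \<inter> (g k -` {x} \<inter> space lebesgue)" by auto
        ultimately show ?thesis unfolding sets_restrict_space by (rule image_eqI[rotated])
      qed
      ultimately show ?thesis by (simp add: simple_function_def space_restrict_space)
    qed
    have conv: "(\<lambda>k. nrm (dual F) (dist_diff (g k s) (ta s j))) \<longlonglongrightarrow> 0" for s
    proof (rule tendsto_sandwich[OF _ _ tendsto_const LIMSEQ_inverse_real_of_nat]; intro always_eventually allI)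
      fix k
      have gk: "g k s \<in> points (dual F)" using f(2) by (simp add: g_def vfield_in_def vzero_def dual_zero)
      have tj: "ta s j \<in> points (dual F)" using ta by (simp add: vfield_in_def)
      show "0 \<le> nrm (dual F) (dist_diff (g k s) (ta s j))" by (intro nrm_dual_nonneg dual_diff gk tj)
      show "nrm (dual F) (dist_diff (g k s) (ta s j)) \<le> inverse (real (Suc k))"
      proof (cases "s \<in> {0<..<t}")
        case True
        have "nrm (dual F) (dist_diff (g k s) (ta s j)) \<le> nrm (dual F) (dist_diff (ta s j) (g k s))"
          by (rule nrm_dual_diff_commute[OF gk tj])
        also have "dist_diff (ta s j) (g k s) = vdiff (a s) (f k s) j"
          using True by (simp add: g_def ta_def vdiff_def)
        also have "nrm (dual F) (vdiff (a s) (f k s) j) \<le> vnorm (dual F) (vdiff (a s) (f k s))"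
          by (intro nrm_le_vnorm vfield_vdiff f regulated_vfield[OF a True])
        finally show ?thesis using f(3)[OF True, of k] by simp
      next
        case False
        then have "dist_diff (g k s) (ta s j) = dist_zero"
          unfolding g_def ta_def by (simp only: if_False dist_diff_self)
        then show ?thesis by (simp add: nrm_dual_zero)
      qed
    qed
    show ?thesis unfolding strongly_measurable_on_def
    proof (intro exI[of _ g] conjI allI)
      show "simple_function (lebesgue_on {0<..}) (g k)" for k by (rule gI)
      show "g k ` {0<..} \<subseteq> points (dual F)" for k
        using f(2) by (auto simp: g_def vfield_in_def vzero_def dual_zero)
      show "AE s in lebesgue_on {0<..}. (\<lambda>k. nrm (dual F) (dist_diff (g k s) (ta s j))) \<longlonglongrightarrow> 0"
        by (rule AE_I2) (rule conv)
    qed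
  qed
  show "Linfty {0<..} (dual F) ta"
    unfolding Linfty_def using ta meas bdd by blast
qed

text \<open>The estimate is applied once with infinite time horizon to the extensions by zero. The
  bilinear term at time t only sees times in (0,t), so the bound involves the suprema over (0,t)
  alone.\<close>

lemma regulated_bilinear:
  assumes K: "K > 0" and bil: "\<And>T u v. T > 0 \<Longrightarrow> Linfty (open_time_interval T) (dual F) u \<Longrightarrow>
        Linfty (open_time_interval T) (dual F) v \<Longrightarrow>
        (\<forall>t\<in>open_time_interval T. \<exists>w. is_bilinear F u v t w \<and>
           vnorm (dual F) w \<le> K * (SUP s\<in>open_time_interval T. vnorm (dual F) (u s))
                                * (SUP s\<in>open_time_interval T. vnorm (dual F) (v s)))"
    and t: "t > 0" and a: "regulated t a" and b: "regulated t b"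
    and A: "A \<ge> 0" "\<And>s. s \<in> {0<..<t} \<Longrightarrow> vnorm (dual F) (a s) \<le> A"
    and B: "B \<ge> 0" "\<And>s. s \<in> {0<..<t} \<Longrightarrow> vnorm (dual F) (b s) \<le> B"
  shows "\<exists>w. is_bilinear F a b t w \<and> vnorm (dual F) w \<le> K * A * B"
proof -
  let ?ta = "\<lambda>s. if s \<in> {0<..<t} then a s else vzero"
  let ?tb = "\<lambda>s. if s \<in> {0<..<t} then b s else vzero"
  have I: "open_time_interval \<infinity> = {0<..}" by (auto simp: open_time_interval_def)
  note LA = regulated_Linfty[OF a A] and LB = regulated_Linfty[OF b B]
  have "\<exists>w. is_bilinear F ?ta ?tb t w \<and> vnorm (dual F) w \<le>
      K * (SUP s\<in>{0<..}. vnorm (dual F) (?ta s)) * (SUP s\<in>{0<..}. vnorm (dual F) (?tb s))"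
    using bil[of \<infinity> ?ta ?tb] LA(1) LB(1) t unfolding I by simp
  then obtain w where w: "is_bilinear F ?ta ?tb t w" "vnorm (dual F) w \<le>
      K * (SUP s\<in>{0<..}. vnorm (dual F) (?ta s)) * (SUP s\<in>{0<..}. vnorm (dual F) (?tb s))" by blast
  have "is_bilinear F a b t w"
    using is_bilinear_cong[of t ?ta a ?tb b w] w(1) by simp
  moreover have "K * (SUP s\<in>{0<..}. vnorm (dual F) (?ta s)) * (SUP s\<in>{0<..}. vnorm (dual F) (?tb s)) \<le> K * A * B"
    using K A B LA(2,3) LB(2,3) by (intro mult_mono mult_left_mono) simp_all
  ultimately show ?thesis using w(2) by (intro exI[of _ w]) linarith
qed

text \<open>Compactness of [0,t] by bisection: near each time a constant element of \<open>P\<close>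
  works by continuity, and approximations on adjacent intervals can be glued. Taking
  \<open>P\<close> small forces the values of the step function into a prescribed set.\<close>

lemma step_approximation:
  fixes t :: real
  assumes t: "0 \<le> t" and u: "\<And>s. s \<in> {0..t} \<Longrightarrow> vfield_in (dual F) (u s)"
    and cont: "\<And>s. s \<in> {0..t} \<Longrightarrow> ((\<lambda>r. vnorm (dual F) (vdiff (u r) (u s))) \<longlongrightarrow> 0) (at s within {0..t})"
    and P: "\<And>g. g \<in> P \<Longrightarrow> vfield_in (dual F) g"
    and near: "\<And>s. s \<in> {0..t} \<Longrightarrow> \<exists>g\<in>P. vnorm (dual F) (vdiff (u s) g) < m"
  obtains f where "simple_function lebesgue f" "\<And>s. f s \<in> P"
    "\<And>s. s \<in> {0..<t} \<Longrightarrow> vnorm (dual F) (vdiff (u s) (f s)) < m"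
proof -
  \<comment> \<open>Half-open intervals overlap nowhere when concatenated; the final time t is
    thereby left out, which does not matter for integrals over (0,t).\<close>
  define Q where "Q a b \<longleftrightarrow> (\<exists>f. simple_function lebesgue f \<and> (\<forall>s. f s \<in> P) \<and>
      (\<forall>s\<in>{a..<b} \<inter> {0..t}. vnorm (dual F) (vdiff (u s) (f s)) < m))" for a b
  have "Q 0 t"
  proof (rule Bolzano[OF t])
    fix a b c assume "Q a b" "Q b c"
    obtain f where f: "simple_function lebesgue f" "\<And>s. f s \<in> P"
        "\<And>s. s \<in> {a..<b} \<inter> {0..t} \<Longrightarrow> vnorm (dual F) (vdiff (u s) (f s)) < m"
      using \<open>Q a b\<close> unfolding Q_def by blast
    obtain g where g: "simple_function lebesgue g" "\<And>s. g s \<in> P"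
        "\<And>s. s \<in> {b..<c} \<inter> {0..t} \<Longrightarrow> vnorm (dual F) (vdiff (u s) (g s)) < m"
      using \<open>Q b c\<close> unfolding Q_def by blast
    show "Q a c" unfolding Q_def
    proof (intro exI[of _ "\<lambda>s. if s \<in> {..<b} then f s else g s"] conjI allI ballI)
      show "simple_function lebesgue (\<lambda>s. if s \<in> {..<b} then f s else g s)"
        by (intro simple_function_If_set f g) simp
      show "(if s \<in> {..<b} then f s else g s) \<in> P" for s by (simp add: f(2) g(2))
      show "vnorm (dual F) (vdiff (u s) (if s \<in> {..<b} then f s else g s)) < m" if "s \<in> {a..<c} \<inter> {0..t}" for s
        using f(3)[of s] g(3)[of s] that by (cases "s < b") simp_all
    qed
  next
    fix x assume "0 \<le> x" "x \<le> t"
    then have x: "x \<in> {0..t}" by simp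
    obtain g where g: "g \<in> P" "vnorm (dual F) (vdiff (u x) g) < m" using near[OF x] by blast
    \<comment> \<open>The strict inequality at x leaves a positive slack, which continuity may use
      up.\<close>
    have "eventually (\<lambda>r. vnorm (dual F) (vdiff (u r) (u x)) < m - vnorm (dual F) (vdiff (u x) g)) (at x within {0..t})"
      using order_tendstoD(2)[OF cont[OF x]] g(2) by simp
    then obtain d where d: "d > 0" "\<And>r. r \<in> {0..t} \<Longrightarrow> r \<noteq> x \<Longrightarrow> dist r x < d \<Longrightarrow>
        vnorm (dual F) (vdiff (u r) (u x)) < m - vnorm (dual F) (vdiff (u x) g)"
      unfolding eventually_at by blast
    have close: "vnorm (dual F) (vdiff (u r) g) < m" if r: "r \<in> {0..t}" "dist r x < d" for r
    proof (cases "r = x")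
      case False
      have "vnorm (dual F) (vdiff (u r) g) \<le> vnorm (dual F) (vdiff (u r) (u x)) + vnorm (dual F) (vdiff (u x) g)"
        by (intro vnorm_vdiff_triangle u x r P g)
      with d(2)[OF r(1) False r(2)] show ?thesis by simp
    qed (use g in simp)
    show "\<exists>d>0. \<forall>a b. a \<le> x \<and> x \<le> b \<and> b - a < d \<longrightarrow> Q a b"
    proof (intro exI[of _ d] conjI allI impI d)
      fix a b assume ab: "a \<le> x \<and> x \<le> b \<and> b - a < d"
      show "Q a b" unfolding Q_def
      proof (intro exI[of _ "\<lambda>s. g"] conjI allI ballI g)
        fix s assume "s \<in> {a..<b} \<inter> {0..t}"
        then show "vnorm (dual F) (vdiff (u s) g) < m" using ab by (intro close) (auto simp: dist_real_def)
      qed simp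
    qed
  qed
  then obtain f where "simple_function lebesgue f" "\<And>s. f s \<in> P"
      "\<And>s. s \<in> {0..<t} \<inter> {0..t} \<Longrightarrow> vnorm (dual F) (vdiff (u s) (f s)) < m"
    unfolding Q_def by blast
  then show ?thesis by (intro that[of f]) auto
qed

end

lemma (in dense_space) regulated_continuous:
  assumes t: "0 \<le> t" and u: "\<And>s. s \<in> {0..t} \<Longrightarrow> vfield_in (dual F) (u s)"
    and cont: "\<And>s. s \<in> {0..t} \<Longrightarrow> ((\<lambda>r. vnorm (dual F) (vdiff (u r) (u s))) \<longlongrightarrow> 0) (at s within {0..t})"
  shows "regulated t u"
  unfolding regulated_def
proof (intro conjI ballI allI impI)
  show "vfield_in (dual F) (u s)" if "s \<in> {0<..<t}" for s using u that by simp
  fix \<epsilon> :: real assume \<epsilon>: "\<epsilon> > 0"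
  obtain f where f: "simple_function lebesgue f" "\<And>s. f s \<in> {g. vfield_in (dual F) g}"
      "\<And>s. s \<in> {0..<t} \<Longrightarrow> vnorm (dual F) (vdiff (u s) (f s)) < \<epsilon>"
  proof (rule step_approximation[OF t u cont, where P = "{g. vfield_in (dual F) g}" and m = \<epsilon>])
    show "\<exists>g\<in>{g. vfield_in (dual F) g}. vnorm (dual F) (vdiff (u s) g) < \<epsilon>" if "s \<in> {0..t}" for s
      using u[OF that] \<epsilon> by (intro bexI[of _ "u s"]) (simp_all add: vdiff_algebra vnorm_vzero)
  qed simp_all
  show "\<exists>f. simple_function lebesgue f \<and> (\<forall>s. vfield_in (dual F) (f s)) \<and> (\<forall>s\<in>{0<..<t}. vnorm (dual F) (vdiff (u s) (f s)) < \<epsilon>)"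
    using f by (intro exI[of _ f]) simp
qed

text \<open>Solves c r^p < \<epsilon> for r; the shift to c + 1 keeps the quotient defined when c =
  0.\<close>

lemma small_powr:
  fixes c p \<epsilon> t :: real
  assumes "c \<ge> 0" "p > 0" "\<epsilon> > 0" "t > 0"
  obtains \<delta> where "\<delta> > 0" "\<delta> < t" "\<And>r. 0 \<le> r \<Longrightarrow> r \<le> \<delta> \<Longrightarrow> c * r powr p < \<epsilon>"
proof -
  define q where "q = (\<epsilon> / (c + 1)) powr (1 / p)"
  have e: "\<epsilon> / (c + 1) > 0" using assms by simp
  have q: "q > 0" unfolding q_def powr_gt_zero using e by linarith
  have "c * r powr p < \<epsilon>" if "0 \<le> r" "r \<le> min q (t / 2)" for r
  proof -
    have "r powr p \<le> q powr p" using that assms by (intro powr_mono2) auto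
    also have "q powr p = \<epsilon> / (c + 1)" using assms e by (auto simp: q_def powr_powr)
    finally have "c * r powr p \<le> c * (\<epsilon> / (c + 1))" using assms by (intro mult_left_mono)
    also have "\<dots> < \<epsilon>" using assms by (simp add: field_simps)
    finally show ?thesis .
  qed
  then show ?thesis using q assms by (intro that[of "min q (t / 2)"]) auto
qed

text \<open>A barrier argument: \<open>d\<close> starts at \<open>0\<close> and cannot first reach a level below \<open>1 / K\<close>.\<close>

lemma quadratic_barrier:
  fixes d :: "real \<Rightarrow> real"
  assumes cont: "continuous_on {0..t1} d" and d0: "d 0 = 0" and K: "K > 0"
    and nn: "\<And>s. s \<in> {0..t1} \<Longrightarrow> 0 \<le> d s"
    and step: "\<And>t m. t \<in> {0<..t1} \<Longrightarrow> 0 \<le> m \<Longrightarrow> (\<And>s. s \<in> {0..t} \<Longrightarrow> d s \<le> m) \<Longrightarrow> d t \<le> K * m\<^sup>2"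
    and t2: "t2 \<in> {0..t1}"
  shows "d t2 = 0"
proof (rule ccontr)
  assume "d t2 \<noteq> 0"
  then have pos: "d t2 > 0" using nn[OF t2] by simp
  \<comment> \<open>At a first time with d = c, the step estimate would give c \<le> K c^2 \<le>
    c/2, since K c \<le> 1/2. Taking c at most d(t2) makes the intermediate value theorem reach the
    level c.\<close>
  define c where "c = min (d t2) (1 / (2 * K))"
  have c: "c > 0" "c \<le> d t2" "K * c \<le> 1 / 2" using pos K by (auto simp: c_def min_def field_simps)
  have c02: "continuous_on {0..t2} d" using cont t2 by (auto intro: continuous_on_subset)
  define S where "S = {0..t2} \<inter> d -` {c}"
  obtain s0 where s0: "0 \<le> s0" "s0 \<le> t2" "d s0 = c"
    using IVT'[of d 0 c t2] c02 d0 c t2 by auto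
  have Sne: "S \<noteq> {}" using s0 by (auto simp: S_def)
  have "closed S" unfolding S_def by (rule continuous_closed_preimage[OF c02]) simp_all
  moreover have bb: "bdd_below S" by (rule bdd_belowI[of _ 0]) (auto simp: S_def)
  ultimately have tS: "Inf S \<in> S" using Sne closed_contains_Inf by blast
  define t where "t = Inf S"
  have t: "0 \<le> t" "t \<le> t2" "d t = c" using tS by (auto simp: S_def t_def)
  have t0: "t > 0" using t d0 c(1) by (cases "t = 0") auto
  \<comment> \<open>A value above c before the first hitting time would, by the intermediate value
    theorem, force an earlier hit.\<close>
  have below: "d s \<le> c" if s: "s \<in> {0..t}" for s
  proof (rule ccontr)
    assume "\<not> d s \<le> c"
    then obtain r where r: "0 \<le> r" "r \<le> s" "d r = c"
      using IVT'[of d 0 c s] continuous_on_subset[OF c02, of "{0..s}"] d0 c s t by auto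
    have "t \<le> r" unfolding t_def by (rule cInf_lower[OF _ bb]) (use r s t in \<open>auto simp: S_def\<close>)
    then have "r = s" "s = t" using r s by auto
    then show False using \<open>\<not> d s \<le> c\<close> t by simp
  qed
  have "c \<le> K * c\<^sup>2" using step[of t c] t t0 t2 below c by auto
  also have "\<dots> = (K * c) * c" by (simp add: power2_eq_square)
  also have "\<dots> \<le> (1 / 2) * c" using c by (intro mult_right_mono) auto
  finally show False using c by simp
qed

section \<open>Uniqueness\<close>

text \<open>\<open>flip\<close> exchanges the factors, so that the field \<open>f\<close> bounded in \<open>E\<^sub>3'\<close> may stand on either side.\<close>

definition tensor_of :: "bool \<Rightarrow> real \<Rightarrow> ('n \<Rightarrow> 'n::finite dist) \<Rightarrow> ('n \<Rightarrow> 'n dist) \<Rightarrow> ('n \<Rightarrow> 'n dist) \<Rightarrow> bool" where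
  "tensor_of flip s a f D = (if flip then div_heat_leray_tensor s f a D else div_heat_leray_tensor s a f D)"

definition bilinear_of :: "('n::finite) dist_space \<Rightarrow> bool \<Rightarrow> (real \<Rightarrow> 'n \<Rightarrow> 'n dist) \<Rightarrow> (real \<Rightarrow> 'n \<Rightarrow> 'n dist) \<Rightarrow>
     real \<Rightarrow> ('n \<Rightarrow> 'n dist) \<Rightarrow> bool" where
  "bilinear_of E flip a f t w = (if flip then is_bilinear E f a t w else is_bilinear E a f t w)"

text \<open>What the uniqueness argument uses of the hypotheses: the bilinear bound, the smoothing
  from \<open>E'\<close> to \<open>E3'\<close> with some rate \<gamma>, and the combination of (U4)
  and (U5) into one estimate with integrable kernel. The sign of \<gamma> is immaterial, since
  smoothing is applied only at times bounded away from 0.\<close>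

locale critical_setting =
  E: dense_space E + E3: dense_space E3 for E E3 :: "('n::finite) dist_space" +
  fixes K Cp \<beta> C3 \<gamma> :: real
  assumes K: "K > 0"
    and bil: "\<And>T u v. T > 0 \<Longrightarrow> Linfty (open_time_interval T) (dual E) u \<Longrightarrow>
        Linfty (open_time_interval T) (dual E) v \<Longrightarrow>
        (\<forall>t\<in>open_time_interval T. \<exists>w. is_bilinear E u v t w \<and>
           vnorm (dual E) w \<le> K * (SUP s\<in>open_time_interval T. vnorm (dual E) (u s))
                                * (SUP s\<in>open_time_interval T. vnorm (dual E) (v s)))"
    and Cp: "Cp \<ge> 0" and \<beta>: "\<beta> > -1" and C3: "C3 > 0"
    and heat3: "\<And>s f. s > 0 \<Longrightarrow> f \<in> points (dual E) \<Longrightarrow>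
        heat s f \<in> points (dual E3) \<and> nrm (dual E3) (heat s f) \<le> C3 * s powr \<gamma> * nrm (dual E) f"
    and product: "\<And>flip s a f. s > 0 \<Longrightarrow> vfield_in (dual E) a \<Longrightarrow> vfield_in (dual E3) f \<Longrightarrow>
        \<exists>D. tensor_of flip s a f D \<and> vfield_in (dual E) D \<and>
          vnorm (dual E) D \<le> Cp * s powr \<beta> * vnorm (dual E) a * vnorm (dual E3) f"
begin

definition Y :: "('n \<Rightarrow> 'n dist) set" where
  "Y = {g. vfield_in (dual E) g \<and> vfield_in (dual E3) g}"

lemma Y_vadd: "f \<in> Y \<Longrightarrow> g \<in> Y \<Longrightarrow> vadd f g \<in> Y"
  by (simp add: Y_def E.vfield_vadd E3.vfield_vadd)

lemma bilinear_exists: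
  assumes "t > 0" "E.regulated t a" "E.regulated t b"
    and "A \<ge> 0" "\<And>s. s \<in> {0<..<t} \<Longrightarrow> vnorm (dual E) (a s) \<le> A"
    and "B \<ge> 0" "\<And>s. s \<in> {0<..<t} \<Longrightarrow> vnorm (dual E) (b s) \<le> B"
  obtains w where "is_bilinear E a b t w" "vnorm (dual E) w \<le> K * A * B" "vfield_in (dual E) w"
  using E.regulated_bilinear[OF K bil assms] is_bilinear_def by blast

lemma bilinear_of_exists:
  assumes "t > 0" "E.regulated t a" "E.regulated t f"
  obtains w where "bilinear_of E flip a f t w" "vfield_in (dual E) w"
proof -
  obtain A where A: "A \<ge> 0" "\<And>s. s \<in> {0<..<t} \<Longrightarrow> vnorm (dual E) (a s) \<le> A"
    using E.regulated_bounded[OF assms(2)] by blast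
  obtain B where B: "B \<ge> 0" "\<And>s. s \<in> {0<..<t} \<Longrightarrow> vnorm (dual E) (f s) \<le> B"
    using E.regulated_bounded[OF assms(3)] by blast
  show ?thesis
  proof (cases flip)
    case True
    obtain w where "is_bilinear E f a t w" "vfield_in (dual E) w"
      using bilinear_exists[OF assms(1,3,2) B A] by blast
    then show ?thesis using that[of w] True by (simp add: bilinear_of_def)
  next
    case False
    obtain w where "is_bilinear E a f t w" "vfield_in (dual E) w"
      using bilinear_exists[OF assms A B] by blast
    then show ?thesis using that[of w] False by (simp add: bilinear_of_def)
  qed
qed

lemma tensor_of_unique: "tensor_of flip s a f D \<Longrightarrow> tensor_of flip s a f D' \<Longrightarrow> D = D'"
  by (cases flip) (simp_all add: tensor_of_def div_heat_leray_tensor_unique)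

lemma tensor_of_heat: "tensor_of flip s a f D \<Longrightarrow> r > 0 \<Longrightarrow> tensor_of flip (s + r) a f (\<lambda>j. heat r (D j))"
  by (cases flip) (simp_all add: tensor_of_def div_heat_leray_tensor_heat)

text \<open>The kernel integrates to (t - c)^(\<beta>+1)/(\<beta>+1) over (c,t). Allowing
  \<open>a\<close> to vanish up to time c serves two ends: c = t - \<delta> isolates the times close
  to t, and in the uniqueness step c is the time up to which the solutions already coincide.\<close>

lemma bilinear_of_bound:
  assumes B: "bilinear_of E flip a f t w" and c: "0 \<le> c" "c \<le> t"
    and a: "\<And>s. s \<in> {0<..<t} \<Longrightarrow> vfield_in (dual E) (a s)"
    and a0: "\<And>s. s \<in> {0<..<t} \<Longrightarrow> s \<le> c \<Longrightarrow> a s = vzero"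
    and A: "A \<ge> 0" "\<And>s. s \<in> {0<..<t} \<Longrightarrow> vnorm (dual E) (a s) \<le> A"
    and f: "\<And>s. f s \<in> Y" and F3: "F3 \<ge> 0" "\<And>s. vnorm (dual E3) (f s) \<le> F3"
  shows "vnorm (dual E) w \<le> real CARD('n) * Cp * F3 / (\<beta> + 1) * A * (t - c) powr (\<beta> + 1)"
proof -
  define M where "M s = indicator {c<..<t} s * (t - s) powr \<beta> * (Cp * A * F3)" for s
  have ind: "indicator {0<..<t} s * M s = indicator {c<..<t} s * (t - s) powr \<beta> * (Cp * A * F3)" for s
    using c by (auto simp: M_def indicator_def)
  have int: "integrable lebesgue (\<lambda>s. indicator {0<..<t} s * M s)"
    unfolding ind by (intro integrable_mult_left powr_kernel_integrable \<beta> c)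
  have M0: "0 \<le> M s" for s using Cp A F3 by (simp add: M_def)
  have D: "\<exists>D. tensor_of flip (t - s) (a s) (f s) D \<and> vfield_in (dual E) D \<and> vnorm (dual E) D \<le> M s"
    if s: "s \<in> {0<..<t}" for s
  proof -
    have ts: "t - s > 0" using s by simp
    obtain D where D: "tensor_of flip (t - s) (a s) (f s) D" "vfield_in (dual E) D"
        "vnorm (dual E) D \<le> Cp * (t - s) powr \<beta> * vnorm (dual E) (a s) * vnorm (dual E3) (f s)"
      using product[OF ts a[OF s], of "f s" flip] f[of s] by (auto simp: Y_def)
    have "Cp * (t - s) powr \<beta> * vnorm (dual E) (a s) * vnorm (dual E3) (f s) \<le> M s"
    proof (cases "s \<le> c")
      case True
      then show ?thesis using a0[OF s] M0[of s] by (simp add: E.vnorm_vzero)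
    next
      case False
      have "Cp * (t - s) powr \<beta> * vnorm (dual E) (a s) * vnorm (dual E3) (f s) \<le> Cp * (t - s) powr \<beta> * A * F3"
        using Cp A F3 s f[of s] E3.vnorm_nonneg[of "f s"]
        by (intro mult_mono mult_left_mono) (simp_all add: Y_def)
      also have "\<dots> = M s" using False s by (simp add: M_def)
      finally show ?thesis .
    qed
    with D show ?thesis by (intro exI[of _ D]) simp
  qed
  have "vnorm (dual E) w \<le> real CARD('n) * (LINT s|lebesgue. indicator {0<..<t} s * M s)"
  proof (cases flip)
    case True
    with B D int M0 show ?thesis
      by (intro E.is_bilinear_bound[of f a t w M]) (simp_all add: bilinear_of_def tensor_of_def)
  next
    case False
    with B D int M0 show ?thesis
      by (intro E.is_bilinear_bound[of a f t w M]) (simp_all add: bilinear_of_def tensor_of_def)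
  qed
  also have "(LINT s|lebesgue. indicator {0<..<t} s * M s) = (t - c) powr (\<beta> + 1) / (\<beta> + 1) * (Cp * A * F3)"
    unfolding ind by (simp add: powr_kernel_integral[OF \<beta> c])
  finally show ?thesis by (simp add: mult_ac)
qed

lemma bilinear_of_near_Y:
  assumes t: "t > 0" and a: "E.regulated t a" and fr: "E.regulated t f" and f: "\<And>s. f s \<in> Y"
    and F3: "F3 \<ge> 0" "\<And>s. vnorm (dual E3) (f s) \<le> F3"
    and B: "bilinear_of E flip a f t w" and \<epsilon>: "\<epsilon> > 0"
  obtains g where "g \<in> Y" "vnorm (dual E) (vdiff w g) < \<epsilon>"
proof -
  obtain A where A: "A \<ge> 0" "\<And>s. s \<in> {0<..<t} \<Longrightarrow> vnorm (dual E) (a s) \<le> A"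
    using E.regulated_bounded[OF a] by blast
  define c0 where "c0 = real CARD('n) * Cp * F3 / (\<beta> + 1) * A"
  have "c0 \<ge> 0" using Cp F3 A \<beta> by (simp add: c0_def)
  then obtain \<delta> where \<delta>: "\<delta> > 0" "\<delta> < t" "\<And>r. 0 \<le> r \<Longrightarrow> r \<le> \<delta> \<Longrightarrow> c0 * r powr (\<beta> + 1) < \<epsilon>"
    using small_powr[of c0 "\<beta> + 1" \<epsilon> t] \<beta> \<epsilon> t by auto
  \<comment> \<open>The late part \<open>a2\<close> contributes less than \<epsilon> by the kernel
    bound; the early part \<open>a1\<close> keeps distance \<delta> from the singular time and will
    contribute an element of \<open>Y\<close>.\<close>
  define a1 where "a1 s = (if s \<in> {..t - \<delta>} then a s else vzero)" for s
  define a2 where "a2 s = (if s \<in> {t - \<delta><..} then a s else vzero)" for s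
  have sum: "vadd (a2 s) (a1 s) = a s" for s by (simp add: a1_def a2_def vdiff_algebra)
  have r1: "E.regulated t a1" and r2: "E.regulated t a2"
    unfolding a1_def[abs_def] a2_def[abs_def] by (intro E.regulated_truncate a; simp)+
  obtain w1 where w1: "bilinear_of E flip a1 f t w1" "vfield_in (dual E) w1"
    using bilinear_of_exists[OF t r1 fr] by blast
  obtain w2 where w2: "bilinear_of E flip a2 f t w2" "vfield_in (dual E) w2"
    using bilinear_of_exists[OF t r2 fr] by blast
  have w: "w = vadd w2 w1"
  proof (cases flip)
    case True
    have "is_bilinear E f a t (vadd w2 w1)"
      using E.is_bilinear_add_right[of f a2 t w2 a1 w1] w1 w2 True by (simp add: bilinear_of_def sum)
    then show ?thesis using B True E.is_bilinear_unique[of f a t w] by (simp add: bilinear_of_def)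
  next
    case False
    have "is_bilinear E a f t (vadd w2 w1)"
      using E.is_bilinear_add_left[of a2 f t w2 a1 w1] w1 w2 False by (simp add: bilinear_of_def sum)
    then show ?thesis using B False E.is_bilinear_unique[of a f t w] by (simp add: bilinear_of_def)
  qed
  have "vnorm (dual E) w2 \<le> c0 * (t - (t - \<delta>)) powr (\<beta> + 1)"
    unfolding c0_def
  proof (rule bilinear_of_bound[OF w2(1)])
    show "vfield_in (dual E) (a2 s)" if "s \<in> {0<..<t}" for s using E.regulated_vfield[OF r2 that] .
    show "vnorm (dual E) (a2 s) \<le> A" if "s \<in> {0<..<t}" for s
      using A(2)[OF that] A(1) by (simp add: a2_def E.vnorm_vzero)
  qed (use \<delta> A F3 f in \<open>simp_all add: a2_def\<close>)
  also have "\<dots> < \<epsilon>" using \<delta> by simp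
  finally have small: "vnorm (dual E) w2 < \<epsilon>" .
  \<comment> \<open>One bound for \<sigma>^p on [\<delta>/2, t], whatever the sign of p: a power is
    monotone, so its maximum sits at an endpoint.\<close>
  define P where "P p = max ((\<delta> / 2) powr p) (t powr p)" for p
  have P: "\<sigma> powr p \<le> P p" if "\<delta> / 2 \<le> \<sigma>" "\<sigma> \<le> t" for \<sigma> p :: real
  proof (cases "p \<ge> 0")
    case True
    then have "\<sigma> powr p \<le> t powr p" using that \<delta> by (intro powr_mono2) auto
    then show ?thesis by (simp add: P_def)
  next
    case False
    then have "\<sigma> powr p \<le> (\<delta> / 2) powr p" using that \<delta> by (intro powr_mono2') auto
    then show ?thesis by (simp add: P_def)
  qed
  have P0: "P p \<ge> 0" for p by (simp add: P_def le_max_iff_disj)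
  define N where "N = real CARD('n) * (C3 * P \<gamma> * (Cp * P \<beta> * A * F3))"
  have N: "N \<ge> 0" using C3 Cp A F3 P0 by (simp add: N_def)
  have tens: "\<exists>D. tensor_of flip (t - s) (a1 s) (f s) D \<and> vfield_in (dual E) D \<and>
      vfield_in (dual E3) D \<and> vnorm (dual E3) D \<le> N" if s: "s \<in> {0<..<t}" for s
  proof -
    have ts: "t - s > 0" using s by simp
    have a1v: "vfield_in (dual E) (a1 s)" using E.regulated_vfield[OF r1 s] .
    have f3: "vfield_in (dual E3) (f s)" using f[of s] by (simp add: Y_def)
    obtain D where D: "tensor_of flip (t - s) (a1 s) (f s) D" "vfield_in (dual E) D"
        "vnorm (dual E) D \<le> Cp * (t - s) powr \<beta> * vnorm (dual E) (a1 s) * vnorm (dual E3) (f s)"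
      using product[OF ts a1v f3, of flip] by blast
    show ?thesis
    proof (cases "s \<le> t - \<delta>")
      case False
      \<comment> \<open>Here \<open>a1\<close> vanishes, so the product estimate itself forces the
        tensor to be zero, which lies in every dual.\<close>
      then have "vnorm (dual E) D \<le> 0" using D(3) by (simp add: a1_def E.vnorm_vzero)
      then have "D = vzero" by (rule E.vnorm_eq_0[OF D(2)])
      then show ?thesis using D N by (intro exI[of _ D]) (simp add: E3.vfield_vzero E3.vnorm_vzero)
    next
      case True
      \<comment> \<open>Half of the elapsed time goes into the derivative and the other half into
        smoothing from \<open>E'\<close> to \<open>E3'\<close>. Uniqueness identifies the result
        with the integrand at the full time.\<close>
      define \<sigma> where "\<sigma> = (t - s) / 2"
      have \<sigma>: "\<sigma> > 0" "\<delta> / 2 \<le> \<sigma>" "\<sigma> \<le> t" using True s by (auto simp: \<sigma>_def)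
      obtain D' where D': "tensor_of flip \<sigma> (a1 s) (f s) D'" "vfield_in (dual E) D'"
          "vnorm (dual E) D' \<le> Cp * \<sigma> powr \<beta> * vnorm (dual E) (a1 s) * vnorm (dual E3) (f s)"
        using product[OF \<sigma>(1) a1v f3, of flip] by blast
      have "Cp * \<sigma> powr \<beta> * vnorm (dual E) (a1 s) * vnorm (dual E3) (f s) \<le> Cp * P \<beta> * A * F3"
        using Cp A(1) A(2)[OF s] F3 P[OF \<sigma>(2,3), of \<beta>] P0[of \<beta>] True E3.vnorm_nonneg[OF f3] E.vnorm_nonneg[OF a1v]
        by (intro mult_mono mult_left_mono) (simp_all add: a1_def)
      with D'(3) have D'n: "vnorm (dual E) D' \<le> Cp * P \<beta> * A * F3" by simp
      have "tensor_of flip (\<sigma> + \<sigma>) (a1 s) (f s) (\<lambda>j. heat \<sigma> (D' j))" by (rule tensor_of_heat[OF D'(1) \<sigma>(1)])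
      then have DD: "D = (\<lambda>j. heat \<sigma> (D' j))" using D(1) by (intro tensor_of_unique) (simp_all add: \<sigma>_def)
      have Dj: "D j \<in> points (dual E3)" "nrm (dual E3) (D j) \<le> C3 * P \<gamma> * (Cp * P \<beta> * A * F3)" for j
      proof -
        have D'j: "D' j \<in> points (dual E)" using D'(2) by (simp add: vfield_in_def)
        show "D j \<in> points (dual E3)" unfolding DD using heat3[OF \<sigma>(1) D'j] by blast
        have "nrm (dual E3) (D j) \<le> C3 * \<sigma> powr \<gamma> * nrm (dual E) (D' j)"
          unfolding DD using heat3[OF \<sigma>(1) D'j] by blast
        also have "\<dots> \<le> C3 * P \<gamma> * (Cp * P \<beta> * A * F3)"
          using C3 P[OF \<sigma>(2,3), of \<gamma>] P0[of \<gamma>] order_trans[OF E.nrm_le_vnorm[OF D'(2)] D'n] E.nrm_dual_nonneg[OF D'j]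
          by (intro mult_mono mult_left_mono) simp_all
        finally show "nrm (dual E3) (D j) \<le> C3 * P \<gamma> * (Cp * P \<beta> * A * F3)" .
      qed
      have "vnorm (dual E3) D \<le> (\<Sum>j\<in>(UNIV::'n set). C3 * P \<gamma> * (Cp * P \<beta> * A * F3))"
        unfolding vnorm_def by (intro sum_mono Dj)
      then have "vnorm (dual E3) D \<le> N" by (simp add: N_def)
      then show ?thesis using D Dj by (intro exI[of _ D]) (simp add: vfield_in_def)
    qed
  qed
  have "vfield_in (dual E3) w1"
  proof (cases flip)
    case True
    with w1 tens show ?thesis
      by (intro E.is_bilinear_in_dual[OF E3.dense_space_axioms _ t N, of f a1]) (simp_all add: bilinear_of_def tensor_of_def)
  next
    case False
    with w1 tens show ?thesis
      by (intro E.is_bilinear_in_dual[OF E3.dense_space_axioms _ t N, of a1 f]) (simp_all add: bilinear_of_def tensor_of_def)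
  qed
  with w1 have "w1 \<in> Y" by (simp add: Y_def)
  moreover have "vdiff w w1 = w2" unfolding w by (rule vdiff_algebra)
  ultimately show ?thesis using small that by simp
qed

section \<open>Distance to Y along a solution\<close>

definition dist_Y :: "('n \<Rightarrow> 'n dist) \<Rightarrow> real" where
  "dist_Y f = (INF g\<in>Y. vnorm (dual E) (vdiff f g))"

lemma Y_nonempty: "Y \<noteq> {}"
  using E.vfield_vzero E3.vfield_vzero by (auto simp: Y_def)

lemma dist_Y_bdd: "vfield_in (dual E) f \<Longrightarrow> bdd_below ((\<lambda>g. vnorm (dual E) (vdiff f g)) ` Y)"
  by (rule bdd_belowI2[of _ 0]) (auto simp: Y_def intro: E.vnorm_nonneg E.vfield_vdiff)

lemma dist_Y_le: "vfield_in (dual E) f \<Longrightarrow> g \<in> Y \<Longrightarrow> dist_Y f \<le> vnorm (dual E) (vdiff f g)"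
  unfolding dist_Y_def by (rule cINF_lower[OF dist_Y_bdd])

lemma dist_Y_nonneg: "vfield_in (dual E) f \<Longrightarrow> 0 \<le> dist_Y f"
  unfolding dist_Y_def by (rule cINF_greatest[OF Y_nonempty]) (auto simp: Y_def intro: E.vnorm_nonneg E.vfield_vdiff)

lemma dist_Y_less:
  assumes "vfield_in (dual E) f" "dist_Y f < m"
  shows "\<exists>g\<in>Y. vnorm (dual E) (vdiff f g) < m"
  using assms(2) unfolding dist_Y_def cINF_less_iff[OF Y_nonempty dist_Y_bdd[OF assms(1)]] .

text \<open>Together with its mirror image this is the 1-Lipschitz property, which transfers
  continuity in time from the solution to its distance.\<close>

lemma dist_Y_triangle:
  assumes f: "vfield_in (dual E) f" and f': "vfield_in (dual E) f'"
  shows "dist_Y f - vnorm (dual E) (vdiff f f') \<le> dist_Y f'"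
  unfolding dist_Y_def[of f']
proof (rule cINF_greatest[OF Y_nonempty])
  fix g assume g: "g \<in> Y"
  then have "dist_Y f \<le> vnorm (dual E) (vdiff f g)" by (rule dist_Y_le[OF f])
  also have "\<dots> \<le> vnorm (dual E) (vdiff f f') + vnorm (dual E) (vdiff f' g)"
    using f f' g by (intro E.vnorm_vdiff_triangle) (simp_all add: Y_def)
  finally show "dist_Y f - vnorm (dual E) (vdiff f f') \<le> vnorm (dual E) (vdiff f' g)" by simp
qed

end

context critical_setting
begin

text \<open>Everything but the product of the two remainders is in \<open>Y\<close> up to
  \<epsilon>. The term \<open>h\<close>, in the application the caloric part, lies in
  \<open>Y\<close> and drops out of the distance.\<close>

lemma solution_dist_Y_step:
  assumes t: "t > 0" and u: "\<And>s. s \<in> {0..t} \<Longrightarrow> vfield_in (dual E) (u s)"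
    and cont: "\<And>s. s \<in> {0..t} \<Longrightarrow> ((\<lambda>r. vnorm (dual E) (vdiff (u r) (u s))) \<longlongrightarrow> 0) (at s within {0..t})"
    and h: "h \<in> Y" and w: "is_bilinear E u u t w" "u t = vadd h w"
    and m: "m \<ge> 0" "\<And>s. s \<in> {0..t} \<Longrightarrow> dist_Y (u s) \<le> m"
  shows "dist_Y (u t) \<le> K * m\<^sup>2"
proof -
  have ur: "E.regulated t u" using t u cont by (intro E.regulated_continuous) auto
  have main: "dist_Y (u t) \<le> K * (m + \<epsilon>)\<^sup>2 + 2 * \<epsilon>" if \<epsilon>: "\<epsilon> > 0" for \<epsilon>
  proof -
    \<comment> \<open>The infimum defining the distance need not be attained, so \<epsilon> is added
      to \<open>m\<close> and removed by a limit at the end.\<close>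
    obtain f where f: "simple_function lebesgue f" "\<And>s. f s \<in> Y"
        "\<And>s. s \<in> {0..<t} \<Longrightarrow> vnorm (dual E) (vdiff (u s) (f s)) < m + \<epsilon>"
    proof (rule E.step_approximation[OF less_imp_le[OF t] u cont, where P = Y and m = "m + \<epsilon>"])
      show "\<exists>g\<in>Y. vnorm (dual E) (vdiff (u s) g) < m + \<epsilon>" if "s \<in> {0..t}" for s
        using dist_Y_less[OF u[OF that], of "m + \<epsilon>"] m(2)[OF that] \<epsilon> by simp
    qed (use t in \<open>simp_all add: Y_def\<close>)
    have fr: "E.regulated t f" using f by (intro E.regulated_simple) (simp_all add: Y_def)
    define r where "r s = vdiff (u s) (f s)" for s
    have rr: "E.regulated t r" unfolding r_def[abs_def] by (rule E.regulated_vdiff[OF ur fr])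
    have fru: "vadd (f s) (r s) = u s" for s by (simp add: r_def vdiff_algebra)
    obtain F3 where F3: "F3 \<ge> 0" "\<And>s. s \<in> space lebesgue \<Longrightarrow> vnorm (dual E3) (f s) \<le> F3"
      using E.simple_function_bounded[OF f(1), of "vnorm (dual E3)"] by metis
    have F3': "\<And>s. vnorm (dual E3) (f s) \<le> F3" using F3(2) by simp
    have rb: "vnorm (dual E) (r s) \<le> m + \<epsilon>" if "s \<in> {0<..<t}" for s
      using f(3)[of s] that by (simp add: r_def)
    have me: "0 \<le> m + \<epsilon>" using m \<epsilon> by simp
    obtain w0 where w0: "is_bilinear E r r t w0" "vnorm (dual E) w0 \<le> K * (m + \<epsilon>) * (m + \<epsilon>)" "vfield_in (dual E) w0"
      by (rule bilinear_exists[OF t rr rr me rb me rb])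
    obtain w1 where w1: "bilinear_of E True u f t w1" "vfield_in (dual E) w1"
      by (rule bilinear_of_exists[OF t ur fr])
    obtain w2 where w2: "bilinear_of E False r f t w2" "vfield_in (dual E) w2"
      by (rule bilinear_of_exists[OF t rr fr])
    obtain g1 where g1: "g1 \<in> Y" "vnorm (dual E) (vdiff w1 g1) < \<epsilon>"
      by (rule bilinear_of_near_Y[OF t ur fr f(2) F3(1) F3' w1(1) \<epsilon>])
    obtain g2 where g2: "g2 \<in> Y" "vnorm (dual E) (vdiff w2 g2) < \<epsilon>"
      by (rule bilinear_of_near_Y[OF t rr fr f(2) F3(1) F3' w2(1) \<epsilon>])
    \<comment> \<open>Reassembly from the inside: B(r,f) + B(r,r) = B(r,u), and adding B(f,u) gives
      B(u,u). Uniqueness of the time integral then identifies this sum with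
      \<open>w\<close>.\<close>
    have "is_bilinear E r (\<lambda>s. vadd (f s) (r s)) t (vadd w2 w0)"
      using E.is_bilinear_add_right[of r f t w2 r w0] w2(1) w0(1) by (simp add: bilinear_of_def)
    then have "is_bilinear E r u t (vadd w2 w0)" by (simp add: fru)
    then have "is_bilinear E (\<lambda>s. vadd (f s) (r s)) u t (vadd w1 (vadd w2 w0))"
      using E.is_bilinear_add_left[of f u t w1 r] w1(1) by (simp add: bilinear_of_def)
    then have "is_bilinear E u u t (vadd w1 (vadd w2 w0))" by (simp add: fru)
    then have w': "w = vadd w1 (vadd w2 w0)" using E.is_bilinear_unique[OF w(1)] by simp
    have gE: "vfield_in (dual E) g1" "vfield_in (dual E) g2" using g1 g2 by (simp_all add: Y_def)
    \<comment> \<open>Subtracting the element h + g1 + g2 of \<open>Y\<close> leaves two errors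
      below \<epsilon> and the quadratic term.\<close>
    have e: "vdiff (u t) (vadd h (vadd g1 g2)) = vadd (vdiff w1 g1) (vadd (vdiff w2 g2) w0)"
      unfolding w(2) w' by (simp add: vadd_def vdiff_def dist_add_def dist_diff_def fun_eq_iff)
    have "dist_Y (u t) \<le> vnorm (dual E) (vdiff (u t) (vadd h (vadd g1 g2)))"
      using t u by (intro dist_Y_le Y_vadd h g1 g2) simp
    also have "\<dots> \<le> vnorm (dual E) (vdiff w1 g1) + vnorm (dual E) (vadd (vdiff w2 g2) w0)"
      unfolding e by (intro E.vnorm_vadd E.vfield_vadd E.vfield_vdiff w0 w1 w2 gE)
    also have "vnorm (dual E) (vadd (vdiff w2 g2) w0) \<le> vnorm (dual E) (vdiff w2 g2) + vnorm (dual E) w0"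
      by (intro E.vnorm_vadd E.vfield_vdiff w0 w2 gE)
    finally show ?thesis using g1(2) g2(2) w0(2) by (simp add: power2_eq_square mult.assoc)
  qed
  have "((\<lambda>\<epsilon>. K * (m + \<epsilon>)\<^sup>2 + 2 * \<epsilon>) \<longlongrightarrow> K * (m + 0)\<^sup>2 + 2 * 0) (at_right 0)"
    by (intro tendsto_intros)
  moreover have "eventually (\<lambda>\<epsilon>. dist_Y (u t) \<le> K * (m + \<epsilon>)\<^sup>2 + 2 * \<epsilon>) (at_right 0)"
    using eventually_at_right_less[of 0] by eventually_elim (rule main)
  ultimately have "dist_Y (u t) \<le> K * (m + 0)\<^sup>2 + 2 * 0"
    by (rule tendsto_lowerbound) simp
  then show ?thesis by simp
qed

text \<open>The preceding estimate feeds the barrier argument, with d the distance of the solution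
  to \<open>Y\<close>.\<close>

lemma solution_dist_Y:
  assumes u: "\<And>s. s \<in> {0..t1} \<Longrightarrow> vfield_in (dual E) (u s)"
    and cont: "\<And>s. s \<in> {0..t1} \<Longrightarrow> ((\<lambda>r. vnorm (dual E) (vdiff (u r) (u s))) \<longlongrightarrow> 0) (at s within {0..t1})"
    and mild: "\<And>t. t \<in> {0<..t1} \<Longrightarrow> \<exists>h\<in>Y. \<exists>w. is_bilinear E u u t w \<and> u t = vadd h w"
    and d0: "dist_Y (u 0) = 0" and t2: "t2 \<in> {0..t1}"
  shows "dist_Y (u t2) = 0"
proof (rule quadratic_barrier[where d = "\<lambda>s. dist_Y (u s)", OF _ d0 K _ _ t2])
  show "0 \<le> dist_Y (u s)" if "s \<in> {0..t1}" for s by (rule dist_Y_nonneg[OF u[OF that]])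
  show "continuous_on {0..t1} (\<lambda>s. dist_Y (u s))"
    unfolding continuous_on_def
  proof
    fix s assume s: "s \<in> {0..t1}"
    have "eventually (\<lambda>r. r \<in> {0..t1}) (at s within {0..t1})" by (auto simp: eventually_at_filter)
    then have "eventually (\<lambda>r. norm (dist_Y (u r) - dist_Y (u s)) \<le> vnorm (dual E) (vdiff (u r) (u s))) (at s within {0..t1})"
    proof eventually_elim
      case (elim r)
      show ?case
        using dist_Y_triangle[OF u[OF elim] u[OF s]] dist_Y_triangle[OF u[OF s] u[OF elim]]
          E.vnorm_vdiff_commute[OF u[OF elim] u[OF s]] by (simp add: abs_le_iff)
    qed
    from Lim_null_comparison[OF this cont[OF s]]
    show "((\<lambda>s. dist_Y (u s)) \<longlongrightarrow> dist_Y (u s)) (at s within {0..t1})" by (rule LIM_zero_cancel)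
  qed
  fix t m :: real assume t: "t \<in> {0<..t1}" and m: "0 \<le> m" "\<And>s. s \<in> {0..t} \<Longrightarrow> dist_Y (u s) \<le> m"
  obtain h w where hw: "h \<in> Y" "is_bilinear E u u t w" "u t = vadd h w" using mild[OF t] by blast
  have sub: "{0..t} \<subseteq> {0..t1}" using t by auto
  show "dist_Y (u t) \<le> K * m\<^sup>2"
  proof (rule solution_dist_Y_step[OF _ _ _ hw m])
    show "((\<lambda>r. vnorm (dual E) (vdiff (u r) (u s))) \<longlongrightarrow> 0) (at s within {0..t})" if "s \<in> {0..t}" for s
      using that sub by (intro tendsto_within_subset[OF cont sub]) auto
  qed (use t sub u in auto)
qed

text \<open>With zero distance to \<open>Y\<close>, both solutions are uniformly approximated by
  step functions that take only finitely many values and are therefore bounded in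
  \<open>E3'\<close>. One \<delta> then serves the whole interval, and the difference is shown to
  vanish on successive intervals of length \<delta>.\<close>

lemma solution_unique:
  assumes t1: "t1 > 0"
    and u: "\<And>s. s \<in> {0..t1} \<Longrightarrow> vfield_in (dual E) (u s)"
    and v: "\<And>s. s \<in> {0..t1} \<Longrightarrow> vfield_in (dual E) (v s)"
    and cu: "\<And>s. s \<in> {0..t1} \<Longrightarrow> ((\<lambda>r. vnorm (dual E) (vdiff (u r) (u s))) \<longlongrightarrow> 0) (at s within {0..t1})"
    and cv: "\<And>s. s \<in> {0..t1} \<Longrightarrow> ((\<lambda>r. vnorm (dual E) (vdiff (v r) (v s))) \<longlongrightarrow> 0) (at s within {0..t1})"
    and du: "\<And>s. s \<in> {0..t1} \<Longrightarrow> dist_Y (u s) = 0"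
    and dv: "\<And>s. s \<in> {0..t1} \<Longrightarrow> dist_Y (v s) = 0"
    and mild: "\<And>t. t \<in> {0<..t1} \<Longrightarrow> \<exists>h wu wv. is_bilinear E u u t wu \<and> is_bilinear E v v t wv \<and>
        u t = vadd h wu \<and> v t = vadd h wv"
    and uv0: "u 0 = v 0" and s: "s \<in> {0..t1}"
  shows "u s = v s"
proof -
  \<comment> \<open>The difference splits into four bilinear terms. Each is to be at most N/8, so
    that their sum is N/2; for the two terms with remainders this means K \<eta> = 1/8.\<close>
  define \<eta> where "\<eta> = 1 / (8 * K)"
  have \<eta>: "\<eta> > 0" "K * \<eta> = 1 / 8" using K by (simp_all add: \<eta>_def)
  have t10: "0 \<le> t1" using t1 by simp
  obtain f where f: "simple_function lebesgue f" "\<And>s. f s \<in> Y"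
      "\<And>s. s \<in> {0..<t1} \<Longrightarrow> vnorm (dual E) (vdiff (u s) (f s)) < \<eta>"
  proof (rule E.step_approximation[OF t10 u cu, where P = Y and m = \<eta>])
    show "\<exists>g\<in>Y. vnorm (dual E) (vdiff (u s) g) < \<eta>" if "s \<in> {0..t1}" for s
      using dist_Y_less[OF u[OF that], of \<eta>] du[OF that] \<eta> by simp
  qed (simp_all add: Y_def)
  obtain g where g: "simple_function lebesgue g" "\<And>s. g s \<in> Y"
      "\<And>s. s \<in> {0..<t1} \<Longrightarrow> vnorm (dual E) (vdiff (v s) (g s)) < \<eta>"
  proof (rule E.step_approximation[OF t10 v cv, where P = Y and m = \<eta>])
    show "\<exists>g\<in>Y. vnorm (dual E) (vdiff (v s) g) < \<eta>" if "s \<in> {0..t1}" for s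
      using dist_Y_less[OF v[OF that], of \<eta>] dv[OF that] \<eta> by simp
  qed (simp_all add: Y_def)
  obtain F1 where F1: "F1 \<ge> 0" "\<And>s. s \<in> space lebesgue \<Longrightarrow> vnorm (dual E3) (f s) \<le> F1"
    using E.simple_function_bounded[OF f(1), of "vnorm (dual E3)"] by metis
  obtain F2 where F2: "F2 \<ge> 0" "\<And>s. s \<in> space lebesgue \<Longrightarrow> vnorm (dual E3) (g s) \<le> F2"
    using E.simple_function_bounded[OF g(1), of "vnorm (dual E3)"] by metis
  define F3 where "F3 = max F1 F2"
  have F3: "F3 \<ge> 0" "\<And>s. vnorm (dual E3) (f s) \<le> F3" "\<And>s. vnorm (dual E3) (g s) \<le> F3"
    using F1 F2 by (simp_all add: F3_def le_max_iff_disj)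
  define c0 where "c0 = real CARD('n) * Cp * F3 / (\<beta> + 1)"
  have c0: "c0 \<ge> 0" using Cp F3 \<beta> by (simp add: c0_def)
  \<comment> \<open>The length \<delta> depends on the \<open>E3'\<close> bound and the kernel only,
    not on the time at which an interval starts.\<close>
  obtain \<delta> where \<delta>: "\<delta> > 0" "\<And>r. 0 \<le> r \<Longrightarrow> r \<le> \<delta> \<Longrightarrow> c0 * r powr (\<beta> + 1) < 1 / 8"
    by (rule small_powr[OF c0 _ _ t1, of "\<beta> + 1" "1 / 8"]) (use \<beta> in auto)
  define d where "d s = vdiff (u s) (v s)" for s
  have dE: "vfield_in (dual E) (d s)" if "s \<in> {0..t1}" for s
    unfolding d_def by (intro E.vfield_vdiff u v that)
  \<comment> \<open>A contraction in pointwise form: if the difference vanishes up to c and is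
    bounded by N before t, it is at most N/2 at t, as long as t \<le> c + \<delta>.\<close>
  have half: "vnorm (dual E) (d t) \<le> N / 2"
    if c: "0 \<le> c" "t \<le> c + \<delta>" and dc: "\<And>s. s \<in> {0..c} \<Longrightarrow> s \<le> t1 \<Longrightarrow> d s = vzero"
      and t: "t \<in> {0<..t1}" and N: "0 \<le> N" "\<And>s. s \<in> {0<..<t} \<Longrightarrow> vnorm (dual E) (d s) \<le> N" for c t N
  proof (cases "t \<le> c")
    case True
    then have "d t = vzero" using dc t by simp
    then show ?thesis using N by (simp add: E.vnorm_vzero)
  next
    case False
    have t0: "t > 0" and tt: "0 \<le> t" using t by simp_all
    have sub: "{0..t} \<subseteq> {0..t1}" using t by auto
    have ur: "E.regulated t u"
      using sub by (intro E.regulated_continuous[OF tt] u tendsto_within_subset[OF cu sub]) auto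
    have vr: "E.regulated t v"
      using sub by (intro E.regulated_continuous[OF tt] v tendsto_within_subset[OF cv sub]) auto
    have fr: "E.regulated t f" using f by (intro E.regulated_simple) (simp_all add: Y_def)
    have gr: "E.regulated t g" using g by (intro E.regulated_simple) (simp_all add: Y_def)
    have dr: "E.regulated t d" unfolding d_def[abs_def] by (rule E.regulated_vdiff[OF ur vr])
    define ru where "ru s = vdiff (u s) (f s)" for s
    define rv where "rv s = vdiff (v s) (g s)" for s
    have rur: "E.regulated t ru" unfolding ru_def[abs_def] by (rule E.regulated_vdiff[OF ur fr])
    have rvr: "E.regulated t rv" unfolding rv_def[abs_def] by (rule E.regulated_vdiff[OF vr gr])
    have ub: "vnorm (dual E) (ru s) \<le> \<eta>" if "s \<in> {0<..<t}" for s
      using f(3)[of s] that t by (simp add: ru_def)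
    have vb: "vnorm (dual E) (rv s) \<le> \<eta>" if "s \<in> {0<..<t}" for s
      using g(3)[of s] that t by (simp add: rv_def)
    have \<eta>0: "0 \<le> \<eta>" using \<eta> by simp
    have sums: "vadd (f s) (ru s) = u s" "vadd (g s) (rv s) = v s" "vadd (v s) (d s) = u s" for s
      by (simp_all add: ru_def rv_def d_def vdiff_algebra)
    obtain p1 where p1: "bilinear_of E False d f t p1" "vfield_in (dual E) p1"
      by (rule bilinear_of_exists[OF t0 dr fr])
    obtain p2 where p2: "is_bilinear E d ru t p2" "vnorm (dual E) p2 \<le> K * N * \<eta>" "vfield_in (dual E) p2"
      by (rule bilinear_exists[OF t0 dr rur N \<eta>0 ub])
    obtain p3 where p3: "bilinear_of E True d g t p3" "vfield_in (dual E) p3"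
      by (rule bilinear_of_exists[OF t0 dr gr])
    obtain p4 where p4: "is_bilinear E rv d t p4" "vnorm (dual E) p4 \<le> K * \<eta> * N" "vfield_in (dual E) p4"
      by (rule bilinear_exists[OF t0 rvr dr \<eta>0 vb N])
    obtain h wu wv where w: "is_bilinear E u u t wu" "is_bilinear E v v t wv" "u t = vadd h wu" "v t = vadd h wv"
      using mild[OF t] by blast
    have "is_bilinear E d (\<lambda>s. vadd (f s) (ru s)) t (vadd p1 p2)"
      using E.is_bilinear_add_right[of d f t p1 ru p2] p1(1) p2(1) by (simp add: bilinear_of_def)
    then have du: "is_bilinear E d u t (vadd p1 p2)" by (simp add: sums)
    have "is_bilinear E (\<lambda>s. vadd (g s) (rv s)) d t (vadd p3 p4)"
      using E.is_bilinear_add_left[of g d t p3 rv p4] p3(1) p4(1) by (simp add: bilinear_of_def)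
    then have vd: "is_bilinear E v d t (vadd p3 p4)" by (simp add: sums)
    \<comment> \<open>From B(v,v) to B(u,u) in two moves: adding B(v,d) gives B(v,u), and adding
      B(d,u) gives B(u,u). The caloric part \<open>h\<close> is common to both solutions and
      cancels.\<close>
    have "is_bilinear E v (\<lambda>s. vadd (v s) (d s)) t (vadd wv (vadd p3 p4))"
      by (rule E.is_bilinear_add_right[OF w(2) vd])
    then have "is_bilinear E v u t (vadd wv (vadd p3 p4))" by (simp add: sums)
    then have "is_bilinear E (\<lambda>s. vadd (v s) (d s)) u t (vadd (vadd wv (vadd p3 p4)) (vadd p1 p2))"
      by (rule E.is_bilinear_add_left[OF _ du])
    then have "is_bilinear E u u t (vadd (vadd wv (vadd p3 p4)) (vadd p1 p2))" by (simp add: sums)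
    then have wu: "wu = vadd (vadd wv (vadd p3 p4)) (vadd p1 p2)" using E.is_bilinear_unique[OF w(1)] by simp
    have dt: "d t = vadd (vadd p3 p4) (vadd p1 p2)"
      unfolding d_def w(3,4) wu by (simp add: vadd_def vdiff_def dist_add_def dist_diff_def add.assoc)
    have tc: "c0 * N * (t - c) powr (\<beta> + 1) \<le> N / 8"
    proof -
      have "c0 * (t - c) powr (\<beta> + 1) \<le> 1 / 8" using \<delta>(2)[of "t - c"] False c by simp
      then have "N * (c0 * (t - c) powr (\<beta> + 1)) \<le> N * (1 / 8)" using N(1) by (rule mult_left_mono)
      then show ?thesis by (simp add: mult_ac)
    qed
    have dz: "d s = vzero" if "s \<in> {0<..<t}" "s \<le> c" for s using dc[of s] that t by simp
    have ct: "c \<le> t" using False by simp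
    have b1: "vnorm (dual E) p1 \<le> N / 8"
      by (rule order_trans[OF _ tc], unfold c0_def)
         (rule bilinear_of_bound[OF p1(1) c(1) ct E.regulated_vfield[OF dr] dz N f(2) F3(1,2)])
    have b3: "vnorm (dual E) p3 \<le> N / 8"
      by (rule order_trans[OF _ tc], unfold c0_def)
         (rule bilinear_of_bound[OF p3(1) c(1) ct E.regulated_vfield[OF dr] dz N g(2) F3(1,3)])
    have b2: "vnorm (dual E) p2 \<le> N / 8"
    proof -
      have "K * N * \<eta> = N / 8" using \<eta>(2) by (simp add: mult.commute mult.left_commute)
      with p2(2) show ?thesis by simp
    qed
    have b4: "vnorm (dual E) p4 \<le> N / 8" using p4(2) \<eta>(2) by simp
    have "vnorm (dual E) (d t) \<le> vnorm (dual E) (vadd p3 p4) + vnorm (dual E) (vadd p1 p2)"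
      unfolding dt by (intro E.vnorm_vadd E.vfield_vadd p1 p2 p3 p4)
    also have "vnorm (dual E) (vadd p3 p4) \<le> vnorm (dual E) p3 + vnorm (dual E) p4"
      by (intro E.vnorm_vadd p3 p4)
    also have "vnorm (dual E) (vadd p1 p2) \<le> vnorm (dual E) p1 + vnorm (dual E) p2"
      by (intro E.vnorm_vadd p1 p2)
    finally show ?thesis using b1 b2 b3 b4 by simp
  qed
  have zero: "d t = vzero" if "t \<in> {0..t1}" "t \<le> real k * \<delta>" for t k
    using that
  proof (induction k arbitrary: t)
    case 0
    then have "t = 0" by simp
    then show ?case using uv0 by (simp add: d_def vdiff_algebra)
  next
    case (Suc k)
    show ?case
    proof (cases "t = 0")
      case True
      then show ?thesis using uv0 by (simp add: d_def vdiff_algebra)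
    next
      case False
      then have t: "t \<in> {0<..t1}" using Suc.prems by simp
      define c where "c = real k * \<delta>"
      have c: "0 \<le> c" "t \<le> c + \<delta>" using \<delta> Suc.prems by (simp_all add: c_def distrib_right add.commute)
      have dc: "d s = vzero" if "s \<in> {0..c}" "s \<le> t1" for s
        using Suc.IH[of s] that by (simp add: c_def)
      have sub: "{0..t} \<subseteq> {0..t1}" using t by auto
      have tt: "0 \<le> t" using t by simp
      have ur: "E.regulated t u"
        using sub by (intro E.regulated_continuous[OF tt] u tendsto_within_subset[OF cu sub]) auto
      have vr: "E.regulated t v"
        using sub by (intro E.regulated_continuous[OF tt] v tendsto_within_subset[OF cv sub]) auto
      have dr: "E.regulated t d" unfolding d_def[abs_def] by (rule E.regulated_vdiff[OF ur vr])
      obtain B where B: "B \<ge> 0" "\<And>s. s \<in> {0<..<t} \<Longrightarrow> vnorm (dual E) (d s) \<le> B"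
        using E.regulated_bounded[OF dr] by blast
      \<comment> \<open>The halving is used at every earlier time s in place of t, since times
        before s only see the same bound; iterating drives the bound to 0.\<close>
      have pw: "\<forall>s\<in>{0<..<t}. vnorm (dual E) (d s) \<le> B / 2 ^ n" for n
      proof (induction n)
        case (Suc n)
        show ?case
        proof
          fix s assume s: "s \<in> {0<..<t}"
          have "vnorm (dual E) (d s) \<le> (B / 2 ^ n) / 2"
            by (rule half[OF c(1) _ dc]) (use s t c B Suc.IH in auto)
          then show "vnorm (dual E) (d s) \<le> B / 2 ^ Suc n" by simp
        qed
      qed (use B in simp)
      have "vnorm (dual E) (d t) \<le> (B / 2 ^ n) / 2" for n
        by (rule half[OF c dc t]) (use B pw[of n] in auto)
      moreover have "(\<lambda>n. (B / 2 ^ n) / 2) \<longlonglongrightarrow> (B * 0) / 2"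
        unfolding divide_inverse power_inverse[symmetric]
        by (intro tendsto_intros LIMSEQ_realpow_zero) simp_all
      ultimately have "vnorm (dual E) (d t) \<le> (B * 0) / 2"
        by (intro LIMSEQ_le_const) auto
      then show ?thesis using E.vnorm_eq_0[OF dE[OF Suc.prems(1)]] by simp
    qed
  qed
  obtain k where "s \<le> real k * \<delta>"
    using reals_Archimedean3[OF \<delta>(1)] less_imp_le by metis
  then have "d s = vzero" using zero s by blast
  then have "vadd (v s) (d s) = v s" by (simp add: vdiff_algebra)
  then show ?thesis by (simp add: d_def vdiff_algebra)
qed

end

section \<open>From the stated hypotheses to the abstract setting\<close>

context dense_space
begin

lemma nrm_dual_sum:
  assumes "finite I" "\<And>i. i \<in> I \<Longrightarrow> f i \<in> points (dual F)"
  shows "(\<lambda>\<phi>. \<Sum>i\<in>I. f i \<phi>) \<in> points (dual F) \<and>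
    nrm (dual F) (\<lambda>\<phi>. \<Sum>i\<in>I. f i \<phi>) \<le> (\<Sum>i\<in>I. nrm (dual F) (f i))"
  using assms
proof (induction I rule: finite_induct)
  case empty
  then show ?case using dual_zero nrm_dual_zero by (simp add: dist_zero_def)
next
  case (insert i I)
  let ?s = "\<lambda>\<phi>. \<Sum>i\<in>I. f i \<phi>"
  have IH: "?s \<in> points (dual F)" "nrm (dual F) ?s \<le> (\<Sum>i\<in>I. nrm (dual F) (f i))" using insert by simp_all
  have fi: "f i \<in> points (dual F)" using insert by simp
  have e: "(\<lambda>\<phi>. \<Sum>i\<in>insert i I. f i \<phi>) = dist_add (f i) ?s" using insert by (simp add: dist_add_def)
  show ?case unfolding e using dual_add(1)[OF fi IH(1)] nrm_dual_add[OF fi IH(1)] IH(2) insert by simp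
qed

text \<open>Membership in the union provides one invariant subspace containing \<open>f\<close>, and
  that suffices for all three properties.\<close>

lemma heat_continuity_space:
  assumes "f \<in> heat_continuity_space (dual F)"
  shows "f \<in> points (dual F)" "t \<ge> 0 \<Longrightarrow> heat t f \<in> points (dual F)"
    and "((\<lambda>t. nrm (dual F) (dist_diff (heat t f) f)) \<longlongrightarrow> 0) (at_right 0)"
proof -
  obtain S where S: "heat_C0_subspace (dual F) S" "f \<in> S"
    using assms unfolding heat_continuity_space_def by blast
  have sub: "S \<subseteq> points (dual F)" and h: "\<And>t. t \<ge> 0 \<Longrightarrow> heat t f \<in> S"
    and c: "continuous_into {0..} (dual F) (\<lambda>t. heat t f)"
    using S unfolding heat_C0_subspace_def by blast+
  show "f \<in> points (dual F)" "t \<ge> 0 \<Longrightarrow> heat t f \<in> points (dual F)" using sub S(2) h by blast+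
  have "((\<lambda>t. nrm (dual F) (dist_diff (heat t f) (heat 0 f))) \<longlongrightarrow> 0) (at 0 within {0..})"
    using c unfolding continuous_into_def by simp
  then have "((\<lambda>t. nrm (dual F) (dist_diff (heat t f) (heat 0 f))) \<longlongrightarrow> 0) (at_right 0)"
    by (rule tendsto_within_subset) auto
  moreover have "heat 0 f = f" by (simp add: heat_def)
  ultimately show "((\<lambda>t. nrm (dual F) (dist_diff (heat t f) f)) \<longlongrightarrow> 0) (at_right 0)" by simp
qed

lemma continuous_into_vnorm:
  assumes "\<And>j. continuous_into I (dual F) (\<lambda>t. u t j)" "s \<in> I"
  shows "vfield_in (dual F) (u s)"
    and "((\<lambda>r. vnorm (dual F) (vdiff (u r) (u s))) \<longlongrightarrow> 0) (at s within I)"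
proof -
  show "vfield_in (dual F) (u s)" using assms by (simp add: vfield_in_def continuous_into_def)
  have "((\<lambda>r. \<Sum>j\<in>UNIV. nrm (dual F) (dist_diff (u r j) (u s j))) \<longlongrightarrow> (\<Sum>j\<in>(UNIV :: 'n set). 0)) (at s within I)"
    using assms by (intro tendsto_sum) (simp add: continuous_into_def)
  then show "((\<lambda>r. vnorm (dual F) (vdiff (u r) (u s))) \<longlongrightarrow> 0) (at s within I)"
    by (simp add: vnorm_def vdiff_def)
qed

end

text \<open>(U5) is applied to each row of the product tensor and bounds all first derivatives; the
  divergence selects from row l only the derivative in direction l.\<close>

lemma tensor_from_products:
  fixes E E4 :: "('n::finite) dist_space"
  assumes E: "dense_space E" and E4: "dense_space E4" and B: "B \<ge> 0"
    and grad: "\<And>f. vfield_in (dual E4) f \<Longrightarrow>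
      \<exists>g. (\<forall>l j. grad_heat_leray s f l j (g l j) \<and> g l j \<in> points (dual E)) \<and>
        (\<Sum>l\<in>UNIV. \<Sum>j\<in>UNIV. nrm (dual E) (g l j)) \<le> B * vnorm (dual E4) f"
    and W: "\<And>l k. is_product (a l) (b k) (W l k)" "\<And>l k. W l k \<in> points (dual E4)"
  shows "\<exists>D. div_heat_leray_tensor s a b D \<and> vfield_in (dual E) D \<and>
    vnorm (dual E) D \<le> B * (\<Sum>l\<in>UNIV. \<Sum>k\<in>UNIV. nrm (dual E4) (W l k))"
proof -
  interpret E: dense_space E by (rule E)
  have "\<exists>g. (\<forall>m j. grad_heat_leray s (W l) m j (g m j) \<and> g m j \<in> points (dual E)) \<and>
        (\<Sum>m\<in>UNIV. \<Sum>j\<in>UNIV. nrm (dual E) (g m j)) \<le> B * vnorm (dual E4) (W l)" for l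
    by (rule grad) (simp add: vfield_in_def W)
  then have "\<forall>l. \<exists>g. (\<forall>m j. grad_heat_leray s (W l) m j (g m j) \<and> g m j \<in> points (dual E)) \<and>
        (\<Sum>m\<in>UNIV. \<Sum>j\<in>UNIV. nrm (dual E) (g m j)) \<le> B * vnorm (dual E4) (W l)" ..
  from choice[OF this] obtain g where g0: "\<forall>l. (\<forall>m j. grad_heat_leray s (W l) m j (g l m j) \<and> g l m j \<in> points (dual E)) \<and>
        (\<Sum>m\<in>UNIV. \<Sum>j\<in>UNIV. nrm (dual E) (g l m j)) \<le> B * vnorm (dual E4) (W l)" ..
  have g: "grad_heat_leray s (W l) m j (g l m j)" "g l m j \<in> points (dual E)"
    "(\<Sum>m\<in>UNIV. \<Sum>j\<in>UNIV. nrm (dual E) (g l m j)) \<le> B * vnorm (dual E4) (W l)" for l m j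
    using g0 by simp_all
  \<comment> \<open>The doubled index \<open>l l\<close> is the contraction of the row index with
    the direction of differentiation.\<close>
  define D where "D j = (\<lambda>\<phi>. \<Sum>l\<in>UNIV. g l l j \<phi>)" for j
  have D: "D j \<in> points (dual E) \<and> nrm (dual E) (D j) \<le> (\<Sum>l\<in>UNIV. nrm (dual E) (g l l j))" for j
    unfolding D_def by (rule E.nrm_dual_sum) (simp_all add: g)
  have "div_heat_leray_tensor s a b D"
    unfolding div_heat_leray_tensor_def
    by (rule exI[of _ W], rule exI[of _ "\<lambda>l j. g l l j"]) (simp add: W g D_def)
  moreover have "vnorm (dual E) D \<le> B * (\<Sum>l\<in>UNIV. \<Sum>k\<in>UNIV. nrm (dual E4) (W l k))"
  proof -
    have "vnorm (dual E) D \<le> (\<Sum>j\<in>UNIV. \<Sum>l\<in>UNIV. nrm (dual E) (g l l j))"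
      unfolding vnorm_def using D by (intro sum_mono) simp
    also have "\<dots> = (\<Sum>l\<in>UNIV. \<Sum>j\<in>UNIV. nrm (dual E) (g l l j))" by (rule sum.swap)
    also have "\<dots> \<le> (\<Sum>l\<in>UNIV. B * vnorm (dual E4) (W l))"
    proof (rule sum_mono)
      fix l
      have "(\<Sum>j\<in>UNIV. nrm (dual E) (g l l j)) \<le> (\<Sum>m\<in>UNIV. \<Sum>j\<in>UNIV. nrm (dual E) (g l m j))"
        by (rule member_le_sum[of l UNIV "\<lambda>m. \<Sum>j\<in>UNIV. nrm (dual E) (g l m j)"])
           (auto intro!: sum_nonneg E.nrm_dual_nonneg g)
      also have "\<dots> \<le> B * vnorm (dual E4) (W l)" by (rule g)
      finally show "(\<Sum>j\<in>UNIV. nrm (dual E) (g l l j)) \<le> B * vnorm (dual E4) (W l)" .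
    qed
    finally show ?thesis by (simp add: vnorm_def sum_distrib_left)
  qed
  ultimately show ?thesis using D by (intro exI[of _ D]) (simp add: vfield_in_def)
qed

text \<open>Scaling forces \<open>\<sigma>4 = \<sigma>E + \<sigma>3\<close> unless all products vanish; only the inequality is needed,
  and it comes from letting the dilation parameter \<open>1 / x\<close> tend to \<open>0\<close>.\<close>

lemma product_scaling:
  fixes E E3 E4 :: "('n::finite) dist_space"
  assumes d: "dense_space E" "dense_space E3" "dense_space E4"
    and sE: "scaling_exponent (dual E) \<sigma>E" and s3: "scaling_exponent (dual E3) \<sigma>3"
    and s4: "scaling_exponent (dual E4) \<sigma>4"
    and C: "C > 0" and prod: "\<And>f g. f \<in> points (dual E) \<Longrightarrow> g \<in> points (dual E3) \<Longrightarrow>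
      \<exists>h\<in>points (dual E4). is_product f g h \<and> nrm (dual E4) h \<le> C * nrm (dual E) f * nrm (dual E3) g"
  shows "\<exists>C\<ge>0. (\<forall>f\<in>points (dual E). \<forall>g\<in>points (dual E3). \<exists>h\<in>points (dual E4).
      is_product f g h \<and> nrm (dual E4) h \<le> C * nrm (dual E) f * nrm (dual E3) g) \<and> (C = 0 \<or> \<sigma>E + \<sigma>3 \<le> \<sigma>4)"
proof (cases "\<sigma>E + \<sigma>3 \<le> \<sigma>4")
  case True
  then show ?thesis using C prod by (intro exI[of _ C]) auto
next
  case False
  interpret E: dense_space E by (rule d)
  interpret E3: dense_space E3 by (rule d)
  interpret E4: dense_space E4 by (rule d)
  obtain CE where CE: "CE > 0" "\<And>l f. l > 0 \<Longrightarrow> f \<in> points (dual E) \<Longrightarrow>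
      dilate l f \<in> points (dual E) \<and> nrm (dual E) (dilate l f) \<le> CE * l powr \<sigma>E * nrm (dual E) f"
    using sE unfolding scaling_exponent_def by blast
  obtain C3 where C3: "C3 > 0" "\<And>l f. l > 0 \<Longrightarrow> f \<in> points (dual E3) \<Longrightarrow>
      dilate l f \<in> points (dual E3) \<and> nrm (dual E3) (dilate l f) \<le> C3 * l powr \<sigma>3 * nrm (dual E3) f"
    using s3 unfolding scaling_exponent_def by blast
  obtain C4 where C4: "C4 > 0" "\<And>l f. l > 0 \<Longrightarrow> f \<in> points (dual E4) \<Longrightarrow>
      dilate l f \<in> points (dual E4) \<and> nrm (dual E4) (dilate l f) \<le> C4 * l powr \<sigma>4 * nrm (dual E4) f"
    using s4 unfolding scaling_exponent_def by blast
  have "\<exists>h\<in>points (dual E4). is_product f g h \<and> nrm (dual E4) h \<le> 0"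
    if f: "f \<in> points (dual E)" and g: "g \<in> points (dual E3)" for f g
  proof -
    obtain h where h: "h \<in> points (dual E4)" "is_product f g h"
      using prod[OF f g] by blast
    \<comment> \<open>Collects the factors that do not depend on the dilation parameter.\<close>
    define A where "A = C4 * C * CE * C3 * nrm (dual E) f * nrm (dual E3) g"
    have bound: "nrm (dual E4) h \<le> A * x powr (\<sigma>4 - \<sigma>E - \<sigma>3)" if x: "x > 0" for x
    proof -
      define l where "l = 1 / x"
      have l: "l > 0" and lx: "1 / l = x" using x by (simp_all add: l_def)
      have fl: "dilate l f \<in> points (dual E)" "nrm (dual E) (dilate l f) \<le> CE * l powr \<sigma>E * nrm (dual E) f"
        using CE(2)[OF l f] by simp_all
      have gl: "dilate l g \<in> points (dual E3)" "nrm (dual E3) (dilate l g) \<le> C3 * l powr \<sigma>3 * nrm (dual E3) g"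
        using C3(2)[OF l g] by simp_all
      have hl: "dilate l h \<in> points (dual E4)" using C4(2)[OF l h(1)] by simp
      obtain h' where h': "is_product (dilate l f) (dilate l g) h'"
          "nrm (dual E4) h' \<le> C * nrm (dual E) (dilate l f) * nrm (dual E3) (dilate l g)"
        using prod[OF fl(1) gl(1)] by blast
      \<comment> \<open>The product estimate for the dilated factors produces some h'; uniqueness
        shows that it is the dilate of h, so undoing the dilation compares h with itself.\<close>
      have "is_product (dilate l f) (dilate l g) (dilate l h)"
        by (rule is_product_dilate[OF l h(2) E.dual_tempered[OF fl(1)] E3.dual_tempered[OF gl(1)] E4.dual_tempered[OF hl]])
      then have e: "h' = dilate l h" by (rule is_product_unique[OF h'(1)])
      have "nrm (dual E4) h = nrm (dual E4) (dilate x (dilate l h))"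
        using dilate_dilate_inverse[OF l E4.dual_tempered[OF h(1)]] by (simp add: lx)
      also have "\<dots> \<le> C4 * x powr \<sigma>4 * nrm (dual E4) (dilate l h)" using C4(2)[OF x hl] by simp
      also have "\<dots> \<le> C4 * x powr \<sigma>4 * (C * (CE * l powr \<sigma>E * nrm (dual E) f) * (C3 * l powr \<sigma>3 * nrm (dual E3) g))"
      proof (rule mult_left_mono)
        have "C * nrm (dual E) (dilate l f) * nrm (dual E3) (dilate l g) \<le>
            C * (CE * l powr \<sigma>E * nrm (dual E) f) * (C3 * l powr \<sigma>3 * nrm (dual E3) g)"
          using C CE(1) fl gl E.nrm_dual_nonneg[OF f] E3.nrm_dual_nonneg[OF gl(1)]
          by (intro mult_mono mult_left_mono) simp_all
        then show "nrm (dual E4) (dilate l h) \<le> C * (CE * l powr \<sigma>E * nrm (dual E) f) * (C3 * l powr \<sigma>3 * nrm (dual E3) g)"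
          using h'(2) by (simp add: e)
      qed (use C4 in simp)
      also have "\<dots> = A * (x powr \<sigma>4 * (l powr \<sigma>E * l powr \<sigma>3))" by (simp add: A_def mult_ac)
      also have "x powr \<sigma>4 * (l powr \<sigma>E * l powr \<sigma>3) = x powr (\<sigma>4 - \<sigma>E - \<sigma>3)"
        using x by (simp add: l_def powr_divide powr_diff)
      finally show ?thesis .
    qed
    \<comment> \<open>In this case \<sigma>4 - \<sigma>E - \<sigma>3 < 0, so the bound tends to 0
      and the product estimate holds with constant 0.\<close>
    have "((\<lambda>x. A * x powr (\<sigma>4 - \<sigma>E - \<sigma>3)) \<longlongrightarrow> A * 0) at_top"
      using False by (intro tendsto_mult tendsto_const tendsto_neg_powr filterlim_ident) simp
    moreover have "eventually (\<lambda>x. nrm (dual E4) h \<le> A * x powr (\<sigma>4 - \<sigma>E - \<sigma>3)) at_top"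
      using eventually_gt_at_top[of 0] by eventually_elim (rule bound)
    ultimately have "nrm (dual E4) h \<le> A * 0" by (rule tendsto_lowerbound) simp
    then show ?thesis using h by auto
  qed
  then show ?thesis by (intro exI[of _ 0]) auto
qed

text \<open>Gathers what the uniqueness lemma asks of one solution on a compact time interval. The
  substance is the last claim, which starts from distance 0 at time 0: U(t)u0 lies in
  \<open>Y\<close> for t > 0 and tends to u0.\<close>

lemma (in critical_setting) mild_solution_properties:
  assumes cu: "\<And>j. continuous_into (time_interval T) (dual E) (\<lambda>t. u t j)"
    and mu: "mild_solution E T u0 u" and u0: "\<And>j. u0 j \<in> heat_continuity_space (dual E)"
    and t1: "t1 \<in> time_interval T" and s: "s \<in> {0..t1}"
  shows "vfield_in (dual E) (u s)"
    and "((\<lambda>r. vnorm (dual E) (vdiff (u r) (u s))) \<longlongrightarrow> 0) (at s within {0..t1})"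
    and "\<exists>w. is_bilinear E u u s w \<and> u s = vadd (\<lambda>j. heat s (u0 j)) w"
    and "u 0 = u0" and "dist_Y (u s) = 0"
proof -
  have sub: "{0..t1} \<subseteq> time_interval T"
    using t1 by (auto simp: time_interval_def intro: le_less_trans[of "ereal _" "ereal t1" T])
  have uE: "vfield_in (dual E) (u s)" if "s \<in> {0..t1}" for s
    using that sub by (intro E.continuous_into_vnorm(1)[OF cu]) auto
  have uc: "((\<lambda>r. vnorm (dual E) (vdiff (u r) (u s))) \<longlongrightarrow> 0) (at s within {0..t1})" if "s \<in> {0..t1}" for s
    using that sub by (intro tendsto_within_subset[OF E.continuous_into_vnorm(2)[OF cu] sub]) auto
  have m: "\<exists>w. is_bilinear E u u s w \<and> u s = vadd (\<lambda>j. heat s (u0 j)) w" if s: "s \<in> {0..t1}" for s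
  proof -
    obtain w where "is_bilinear E u u s w" "\<forall>j. u s j = dist_add (heat s (u0 j)) (w j)"
      using mu s sub unfolding mild_solution_def by blast
    then show ?thesis by (intro exI[of _ w]) (simp add: vadd_def fun_eq_iff)
  qed
  have z: "0 \<in> {0..t1}" using s by simp
  \<comment> \<open>The bilinear term vanishes at time 0 and U(0) is the identity, so the mild
    formulation fixes the initial value.\<close>
  obtain w where w: "is_bilinear E u u 0 w" "u 0 = vadd (\<lambda>j. heat 0 (u0 j)) w" using m[OF z] by blast
  show u00: "u 0 = u0"
    unfolding w(2) E.is_bilinear_zero_time[OF w(1)] by (simp add: heat_def vdiff_algebra)
  have u0E: "vfield_in (dual E) u0" using uE[OF z] u00 by simp
  have hY: "(\<lambda>j. heat t (u0 j)) \<in> Y" if "t > 0" for t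
    using E.heat_continuity_space(1,2)[OF u0] heat3[OF that] that by (simp add: Y_def vfield_in_def)
  have hE: "vfield_in (dual E) (\<lambda>j. heat t (u0 j))" if "t > 0" for t
    using hY[OF that] by (simp add: Y_def)
  have "((\<lambda>t. \<Sum>j\<in>UNIV. nrm (dual E) (dist_diff (heat t (u0 j)) (u0 j))) \<longlongrightarrow> (\<Sum>j\<in>(UNIV :: 'n set). 0)) (at_right 0)"
    by (intro tendsto_sum E.heat_continuity_space(3) u0)
  then have "((\<lambda>t. vnorm (dual E) (vdiff (\<lambda>j. heat t (u0 j)) u0)) \<longlongrightarrow> 0) (at_right 0)"
    by (simp add: vnorm_def vdiff_def)
  moreover have "eventually (\<lambda>t. dist_Y u0 \<le> vnorm (dual E) (vdiff (\<lambda>j. heat t (u0 j)) u0)) (at_right 0)"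
    using eventually_at_right_less[of 0]
  proof eventually_elim
    case (elim t)
    show ?case using dist_Y_le[OF u0E hY[OF elim]] E.vnorm_vdiff_commute[OF u0E hE[OF elim]] by simp
  qed
  ultimately have "dist_Y u0 \<le> 0" by (rule tendsto_lowerbound) simp
  then have d0: "dist_Y (u 0) = 0" using dist_Y_nonneg[OF u0E] u00 by simp
  show "dist_Y (u s) = 0"
  proof (rule solution_dist_Y[OF uE uc _ d0 s])
    fix t assume t: "t \<in> {0<..t1}"
    then have t0: "t > 0" and t': "t \<in> {0..t1}" by simp_all
    show "\<exists>h\<in>Y. \<exists>w. is_bilinear E u u t w \<and> u t = vadd h w"
      using m[OF t'] hY[OF t0] by blast
  qed
  show "vfield_in (dual E) (u s)" by (rule uE[OF s])
  show "((\<lambda>r. vnorm (dual E) (vdiff (u r) (u s))) \<longlongrightarrow> 0) (at s within {0..t1})" by (rule uc[OF s])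
  show "\<exists>w. is_bilinear E u u s w \<and> u s = vadd (\<lambda>j. heat s (u0 j)) w" by (rule m[OF s])
qed

theorem theorem7p1:
  fixes E E3 E4 :: "('n::finite) dist_space"
    and \<sigma>E \<sigma>3 \<sigma>4 :: real
    and T :: ereal
    and u0 :: "'n \<Rightarrow> 'n dist"
    and u v :: "real \<Rightarrow> 'n \<Rightarrow> 'n dist"
  assumes dim: "CARD('n) \<ge> 3"
    and E: "class_G E" "schwartz_dense E" "scaling_exponent (dual E) \<sigma>E" "\<sigma>E = -1"
    and bilinear: "bilinear_estimate E"
    and E3: "class_G E3" "schwartz_dense E3" "scaling_exponent (dual E3) \<sigma>3"
    and E4: "class_G E4" "schwartz_dense E4" "scaling_exponent (dual E4) \<sigma>4"
    and U1: "-1 < \<sigma>3" "\<sigma>3 < 1"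
    and U2: "\<exists>C>0. \<forall>s>0. \<forall>f\<in>points (dual E3).
               heat s f \<in> points (dual E3) \<and> nrm (dual E3) (heat s f) \<le> C * nrm (dual E3) f"
    and U3: "\<exists>C>0. \<forall>s>0. \<forall>f\<in>points (dual E).
               heat s f \<in> points (dual E3) \<and>
               nrm (dual E3) (heat s f) \<le> C * s powr ((\<sigma>E - \<sigma>3) / 2) * nrm (dual E) f"
    and U4: "\<exists>C>0. \<forall>f\<in>points (dual E). \<forall>g\<in>points (dual E3). \<exists>h\<in>points (dual E4).
               is_product f g h \<and> nrm (dual E4) h \<le> C * nrm (dual E) f * nrm (dual E3) g"
    and U5: "\<exists>C>0. \<forall>s>0. \<forall>f. vfield_in (dual E4) f \<longrightarrow>
               (\<exists>g. (\<forall>l j. grad_heat_leray s f l j (g l j) \<and> g l j \<in> points (dual E)) \<and>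
                    (\<Sum>l\<in>UNIV. \<Sum>j\<in>UNIV. nrm (dual E) (g l j))
                      \<le> C * s powr ((\<sigma>4 - \<sigma>E) / 2 - 1 / 2) * vnorm (dual E4) f)"
    and T: "T > 0"
    and u0: "\<And>j. u0 j \<in> heat_continuity_space (dual E)"
    and u: "\<And>j. continuous_into (time_interval T) (dual E) (\<lambda>t. u t j)" "mild_solution E T u0 u"
    and v: "\<And>j. continuous_into (time_interval T) (dual E) (\<lambda>t. v t j)" "mild_solution E T u0 v"
  shows "\<forall>t\<in>time_interval T. u t = v t"
proof -
  have dE: "dense_space E" and dE3: "dense_space E3" and dE4: "dense_space E4"
    using E E3 E4 by (simp_all add: dense_space_def class_G_def)
  interpret E: dense_space E by (rule dE)
  interpret E3: dense_space E3 by (rule dE3)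
  obtain K where K: "K > 0" and bil: "\<forall>T>0. \<forall>u v.
        Linfty (open_time_interval T) (dual E) u \<longrightarrow>
        Linfty (open_time_interval T) (dual E) v \<longrightarrow>
        (\<forall>t\<in>open_time_interval T. \<exists>w. is_bilinear E u v t w \<and>
           vnorm (dual E) w \<le> K * (SUP s\<in>open_time_interval T. vnorm (dual E) (u s))
                                * (SUP s\<in>open_time_interval T. vnorm (dual E) (v s)))"
    using bilinear unfolding bilinear_estimate_def by blast
  obtain C3 where C3: "C3 > 0" "\<forall>s>0. \<forall>f\<in>points (dual E).
               heat s f \<in> points (dual E3) \<and>
               nrm (dual E3) (heat s f) \<le> C3 * s powr ((\<sigma>E - \<sigma>3) / 2) * nrm (dual E) f"
    using U3 by blast
  define b where "b = (\<sigma>4 - \<sigma>E) / 2 - 1 / 2"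
  obtain C5 where C5: "C5 > 0" and grad: "\<forall>s>0. \<forall>f. vfield_in (dual E4) f \<longrightarrow>
               (\<exists>g. (\<forall>l j. grad_heat_leray s f l j (g l j) \<and> g l j \<in> points (dual E)) \<and>
                    (\<Sum>l\<in>UNIV. \<Sum>j\<in>UNIV. nrm (dual E) (g l j))
                      \<le> C5 * s powr b * vnorm (dual E4) f)"
    using U5 unfolding b_def by blast
  obtain C4 where C4: "C4 > 0" "\<forall>f\<in>points (dual E). \<forall>g\<in>points (dual E3). \<exists>h\<in>points (dual E4).
               is_product f g h \<and> nrm (dual E4) h \<le> C4 * nrm (dual E) f * nrm (dual E3) g"
    using U4 by blast
  obtain C where C: "C \<ge> 0" and prod: "\<forall>f\<in>points (dual E). \<forall>g\<in>points (dual E3). \<exists>h\<in>points (dual E4).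
      is_product f g h \<and> nrm (dual E4) h \<le> C * nrm (dual E) f * nrm (dual E3) g"
      and dich: "C = 0 \<or> \<sigma>E + \<sigma>3 \<le> \<sigma>4"
    using product_scaling[OF dE dE3 dE4 E(3) E3(3) E4(3) C4(1)] C4(2) by blast
  \<comment> \<open>If b \<le> -1, then \<sigma>4 \<le> \<sigma>E - 1 < \<sigma>E + \<sigma>3 by
    \<sigma>3 > -1, so the product constant is C = 0 and any exponent may stand in the estimate; 0
    is taken.\<close>
  define \<beta> where "\<beta> = (if b > -1 then b else 0)"
  have \<beta>: "\<beta> > -1" by (simp add: \<beta>_def)
  have Cb: "C5 * s powr b * C = C5 * C * s powr \<beta>" for s
  proof (cases "b > -1")
    case False
    then have "\<not> \<sigma>E + \<sigma>3 \<le> \<sigma>4" using U1 by (simp add: b_def field_simps)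
    with dich have "C = 0" by simp
    then show ?thesis by simp
  qed (simp add: \<beta>_def)
  \<comment> \<open>Choice over pairs gives one function \<open>H\<close> for all component
    products, so that the tensor can be written down entry by entry.\<close>
  have "\<forall>p. \<exists>h. fst p \<in> points (dual E) \<longrightarrow> snd p \<in> points (dual E3) \<longrightarrow> h \<in> points (dual E4) \<and>
      is_product (fst p) (snd p) h \<and> nrm (dual E4) h \<le> C * nrm (dual E) (fst p) * nrm (dual E3) (snd p)"
    using prod by blast
  from choice[OF this] obtain H where H: "\<forall>p. fst p \<in> points (dual E) \<longrightarrow> snd p \<in> points (dual E3) \<longrightarrow> H p \<in> points (dual E4) \<and>
      is_product (fst p) (snd p) (H p) \<and> nrm (dual E4) (H p) \<le> C * nrm (dual E) (fst p) * nrm (dual E3) (snd p)" ..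
  have estimate: "\<exists>D. tensor_of flip s a f D \<and> vfield_in (dual E) D \<and>
          vnorm (dual E) D \<le> C5 * C * s powr \<beta> * vnorm (dual E) a * vnorm (dual E3) f"
    if s: "s > 0" and a: "vfield_in (dual E) a" and f: "vfield_in (dual E3) f" for flip s a f
  proof -
    have B: "0 \<le> C5 * s powr b" using C5 by simp
    have H': "H (a l, f k) \<in> points (dual E4)" "is_product (a l) (f k) (H (a l, f k))"
        "nrm (dual E4) (H (a l, f k)) \<le> C * nrm (dual E) (a l) * nrm (dual E3) (f k)" for l k
      using H[rule_format, of "(a l, f k)"] a f by (simp_all add: vfield_in_def)
    have "(\<Sum>l\<in>UNIV. \<Sum>k\<in>UNIV. nrm (dual E4) (H (a l, f k))) \<le>
        (\<Sum>l\<in>UNIV. \<Sum>k\<in>UNIV. C * nrm (dual E) (a l) * nrm (dual E3) (f k))"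
      by (intro sum_mono H')
    also have "\<dots> = C * (vnorm (dual E) a * vnorm (dual E3) f)"
      unfolding vnorm_def sum_product by (simp add: sum_distrib_left mult.assoc)
    finally have S: "(\<Sum>l\<in>UNIV. \<Sum>k\<in>UNIV. nrm (dual E4) (H (a l, f k))) \<le> C * (vnorm (dual E) a * vnorm (dual E3) f)" .
    have S': "(\<Sum>l\<in>UNIV. \<Sum>k\<in>UNIV. nrm (dual E4) (H (a k, f l))) \<le> C * (vnorm (dual E) a * vnorm (dual E3) f)"
      by (subst sum.swap) (rule S)
    have g: "\<exists>g. (\<forall>l j. grad_heat_leray s f l j (g l j) \<and> g l j \<in> points (dual E)) \<and>
        (\<Sum>l\<in>UNIV. \<Sum>j\<in>UNIV. nrm (dual E) (g l j)) \<le> (C5 * s powr b) * vnorm (dual E4) f"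
      if "vfield_in (dual E4) f" for f using grad s that by blast
    have fin: "(C5 * s powr b) * (C * (vnorm (dual E) a * vnorm (dual E3) f)) =
        C5 * C * s powr \<beta> * vnorm (dual E) a * vnorm (dual E3) f"
      unfolding Cb[symmetric] by simp
    show ?thesis
    proof (cases flip)
      case True
      \<comment> \<open>With the factors exchanged the rows are indexed by the components of f,
        hence the transposed family of products and the commutativity of the product.\<close>
      obtain D where D: "div_heat_leray_tensor s f a D" "vfield_in (dual E) D"
          "vnorm (dual E) D \<le> (C5 * s powr b) * (\<Sum>l\<in>UNIV. \<Sum>k\<in>UNIV. nrm (dual E4) (H (a k, f l)))"
        using tensor_from_products[OF dE dE4 B g, of f a "\<lambda>l k. H (a k, f l)"] H'(1) H'(2)[unfolded is_product_commute[of "a _"]]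
        by blast
      have "vnorm (dual E) D \<le> (C5 * s powr b) * (C * (vnorm (dual E) a * vnorm (dual E3) f))"
        using D(3) mult_left_mono[OF S' B] by simp
      then show ?thesis using D True unfolding fin tensor_of_def by (intro exI[of _ D]) simp
    next
      case False
      obtain D where D: "div_heat_leray_tensor s a f D" "vfield_in (dual E) D"
          "vnorm (dual E) D \<le> (C5 * s powr b) * (\<Sum>l\<in>UNIV. \<Sum>k\<in>UNIV. nrm (dual E4) (H (a l, f k)))"
        using tensor_from_products[OF dE dE4 B g, of a f "\<lambda>l k. H (a l, f k)"] H'(1,2) by blast
      have "vnorm (dual E) D \<le> (C5 * s powr b) * (C * (vnorm (dual E) a * vnorm (dual E3) f))"
        using D(3) mult_left_mono[OF S B] by simp
      then show ?thesis using D False unfolding fin tensor_of_def by (intro exI[of _ D]) simp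
    qed
  qed
  \<comment> \<open>The constants multiply to C5 C, and \<gamma> is the exponent of (U3).\<close>
  interpret critical_setting E E3 K "C5 * C" \<beta> C3 "(\<sigma>E - \<sigma>3) / 2"
  proof (unfold_locales)
    show "0 \<le> C5 * C" using C5 C by simp
  qed (use K bil \<beta> C3 estimate in simp_all)
  show ?thesis
  proof
    fix t1 assume t1: "t1 \<in> time_interval T"
    note U = mild_solution_properties[OF u u0 t1] and V = mild_solution_properties[OF v u0 t1]
    have t10: "t1 \<ge> 0" using t1 by (simp add: time_interval_def)
    have z: "0 \<in> {0..t1}" using t10 by simp
    have uv: "u 0 = v 0" using U(4)[OF z] V(4)[OF z] by simp
    show "u t1 = v t1"
    proof (cases "t1 = 0")
      case False
      then have t1p: "t1 > 0" using t10 by simp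
      show ?thesis
      proof (rule solution_unique[OF t1p U(1) V(1) U(2) V(2) U(5) V(5) _ uv])
        fix t assume "t \<in> {0<..t1}"
        then have t: "t \<in> {0..t1}" by simp
        show "\<exists>h wu wv. is_bilinear E u u t wu \<and> is_bilinear E v v t wv \<and> u t = vadd h wu \<and> v t = vadd h wv"
          using U(3)[OF t] V(3)[OF t] by blast
      qed (use t10 in simp_all)
    qed (use uv in simp)
  qed
qed

end
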